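(* Let $\mathcal H$ be an infinite-dimensional complex Hilbert space and let $T\in\mathcal B(\mathcal H)$. There exists a sequence $(K_n)_{n\ge1}$ of compact operators on $\mathcal H$ such that for every polynomial $p$ with complex coefficients, $$\|p(T+K_n)\|\to\|p(T)\|_e\quad\text{as } n\to\infty.$$
   Context: $\mathcal B(\mathcal H)$ is the algebra of bounded operators on $\mathcal H$ and $\mathcal K(\mathcal H)$ the ideal of compact operators. The essential norm $\|X\|_e$ of $X\in\mathcal B(\mathcal H)$ is the norm of the image of $X$ in the Calkin algebra $\mathcal B(\mathcal H)/\mathcal K(\mathcal H)$. *)

theory Defs
  imports "HOL-Analysis.Analysis" "HOL-Computational_Algebra.Polynomial"
begin

section \<open>Complex Hilbert spaces\<close>

class complex_vector = real_vector +
  fixes scaleC :: "complex \<Rightarrow> 'a \<Rightarrow> 'a" (infixr "*\<^sub>C" 75)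
  assumes scaleC_add_right: "a *\<^sub>C (x + y) = a *\<^sub>C x + a *\<^sub>C y"
    and scaleC_add_left: "(a + b) *\<^sub>C x = a *\<^sub>C x + b *\<^sub>C x"
    and scaleC_scaleC: "a *\<^sub>C (b *\<^sub>C x) = (a * b) *\<^sub>C x"
    and scaleC_one: "1 *\<^sub>C x = x"
    and scaleR_eq_scaleC: "r *\<^sub>R x = complex_of_real r *\<^sub>C x"

global_interpretation complex_vector: vector_space "scaleC :: complex \<Rightarrow> 'a \<Rightarrow> 'a::complex_vector"
  defines cspan = complex_vector.span
  by unfold_locales
    (simp_all add: scaleC_add_right scaleC_add_left scaleC_scaleC scaleC_one)

text \<open>
  The complex inner product is linear in its first argument. Its real part is the inner product
  of \<^class>\<open>real_inner\<close>, so that norm, metric and topology are the library's; the usual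
  positivity and norm laws follow (see the two lemmas below).
\<close>

class complex_inner = complex_vector + real_inner +
  fixes cinner :: "'a \<Rightarrow> 'a \<Rightarrow> complex"
  assumes cinner_commute: "cinner x y = cnj (cinner y x)"
    and cinner_add_left: "cinner (x + y) z = cinner x z + cinner y z"
    and cinner_scaleC_left: "cinner (a *\<^sub>C x) y = a * cinner x y"
    and Re_cinner: "Re (cinner x y) = inner x y"

lemma cinner_self: "cinner x x = complex_of_real ((norm x)\<^sup>2)"
proof (rule complex_eqI)
  show "Re (cinner x x) = Re (complex_of_real ((norm x)\<^sup>2))"
    by (simp add: Re_cinner power2_norm_eq_inner)
  have "Im (cinner x x) = - Im (cinner x x)"
    using arg_cong[OF cinner_commute[of x x], of Im] by (simp only: cnj.simps)
  then show "Im (cinner x x) = Im (complex_of_real ((norm x)\<^sup>2))"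
    by simp
qed

lemma cinner_self_eq_zero_iff: "cinner x x = 0 \<longleftrightarrow> x = 0"
  by (simp add: cinner_self)

class chilbert_space = complex_inner + complete_space

definition infinite_dimensional :: "'a::complex_vector itself \<Rightarrow> bool" where
  "infinite_dimensional _ \<longleftrightarrow> \<not> (\<exists>B :: 'a set. finite B \<and> cspan B = UNIV)"


section \<open>Bounded and compact operators\<close>

definition bounded_clinear :: "('a::complex_inner \<Rightarrow> 'a) \<Rightarrow> bool" where
  "bounded_clinear T \<longleftrightarrow> bounded_linear T \<and> (\<forall>c x. T (c *\<^sub>C x) = c *\<^sub>C T x)"

definition compact_operator :: "('a::complex_inner \<Rightarrow> 'a) \<Rightarrow> bool" where
  "compact_operator K \<longleftrightarrow> bounded_clinear K \<and> compact (closure (K ` cball 0 1))"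

text \<open>
  Elements of the Calkin algebra are cosets of the ideal of compact operators, and the norm of
  a coset in the quotient is the infimum of the operator norms of its representatives.
\<close>

definition calkin_class :: "('a::complex_inner \<Rightarrow> 'a) \<Rightarrow> ('a \<Rightarrow> 'a) set" where
  "calkin_class X = {(\<lambda>x. X x + K x) | K. compact_operator K}"

definition essential_norm :: "('a::complex_inner \<Rightarrow> 'a) \<Rightarrow> real" where
  "essential_norm X = (INF Y \<in> calkin_class X. onorm Y)"

definition poly_op :: "complex poly \<Rightarrow> ('a::complex_inner \<Rightarrow> 'a) \<Rightarrow> 'a \<Rightarrow> 'a" where
  "poly_op p T = (\<lambda>x. \<Sum>i\<le>degree p. coeff p i *\<^sub>C (T ^^ i) x)"

end

theory Submission
  imports Defs "HOL-Complex_Analysis.Complex_Analysis"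
    "HOL-Computational_Algebra.Fundamental_Theorem_Algebra"
begin

text \<open>
  Write \<open>\<parallel>X\<parallel>\<^sub>e\<close> for the essential norm. If \<open>K\<close> is compact, then \<open>p(T + K)\<close> is a compact
  perturbation of \<open>p(T)\<close>, so \<open>\<parallel>p(T + K)\<parallel> \<ge> \<parallel>p(T)\<parallel>\<^sub>e\<close>; the content is the upper bound. Both sides depend
  continuously on the coefficients of \<open>p\<close>, uniformly as long as \<open>T + K\<close> stays bounded, so a diagonal
  argument over the countably many polynomials with rational coefficients leaves the following
  problem: given finitely many \<open>p\<^sub>i\<close> and \<open>\<epsilon> > 0\<close>, find \<open>K\<close> of finite rank with
  \<open>\<parallel>p\<^sub>i(T + K)\<parallel> \<le> \<parallel>p\<^sub>i(T)\<parallel>\<^sub>e + \<epsilon>\<close> for all \<open>i\<close> (\<open>ex_finrank_perturbation\<close>). Compact operators are norm limits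
  of finite-rank ones, so after rescaling the \<open>p\<^sub>i\<close> one has \<open>p\<^sub>i(T) = Y\<^sub>i + F\<^sub>i\<close> with \<open>\<parallel>Y\<^sub>i\<parallel> < 1\<close> and \<open>F\<^sub>i\<close> of
  finite rank, and the bound to reach is \<open>1 + \<epsilon>\<close>.

  The main tool is a similarity: if \<open>S - 1\<close> has finite rank, then so has \<open>S T S\<^sup>-\<^sup>1 - T\<close>, and
  \<open>p(S T S\<^sup>-\<^sup>1) = S p(T) S\<^sup>-\<^sup>1\<close> for all \<open>p\<close> at once. Suppose that the powers of every \<open>X\<^sub>i = p\<^sub>i(T)\<close> decay
  geometrically. As in Rota's characterisation of the spectral radius one then renorms the space by
  \<open>\<parallel>x\<parallel>\<^sup>2 + \<Sum>\<^sub>n D(X\<^sup>n x)\<close>, where \<open>n\<close> ranges over multi-indices and the quadratic form \<open>D\<close> bounds all the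
  excesses \<open>\<parallel>X\<^sub>i x\<parallel>\<^sup>2 - \<parallel>x\<parallel>\<^sup>2\<close>. All \<open>X\<^sub>i\<close> become contractions in this norm. Since \<open>X\<^sub>i\<close> is a strict contraction
  up to finite rank, \<open>D\<close> can be taken of finite rank; truncating the sum costs an \<open>\<epsilon>\<close>, and then the
  new norm is \<open>\<parallel>S x\<parallel>\<close> with \<open>S - 1\<close> of finite rank (\<open>simultaneous_similarity\<close>). This renorming of a
  commuting family relative to an ideal is due to Loring and Shulman.

  The powers fail to decay when \<open>T\<close> has eigenvalues at which some \<open>p\<^sub>i\<close> has modulus at least \<open>1\<close>; these
  are moved first. The resolvent of a finite-rank perturbation of a strict contraction is
  meromorphic on a disc of radius greater than \<open>1\<close>. Clearing its poles gives polynomials \<open>r\<^sub>i \<noteq> 0\<close>, with all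
  zeros outside the open unit disc, such that \<open>r\<^sub>i(X\<^sub>i) X\<^sub>i\<^sup>n\<close> decays geometrically
  (\<open>ex_unstable_annihilator\<close>). The product of the \<open>r\<^sub>i(X\<^sub>i)\<close> has a finite-dimensional \<open>T\<close>-invariant kernel
  \<open>M\<close>, and modulo \<open>M\<close> the powers of all \<open>X\<^sub>i\<close> decay. Replace \<open>T\<close> by its compression to the orthogonal
  complement of \<open>M\<close> plus a scalar \<open>z\<close> on \<open>M\<close>; this is a finite-rank change, and the powers decay as soon
  as \<open>\<bar>p\<^sub>i(z)\<bar> < 1\<close> for all \<open>i\<close>. Every point of the spectrum of the compression has this property, and the
  spectrum is not empty because the complement of \<open>M\<close> is not zero (\<open>ex_stable_point\<close>,
  \<open>ex_stable_perturbation\<close>).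
\<close>

section \<open>Complex inner product spaces\<close>

subclass (in chilbert_space) banach ..

lemma scaleC_zero_left [simp]: "0 *\<^sub>C (x::'a::complex_vector) = 0"
  by (rule complex_vector.scale_zero_left)
lemma scaleC_zero_right [simp]: "c *\<^sub>C (0::'a::complex_vector) = 0"
  by (rule complex_vector.scale_zero_right)
lemma scaleC_one' [simp]: "1 *\<^sub>C (x::'a::complex_vector) = x"
  by (rule scaleC_one)
lemma scaleC_minus_right: "c *\<^sub>C (- x) = - (c *\<^sub>C (x::'a::complex_vector))"
  by (rule complex_vector.scale_minus_right)
lemma scaleC_minus_left: "(- c) *\<^sub>C x = - (c *\<^sub>C (x::'a::complex_vector))"
  by (rule complex_vector.scale_minus_left)
lemma scaleC_diff_right: "c *\<^sub>C (x - y) = c *\<^sub>C x - c *\<^sub>C (y::'a::complex_vector)"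
  by (rule complex_vector.scale_right_diff_distrib)
lemma scaleC_diff_left: "(b - c) *\<^sub>C x = b *\<^sub>C x - c *\<^sub>C (x::'a::complex_vector)"
  by (rule complex_vector.scale_left_diff_distrib)
lemma scaleC_sum_left: "(\<Sum>i\<in>I. f i) *\<^sub>C x = (\<Sum>i\<in>I. f i *\<^sub>C (x::'a::complex_vector))"
  by (rule complex_vector.scale_sum_left)

lemma norm_scaleC: "norm (c *\<^sub>C x) = cmod c * norm (x::'a::complex_inner)"
proof -
  have "complex_of_real ((norm (c *\<^sub>C x))\<^sup>2) = cinner (c *\<^sub>C x) (c *\<^sub>C x)"
    by (simp add: cinner_self)
  also have "\<dots> = c * cnj (c * cinner x x)"
    by (simp add: cinner_scaleC_left, subst cinner_commute, simp add: cinner_scaleC_left)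
  also have "\<dots> = (c * cnj c) * cnj (cinner x x)" by simp
  also have "\<dots> = complex_of_real ((cmod c * norm x)\<^sup>2)"
    by (simp only: complex_norm_square[symmetric] cinner_self) (simp add: power_mult_distrib)
  finally have "(norm (c *\<^sub>C x))\<^sup>2 = (cmod c * norm x)\<^sup>2" by (simp only: of_real_eq_iff)
  then show ?thesis by (simp add: power2_eq_iff_nonneg)
qed

lemma cinner_scaleC_right: "cinner x (c *\<^sub>C y) = cnj c * cinner x y"
  by (subst (1 2) cinner_commute) (simp add: cinner_scaleC_left)
lemma cinner_add_right: "cinner x (y + z) = cinner x y + cinner x z"
  by (subst (1 2 3) cinner_commute) (simp add: cinner_add_left)
lemma cinner_zero_left [simp]: "cinner 0 x = 0"
  using cinner_scaleC_left[of 0 0 x] by simp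
lemma cinner_zero_right [simp]: "cinner x 0 = 0"
  using cinner_scaleC_right[of x 0 0] by simp
lemma cinner_minus_left: "cinner (- x) y = - cinner x y"
  using cinner_scaleC_left[of "-1" x y] by (simp add: scaleC_minus_left)
lemma cinner_minus_right: "cinner x (- y) = - cinner x y"
  using cinner_scaleC_right[of x "-1" y] by (simp add: scaleC_minus_left)
lemma cinner_diff_left: "cinner (x - y) z = cinner x z - cinner y z"
  using cinner_add_left[of x "-y" z] by (simp add: cinner_minus_left)
lemma cinner_diff_right: "cinner x (y - z) = cinner x y - cinner x z"
  using cinner_add_right[of x y "-z"] by (simp add: cinner_minus_right)

lemma norm_cinner_le: "cmod (cinner x y) \<le> norm x * norm y"
proof (cases "cinner x y = 0")
  case False
  define u where "u = cnj (cinner x y) / cmod (cinner x y)"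
  have u: "cmod u = 1" using False by (simp add: u_def norm_divide)
  have "cmod (cinner x y) = Re (cinner (u *\<^sub>C x) y)"
  proof -
    have "u * cinner x y = (cinner x y * cnj (cinner x y)) / cmod (cinner x y)"
      by (simp add: u_def mult.commute)
    also have "\<dots> = complex_of_real (cmod (cinner x y))"
      using False by (simp only: complex_norm_square[symmetric]) (simp add: power2_eq_square)
    finally show ?thesis by (simp add: cinner_scaleC_left)
  qed
  also have "\<dots> \<le> norm (u *\<^sub>C x) * norm y"
    unfolding Re_cinner by (rule norm_cauchy_schwarz)
  finally show ?thesis by (simp add: norm_scaleC u)
qed auto

lemmas cinner_simps = cinner_add_left cinner_add_right cinner_diff_left cinner_diff_right
  cinner_scaleC_left cinner_scaleC_right cinner_minus_left cinner_minus_right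

lemma norm_pythagoras:
  fixes x y :: "'a::complex_inner"
  assumes "cinner x y = 0"
  shows "(norm (x + y))\<^sup>2 = (norm x)\<^sup>2 + (norm y)\<^sup>2"
proof -
  have "inner x y = 0" using assms Re_cinner[of x y] by simp
  then show ?thesis by (simp add: power2_norm_eq_inner inner_add_left inner_add_right inner_commute)
qed

section \<open>The algebra of bounded operators\<close>

text \<open>
  Operators form a type of their own so that the algebraic and analytic type classes apply to them.
  The class \<open>ring_1\<close> is out of reach, because \<open>0 = 1\<close> holds when the underlying space is zero; \<open>ring\<close>
  together with \<open>monoid_mult\<close> still provides powers and power series.
\<close>

typedef (overloaded) 'a bop = "{f :: 'a::complex_inner \<Rightarrow> 'a. bounded_clinear f}"
  morphisms app Bop
proof
  show "(\<lambda>x. 0) \<in> {f :: 'a \<Rightarrow> 'a. bounded_clinear f}"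
    by (simp add: bounded_clinear_def)
qed

setup_lifting type_definition_bop

lemma bounded_clinear_app: "bounded_clinear (app A)"
  using app by blast
lemma bounded_linear_app: "bounded_linear (app A)"
  using bounded_clinear_app bounded_clinear_def by blast
lemma app_scaleC [simp]: "app A (c *\<^sub>C x) = c *\<^sub>C app A x"
  using bounded_clinear_app[of A] by (simp add: bounded_clinear_def)

lemmas app_zero_right [simp] = linear_0[OF bounded_linear.linear[OF bounded_linear_app]]
lemmas app_add_right = linear_add[OF bounded_linear.linear[OF bounded_linear_app]]
lemmas app_diff_right = linear_diff[OF bounded_linear.linear[OF bounded_linear_app]]
lemmas app_minus_right = linear_neg[OF bounded_linear.linear[OF bounded_linear_app]]
lemmas app_scaleR_right = linear_cmul[OF bounded_linear.linear[OF bounded_linear_app]]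
lemmas app_sum_right = linear_sum[OF bounded_linear.linear[OF bounded_linear_app]]
lemmas tendsto_app [tendsto_intros] = bounded_linear.tendsto[OF bounded_linear_app]
lemmas app_right_simps = app_add_right app_diff_right app_minus_right app_scaleR_right app_sum_right

instantiation bop :: (complex_inner) "{ring, monoid_mult, real_normed_algebra, complex_vector}"
begin

lift_definition zero_bop :: "'a bop" is "\<lambda>x. 0" by (simp add: bounded_clinear_def)
lift_definition one_bop :: "'a bop" is "\<lambda>x. x" by (simp add: bounded_clinear_def)
lift_definition plus_bop :: "'a bop \<Rightarrow> 'a bop \<Rightarrow> 'a bop" is "\<lambda>f g x. f x + g x"
  by (auto simp: bounded_clinear_def scaleC_add_right intro: bounded_linear_add)
lift_definition minus_bop :: "'a bop \<Rightarrow> 'a bop \<Rightarrow> 'a bop" is "\<lambda>f g x. f x - g x"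
  by (auto simp: bounded_clinear_def scaleC_diff_right intro: bounded_linear_sub)
lift_definition uminus_bop :: "'a bop \<Rightarrow> 'a bop" is "\<lambda>f x. - f x"
  by (auto simp: bounded_clinear_def scaleC_minus_right intro: bounded_linear_minus)
lift_definition times_bop :: "'a bop \<Rightarrow> 'a bop \<Rightarrow> 'a bop" is "\<lambda>f g x. f (g x)"
  by (auto simp: bounded_clinear_def intro: bounded_linear_compose)
lift_definition scaleC_bop :: "complex \<Rightarrow> 'a bop \<Rightarrow> 'a bop" is "\<lambda>c f x. c *\<^sub>C f x"
proof -
  fix c :: complex and f :: "'a \<Rightarrow> 'a" assume f: "bounded_clinear f"
  interpret bounded_linear f using f by (simp add: bounded_clinear_def)
  obtain K where K: "\<And>x. norm (f x) \<le> norm x * K" using bounded by blast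
  have fc: "f (b *\<^sub>C x) = b *\<^sub>C f x" for b x using f by (simp add: bounded_clinear_def)
  have "bounded_linear (\<lambda>x. c *\<^sub>C f x)"
  proof (rule bounded_linear_intro[where K="cmod c * K"])
    fix x show "norm (c *\<^sub>C f x) \<le> norm x * (cmod c * K)"
      using mult_left_mono[OF K[of x], of "cmod c"] by (simp add: norm_scaleC mult_ac)
  qed (simp_all add: add scaleC_add_right scaleR_eq_scaleC fc scaleC_scaleC mult.commute)
  then show "bounded_clinear (\<lambda>x. c *\<^sub>C f x)"
    by (simp add: bounded_clinear_def fc scaleC_scaleC mult.commute)
qed
definition "r *\<^sub>R (A :: 'a bop) = complex_of_real r *\<^sub>C A"
lift_definition norm_bop :: "'a bop \<Rightarrow> real" is onorm .
definition "dist (A :: 'a bop) B = norm (A - B)"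
definition "sgn (A :: 'a bop) = inverse (norm A) *\<^sub>R A"
definition "uniformity = (INF e\<in>{0<..}. principal {(A :: 'a bop, B). dist A B < e})"
definition "open U \<longleftrightarrow> (\<forall>A\<in>U. \<forall>\<^sub>F (A', B :: 'a bop) in uniformity. A' = A \<longrightarrow> B \<in> U)"

instance
proof
  fix A B C :: "'a bop" and r s :: real and a b :: complex
  show "A + B + C = A + (B + C)" by transfer (simp add: add.assoc)
  show "A + B = B + A" by transfer (simp add: add.commute)
  show "0 + A = A" by transfer simp
  show "- A + A = 0" by transfer simp
  show "A - B = A + - B" by transfer simp
  show "A * B * C = A * (B * C)" by transfer simp
  show "1 * A = A" by transfer simp
  show "A * 1 = A" by transfer simp
  show "(A + B) * C = A * C + B * C" by transfer simp
  show "A * (B + C) = A * B + A * C"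
    by transfer (auto simp: bounded_clinear_def linear_add bounded_linear.linear)
  show "a *\<^sub>C (A + B) = a *\<^sub>C A + a *\<^sub>C B" by transfer (simp add: scaleC_add_right)
  show "(a + b) *\<^sub>C A = a *\<^sub>C A + b *\<^sub>C A" by transfer (simp add: scaleC_add_left)
  show "a *\<^sub>C (b *\<^sub>C A) = (a * b) *\<^sub>C A" by transfer (simp add: scaleC_scaleC)
  show "1 *\<^sub>C A = A" by transfer simp
  show *: "r *\<^sub>R A = complex_of_real r *\<^sub>C A" for r and A :: "'a bop" by (simp add: scaleR_bop_def)
  show "r *\<^sub>R (A + B) = r *\<^sub>R A + r *\<^sub>R B" unfolding * by transfer (simp add: scaleC_add_right)
  show "(r + s) *\<^sub>R A = r *\<^sub>R A + s *\<^sub>R A" unfolding * by transfer (simp add: scaleC_add_left)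
  show "r *\<^sub>R s *\<^sub>R A = (r * s) *\<^sub>R A" unfolding * by transfer (simp add: scaleC_scaleC)
  show "1 *\<^sub>R A = A" unfolding * by transfer simp
  show "r *\<^sub>R A * B = r *\<^sub>R (A * B)" unfolding * by transfer simp
  show "A * r *\<^sub>R B = r *\<^sub>R (A * B)" unfolding * by transfer (simp add: bounded_clinear_def)
  show "dist A B = norm (A - B)" by (rule dist_bop_def)
  show "sgn A = inverse (norm A) *\<^sub>R A" by (rule sgn_bop_def)
  show "uniformity = (INF e\<in>{0<..}. principal {(A :: 'a bop, B). dist A B < e})"
    by (rule uniformity_bop_def)
  show "open U \<longleftrightarrow> (\<forall>A\<in>U. \<forall>\<^sub>F (A', B) in uniformity. A' = A \<longrightarrow> B \<in> U)" for U :: "'a bop set"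
    by (rule open_bop_def)
  show "(norm A = 0) = (A = 0)" by transfer (auto simp: bounded_clinear_def onorm_eq_0)
  show "norm (A + B) \<le> norm A + norm B" by transfer (simp add: bounded_clinear_def onorm_triangle)
  show "norm (r *\<^sub>R A) = \<bar>r\<bar> * norm A"
    unfolding * by transfer (simp add: bounded_clinear_def onorm_scaleR flip: scaleR_eq_scaleC)
  show "norm (A * B) \<le> norm A * norm B"
    by transfer (simp add: bounded_clinear_def onorm_compose[unfolded o_def])
qed

end

lemma app_zero [simp]: "app 0 x = 0" by transfer simp
lemma app_one [simp]: "app 1 x = x" by transfer simp
lemma app_add: "app (A + B) x = app A x + app B x" by transfer simp
lemma app_diff: "app (A - B) x = app A x - app B x" by transfer simp
lemma app_minus: "app (- A) x = - app A x" by transfer simp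
lemma app_mult: "app (A * B) x = app A (app B x)" by transfer simp
lemma app_cscale: "app (c *\<^sub>C A) x = c *\<^sub>C app A x" by transfer simp
lemma app_rscale: "app (c *\<^sub>R A) x = c *\<^sub>R app A x" by (simp add: scaleR_eq_scaleC app_cscale)
lemma app_sum: "app (\<Sum>i\<in>I. f i) x = (\<Sum>i\<in>I. app (f i) x)"
  by (induction I rule: infinite_finite_induct) (auto simp: app_add)
lemma app_power: "app (A ^ n) = app A ^^ n"
  by (induction n) (auto simp: fun_eq_iff app_mult)
lemmas app_simps = app_add app_diff app_minus app_mult app_cscale app_rscale app_sum

lemma bop_eqI: "(\<And>x. app A x = app B x) \<Longrightarrow> A = B"
  by (metis app_inject ext)

lemma norm_bop_onorm: "norm A = onorm (app A)" by transfer simp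
lemma norm_app: "norm (app A x) \<le> norm A * norm x"
  unfolding norm_bop_onorm by (rule onorm[OF bounded_linear_app])
lemma norm_bop_le: "0 \<le> b \<Longrightarrow> (\<And>x. norm (app A x) \<le> b * norm x) \<Longrightarrow> norm A \<le> b"
  unfolding norm_bop_onorm by (rule onorm_bound)

lemma ex_bop: 
  assumes "\<And>x y. f (x + y) = f x + f y" "\<And>c x. f (c *\<^sub>C x) = c *\<^sub>C f x" "\<And>x. norm (f x) \<le> norm x * K"
  shows "\<exists>A. \<forall>x. app A x = f x"
proof -
  have "bounded_clinear f"
    unfolding bounded_clinear_def
    by (auto simp: assms scaleR_eq_scaleC intro!: bounded_linear_intro[where K=K])
  then show ?thesis by (metis mem_Collect_eq Bop_inverse)
qed

lemma mult_cscale_left [simp]: "(c *\<^sub>C A) * B = c *\<^sub>C (A * (B::'a::complex_inner bop))"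
  by transfer simp
lemma mult_cscale_right [simp]: "A * (c *\<^sub>C B) = c *\<^sub>C (A * (B::'a::complex_inner bop))"
  by transfer (simp add: bounded_clinear_def)

lemma norm_cscale: "norm (c *\<^sub>C A) = cmod c * norm (A::'a::complex_inner bop)"
proof -
  have le: "norm (c *\<^sub>C A) \<le> cmod c * norm A" for c and A :: "'a bop"
    by (rule norm_bop_le) (auto simp: app_cscale norm_scaleC mult.assoc intro!: mult_left_mono norm_app)
  show ?thesis
  proof (cases "c = 0")
    case False
    have "cmod c * norm A = cmod c * norm (inverse c *\<^sub>C (c *\<^sub>C A))"
      using False by (simp add: scaleC_scaleC)
    also have "\<dots> \<le> cmod c * (cmod (inverse c) * norm (c *\<^sub>C A))"
      by (intro mult_left_mono le) auto
    also have "\<dots> = norm (c *\<^sub>C A)" using False by (simp add: norm_inverse)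
    finally show ?thesis using le[of c A] by simp
  qed simp
qed

lemma norm_one_bop_le: "norm (1::'a::complex_inner bop) \<le> 1"
  by (rule norm_bop_le) auto

lemma norm_power_le: "norm (A ^ n) \<le> norm (A::'a::complex_inner bop) ^ n"
proof (induction n)
  case (Suc n)
  have "norm (A ^ Suc n) \<le> norm A * norm (A ^ n)" by (simp add: norm_mult_ineq)
  also have "\<dots> \<le> norm A * norm A ^ n" using Suc by (intro mult_left_mono) auto
  finally show ?case by simp
qed (simp add: norm_one_bop_le)

lemma cscale_power: "(c *\<^sub>C A) ^ n = c ^ n *\<^sub>C (A ^ n :: 'a::complex_inner bop)"
  by (induction n) (auto simp: scaleC_scaleC mult.commute)

section \<open>Polynomials of operators\<close>

definition peval :: "complex poly \<Rightarrow> 'a::complex_inner bop \<Rightarrow> 'a bop" where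
  "peval p A = (\<Sum>i\<le>degree p. coeff p i *\<^sub>C A ^ i)"

lemma peval_bound: "degree p \<le> n \<Longrightarrow> peval p A = (\<Sum>i\<le>n. coeff p i *\<^sub>C A ^ i)"
  unfolding peval_def by (rule sum.mono_neutral_left) (auto simp: coeff_eq_0)

lemma peval_0 [simp]: "peval 0 A = 0" by (simp add: peval_def)
lemma peval_pCons: "peval (pCons a p) A = a *\<^sub>C 1 + A * peval p A"
proof -
  have "peval (pCons a p) A = (\<Sum>i\<le>Suc (degree p). coeff (pCons a p) i *\<^sub>C A ^ i)"
    by (rule peval_bound) (rule degree_pCons_le)
  also have "\<dots> = a *\<^sub>C 1 + (\<Sum>i\<le>degree p. coeff p i *\<^sub>C A ^ Suc i)"
    by (subst sum.atMost_Suc_shift) simp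
  also have "\<dots> = a *\<^sub>C 1 + A * peval p A"
    by (simp add: peval_def sum_distrib_left)
  finally show ?thesis .
qed
lemma peval_1 [simp]: "peval 1 A = 1" by (simp add: one_pCons peval_pCons)
lemma peval_const: "peval [:a:] A = a *\<^sub>C 1" by (simp add: peval_pCons)
lemma peval_add: "peval (p + q) A = peval p A + peval q A"
  by (induction p q rule: poly_induct2) (auto simp: peval_pCons scaleC_add_left algebra_simps)
lemma peval_smult: "peval (smult c p) A = c *\<^sub>C peval p A"
  by (induction p) (auto simp: peval_pCons scaleC_add_right scaleC_scaleC)
lemma peval_minus: "peval (- p) A = - peval p A"
  using peval_smult[of "-1" p A] by (simp add: scaleC_minus_left)
lemma peval_diff: "peval (p - q) A = peval p A - peval q A"
  using peval_add[of p "-q" A] by (simp add: peval_minus)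
lemma peval_mult: "peval (p * q) A = peval p A * peval q A"
  by (induction p) (auto simp: peval_pCons peval_add peval_smult algebra_simps)
lemma peval_power: "peval (p ^ n) A = peval p A ^ n"
  by (induction n) (auto simp: peval_mult)

lemma peval_commutes: "A * B = B * A \<Longrightarrow> peval p A * B = B * peval p A"
proof (induction p)
  case (pCons a p)
  then show ?case by (simp add: peval_pCons algebra_simps) (metis mult.assoc)
qed simp
lemma peval_commute: "peval p A * peval q A = peval q A * peval p A"
  by (metis peval_mult mult.commute)

lemma poly_op_app: "poly_op p (app A) = app (peval p A)"
  by (auto simp: poly_op_def peval_def fun_eq_iff app_sum app_cscale app_power)

section \<open>Finite-rank operators and compactness\<close>

text \<open>
  The zero operator counts as \<open>rank_one\<close>, which makes this class stable under composition with
  arbitrary operators.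
\<close>

definition rank_one :: "'a::complex_inner bop \<Rightarrow> bool" where
  "rank_one K \<longleftrightarrow> (\<exists>v. \<forall>x. \<exists>c. app K x = c *\<^sub>C v)"

inductive finrank :: "'a::complex_inner bop \<Rightarrow> bool" where
  zero: "finrank 0"
| add_rank_one: "finrank F \<Longrightarrow> rank_one K \<Longrightarrow> finrank (F + K)"

lemma rank_one_mult_left: "rank_one K \<Longrightarrow> rank_one (A * K)"
  unfolding rank_one_def by (metis app_mult app_scaleC)
lemma rank_one_mult_right: "rank_one K \<Longrightarrow> rank_one (K * A)"
  unfolding rank_one_def by (metis app_mult)
lemma rank_one_cscale: "rank_one K \<Longrightarrow> rank_one (c *\<^sub>C K)"
  unfolding rank_one_def by (metis app_cscale scaleC_scaleC)

lemma finrank_rank_one: "rank_one K \<Longrightarrow> finrank K"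
  using finrank.add_rank_one[OF finrank.zero] by simp
lemma finrank_add: "finrank G \<Longrightarrow> finrank F \<Longrightarrow> finrank (F + G)"
  by (induction rule: finrank.induct) (auto simp: add.assoc[symmetric] intro: finrank.intros)
lemma finrank_mult_left: "finrank F \<Longrightarrow> finrank (A * F)"
  by (induction rule: finrank.induct) (auto simp: distrib_left intro: finrank.intros rank_one_mult_left)
lemma finrank_mult_right: "finrank F \<Longrightarrow> finrank (F * A)"
  by (induction rule: finrank.induct) (auto simp: distrib_right intro: finrank.intros rank_one_mult_right)
lemma finrank_cscale: "finrank F \<Longrightarrow> finrank (c *\<^sub>C F)"
  by (induction rule: finrank.induct) (auto simp: scaleC_add_right intro: finrank.intros rank_one_cscale)
lemma finrank_minus: "finrank F \<Longrightarrow> finrank (- F)"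
  using finrank_cscale[of F "-1"] by (simp add: scaleC_minus_left)
lemma finrank_diff: "finrank F \<Longrightarrow> finrank G \<Longrightarrow> finrank (F - G)"
  using finrank_add[of "-G" F] finrank_minus[of G] by simp

lemma finrank_peval_diff:
  assumes "finrank (B - A)"
  shows "finrank (peval p B - peval p A)"
proof (induction p)
  case (pCons a p)
  have "peval (pCons a p) B - peval (pCons a p) A
      = B * (peval p B - peval p A) + (B - A) * peval p A"
    by (simp add: peval_pCons algebra_simps)
  with pCons assms show ?case by (auto intro: finrank_add finrank_mult_left finrank_mult_right)
qed (auto intro: finrank.zero)

lemma finrank_image_compact:
  assumes "finrank F"
  shows "\<exists>C. compact C \<and> app F ` cball 0 1 \<subseteq> C"
  using assms
proof (induction rule: finrank.induct)
  case zero
  show ?case by (rule exI[of _ "{0}"]) auto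
next
  case (add_rank_one F K)
  then obtain C where C: "compact C" "app F ` cball 0 1 \<subseteq> C" by blast
  obtain v where v: "\<And>x. \<exists>c. app K x = c *\<^sub>C v"
    using add_rank_one.hyps unfolding rank_one_def by blast
  define D where "D = (\<lambda>c. c *\<^sub>C v) ` cball 0 (norm K / norm v)"
  have "continuous_on UNIV (\<lambda>c. c *\<^sub>C v)"
  proof (rule linear_continuous_on)
    show "bounded_linear (\<lambda>c. c *\<^sub>C v)"
      by (rule bounded_linear_intro[where K="norm v"])
         (auto simp: norm_scaleC scaleC_add_left scaleR_eq_scaleC scaleC_scaleC scaleR_conv_of_real)
  qed
  then have "compact D" unfolding D_def
    by (intro compact_continuous_image) (auto intro: continuous_on_subset)
  moreover have "app K x \<in> D" if "x \<in> cball 0 1" for x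
  proof (cases "v = 0")
    case True
    then show ?thesis using v[of x] by (auto simp: D_def)
  next
    case False
    obtain c where c: "app K x = c *\<^sub>C v" using v by blast
    have "norm K * norm x \<le> norm K * 1" using that by (intro mult_left_mono) auto
    then have "cmod c * norm v \<le> norm K"
      using norm_app[of K x] by (simp add: c norm_scaleC)
    then show ?thesis using False by (auto simp: D_def c field_simps)
  qed
  ultimately show ?case using C
    by (intro exI[of _ "{x + y |x y. x \<in> C \<and> y \<in> D}"]) (fastforce simp: app_add intro!: compact_sums)
qed

lemma finrank_compact_operator:
  assumes "finrank F"
  shows "compact_operator (app F)"
proof -
  obtain C where C: "compact C" "app F ` cball 0 1 \<subseteq> C" using finrank_image_compact[OF assms] by blast
  then have "closure (app F ` cball 0 1) \<subseteq> C" by (simp add: closure_minimal compact_imp_closed)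
  with C(1) have "compact (closure (app F ` cball 0 1))"
    using compact_Int_closed[OF C(1) closed_closure, of "app F ` cball 0 1"] by (simp add: Int_absorb1)
  then show ?thesis by (simp add: compact_operator_def bounded_clinear_app)
qed

text \<open>
  The sequential form of compactness: it lets a finite-rank summand be discarded after passing to
  a subsequence.
\<close>

lemma finrank_convergent_subseq:
  fixes x :: "nat \<Rightarrow> 'a::complex_inner"
  assumes "finrank F" "\<And>k. norm (x k) \<le> B"
  shows "\<exists>r l. strict_mono r \<and> (\<lambda>k. app F (x (r k))) \<longlonglongrightarrow> l"
proof -
  define b where "b = max B 1"
  have b: "b > 0" "\<And>k. norm (x k) \<le> b" using assms(2) by (auto simp: b_def max_def intro: order_trans)
  obtain C where C: "compact C" "app F ` cball 0 1 \<subseteq> C" using finrank_image_compact[OF assms(1)] by blast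
  have "\<forall>k. app F ((1/b) *\<^sub>R x k) \<in> C" using C(2) b by (auto simp: divide_simps)
  then obtain l r where "strict_mono r" "((\<lambda>k. app F ((1/b) *\<^sub>R x k)) \<circ> r) \<longlonglongrightarrow> l"
    using C(1) unfolding compact_def by meson
  then have "strict_mono r \<and> (\<lambda>k. b *\<^sub>R (app F ((1/b) *\<^sub>R x (r k)))) \<longlonglongrightarrow> b *\<^sub>R l"
    by (intro conjI tendsto_intros) (auto simp: o_def)
  then show ?thesis using b by (auto simp: app_scaleR_right)
qed

subsection \<open>Orthogonal projections\<close>

definition orth_proj :: "'a::complex_inner bop \<Rightarrow> bool" where
  "orth_proj P \<longleftrightarrow> P * P = P \<and> (\<forall>x y. cinner (app P x) y = cinner x (app P y))"

lemma orth_proj_app_app: "orth_proj P \<Longrightarrow> app P (app P x) = app P x"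
  by (metis orth_proj_def app_mult)

lemma orth_proj_orthogonal:
  assumes "orth_proj P"
  shows "cinner (app P x) (y - app P y) = 0"
  using assms orth_proj_app_app[OF assms] by (auto simp: orth_proj_def app_diff_right)

lemma orth_proj_norm_le:
  assumes "orth_proj P"
  shows "norm (x - app P x) \<le> norm x"
proof -
  have "(norm x)\<^sup>2 = (norm (app P x + (x - app P x)))\<^sup>2" by simp
  also have "\<dots> = (norm (app P x))\<^sup>2 + (norm (x - app P x))\<^sup>2"
    by (rule norm_pythagoras) (rule orth_proj_orthogonal[OF assms])
  finally have "(norm (x - app P x))\<^sup>2 \<le> (norm x)\<^sup>2" by simp
  then show ?thesis by (rule power2_le_imp_le) simp
qed

text \<open>
  One Gram-Schmidt step. The part \<open>u\<close> of \<open>y\<close> orthogonal to the range of \<open>P\<close> spans the new direction, and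
  \<open>Q\<close> is \<open>P\<close> plus the orthogonal projection onto \<open>u\<close>. The last clause records that \<open>Q - P\<close> has rank one and
  that \<open>Q\<close> maps into any subspace that contains \<open>y\<close> and the range of \<open>P\<close>.
\<close>

lemma ex_orth_proj_insert:
  fixes P :: "'a::complex_inner bop"
  assumes P: "orth_proj P" and y: "app P y \<noteq> y"
  shows "\<exists>Q u. orth_proj Q \<and> app Q y = y \<and> (\<forall>x. app P x = x \<longrightarrow> app Q x = x)
    \<and> u = (y - app P y) \<and> (\<forall>x. \<exists>c. app Q x = app P x + c *\<^sub>C u)"
proof -
  define w where "w = y - app P y"
  define n where "n = (norm w)\<^sup>2"
  have w0: "w \<noteq> 0" and n0: "n > 0" using y by (auto simp: w_def n_def)
  have wP: "cinner (app P x) w = 0" for x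
    unfolding w_def by (rule orth_proj_orthogonal[OF P])
  have Pw: "app P w = 0" by (simp add: w_def app_diff_right orth_proj_app_app[OF P])
  have "\<exists>R. \<forall>x. app R x = (cinner x w / of_real n) *\<^sub>C w"
  proof (rule ex_bop[where K=1])
    fix x
    have "norm ((cinner x w / of_real n) *\<^sub>C w) = cmod (cinner x w) * norm w / n"
      using n0 by (simp add: norm_scaleC norm_divide)
    also have "\<dots> \<le> (norm x * norm w) * norm w / n"
      using n0 by (intro divide_right_mono mult_right_mono norm_cinner_le) auto
    also have "\<dots> = norm x" using w0 by (simp add: n_def power2_eq_square)
    finally show "norm ((cinner x w / of_real n) *\<^sub>C w) \<le> norm x * 1" by simp
  qed (auto simp: cinner_simps scaleC_add_left add_divide_distrib scaleC_scaleC)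
  then obtain R where R: "\<And>x. app R x = (cinner x w / of_real n) *\<^sub>C w" by blast
  have Rw: "app R w = w" using n0 w0 by (simp add: R cinner_self n_def)
  have RP: "app R (app P x) = 0" for x by (simp add: R wP)
  have PR: "app P (app R x) = 0" for x by (simp add: R Pw)
  have RR: "app R (app R x) = app R x" for x
    by (subst (2) R) (simp add: Rw, simp add: R)
  have Rsym: "cinner (app R x) z = cinner x (app R z)" for x z
    unfolding R by (simp add: cinner_simps) (metis cinner_commute mult.commute)
  have "orth_proj (P + R)" unfolding orth_proj_def
  proof (intro conjI allI)
    show "(P + R) * (P + R) = P + R"
      by (rule bop_eqI) (simp add: app_simps app_right_simps RP PR RR orth_proj_app_app[OF P])
    fix x z show "cinner (app (P + R) x) z = cinner x (app (P + R) z)"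
      using P by (simp add: app_add cinner_simps Rsym orth_proj_def)
  qed
  moreover have "app (P + R) y = y"
  proof -
    have "app R y = app R (w + app P y)" by (simp add: w_def)
    then show ?thesis by (simp add: app_add app_add_right RP Rw) (simp add: w_def)
  qed
  moreover have "app (P + R) x = x" if "app P x = x" for x
    using that RP[of x] by (simp add: app_add)
  moreover have "\<exists>c. app (P + R) x = app P x + c *\<^sub>C w" for x
    by (auto simp: app_add R)
  ultimately show ?thesis unfolding w_def by blast
qed

lemma ex_orth_proj_finite:
  fixes Y :: "'a::complex_inner set"
  assumes "finite Y" "Y \<subseteq> E" "complex_vector.subspace E"
  shows "\<exists>P. finrank P \<and> orth_proj P \<and> (\<forall>x. app P x \<in> E) \<and> (\<forall>y\<in>Y. app P y = y)"
  using assms(1,2)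
proof (induction rule: finite_induct)
  case empty
  show ?case
    by (rule exI[of _ 0]) (use assms(3) in \<open>auto simp: orth_proj_def intro: finrank.zero complex_vector.subspace_0\<close>)
next
  case (insert y Y)
  then obtain P where P: "finrank P" "orth_proj P" "\<And>x. app P x \<in> E" "\<And>y. y \<in> Y \<Longrightarrow> app P y = y"
    by auto
  show ?case
  proof (cases "app P y = y")
    case True
    with P show ?thesis by auto
  next
    case False
    obtain Q u where Q: "orth_proj Q" "app Q y = y" "\<And>x. app P x = x \<Longrightarrow> app Q x = x" "u = y - app P y"
      "\<And>x. \<exists>c. app Q x = app P x + c *\<^sub>C u"
      using ex_orth_proj_insert[OF P(2) False] by blast
    have uE: "u \<in> E" using P(3) insert.prems assms(3) by (auto simp: Q(4) intro: complex_vector.subspace_diff)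
    have "app Q x \<in> E" for x
    proof -
      obtain c where "app Q x = app P x + c *\<^sub>C u" using Q(5) by blast
      moreover have "app P x + c *\<^sub>C u \<in> E"
        using complex_vector.subspace_add[OF assms(3) P(3) complex_vector.subspace_scale[OF assms(3) uE]] .
      ultimately show ?thesis by simp
    qed
    moreover have "rank_one (Q - P)" unfolding rank_one_def
    proof (rule exI[of _ u], rule allI)
      fix x obtain c where "app Q x = app P x + c *\<^sub>C u" using Q(5) by blast
      then have "app (Q - P) x = c *\<^sub>C u" by (simp add: app_diff)
      then show "\<exists>c. app (Q - P) x = c *\<^sub>C u" by blast
    qed
    then have "finrank Q" using finrank.add_rank_one[OF P(1), of "Q - P"] by simp
    ultimately show ?thesis using Q P(4) by (intro exI[of _ Q]) auto
  qed
qed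

text \<open>
  Project onto the span of a finite \<open>\<epsilon>\<close>-net: a projection \<open>P\<close> satisfies \<open>\<parallel>x - P x\<parallel> \<le> \<parallel>x\<parallel>\<close>, so points near the
  net stay near it. The lemma serves twice, for the approximation of compact operators and for
  the finite dimension of certain kernels.
\<close>

lemma ex_orth_proj_compact:
  fixes C :: "'a::complex_inner set"
  assumes "compact C" "C \<subseteq> E" "complex_vector.subspace E" "\<epsilon> > 0"
  shows "\<exists>P. finrank P \<and> orth_proj P \<and> (\<forall>x. app P x \<in> E) \<and> (\<forall>y\<in>C. norm (y - app P y) < \<epsilon>)"
proof -
  obtain Y where Y: "finite Y" "Y \<subseteq> C" "C \<subseteq> (\<Union>y\<in>Y. ball y \<epsilon>)"
    using compactE_image[OF assms(1), of C "\<lambda>y. ball y \<epsilon>"] assms(4)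
    by (metis (no_types, lifting) UN_I centre_in_ball open_ball subsetI)
  obtain P where P: "finrank P" "orth_proj P" "\<And>x. app P x \<in> E" "\<And>y. y \<in> Y \<Longrightarrow> app P y = y"
    using ex_orth_proj_finite[OF Y(1) order_trans[OF Y(2) assms(2)] assms(3)] by blast
  have "norm (x - app P x) < \<epsilon>" if xC: "x \<in> C" for x
  proof -
    obtain y where y: "y \<in> Y" "dist y x < \<epsilon>" using Y(3) xC by auto
    have "x - app P x = (x - y) - app P (x - y)" using P(4)[OF y(1)] by (simp add: app_diff_right)
    also have "norm \<dots> \<le> norm (x - y)" by (rule orth_proj_norm_le[OF P(2)])
    finally show ?thesis using y by (simp add: dist_norm norm_minus_commute)
  qed
  with P show ?thesis by blast
qed

lemma compact_operator_approx_finrank: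
  fixes K :: "'a::complex_inner bop"
  assumes "compact_operator (app K)" "\<epsilon> > 0"
  shows "\<exists>F. finrank F \<and> norm (K - F) \<le> \<epsilon>"
proof -
  have "compact (closure (app K ` cball 0 1))" using assms by (simp add: compact_operator_def)
  from ex_orth_proj_compact[OF this _ _ assms(2), of UNIV]
  obtain P where P: "finrank P" "\<And>y. y \<in> closure (app K ` cball 0 1) \<Longrightarrow> norm (y - app P y) < \<epsilon>"
    by auto
  have "norm (app (K - P * K) x) \<le> \<epsilon> * norm x" for x
  proof (cases "x = 0")
    case False
    let ?y = "app K ((1 / norm x) *\<^sub>R x)"
    have "?y \<in> app K ` cball 0 1" using False by (intro imageI) simp
    then have "norm (?y - app P ?y) < \<epsilon>" using P(2) closure_subset by blast
    moreover have "?y - app P ?y = (1 / norm x) *\<^sub>R app (K - P * K) x"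
      by (simp add: app_simps app_right_simps algebra_simps)
    ultimately show ?thesis using False by (simp add: field_simps)
  qed simp
  then have "norm (K - P * K) \<le> \<epsilon>" using assms(2) by (intro norm_bop_le) auto
  with P(1) show ?thesis by (blast intro: finrank_mult_right)
qed

subsection \<open>The essential norm\<close>

lemma calkin_class_app: "calkin_class (app X) = {app (X + K) |K. compact_operator (app K)}"
proof -
  have "\<exists>K'. (\<lambda>x. app X x + K x) = app (X + K') \<and> compact_operator (app K')" if "compact_operator K" for K
  proof -
    have K: "app (Bop K) = K" using that by (simp add: Bop_inverse compact_operator_def)
    show ?thesis by (rule exI[of _ "Bop K"]) (simp add: K that app_add fun_eq_iff)
  qed
  moreover have "\<exists>K'. app (X + K) = (\<lambda>x. app X x + K' x) \<and> compact_operator K'"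
    if "compact_operator (app K)" for K
    using that by (intro exI[of _ "app K"]) (auto simp: app_add fun_eq_iff)
  ultimately show ?thesis unfolding calkin_class_def by blast
qed

lemma essential_norm_app: "essential_norm (app X) = (INF K\<in>{K. compact_operator (app K)}. norm (X + K))"
proof -
  have "onorm ` {app (X + K) |K. compact_operator (app K)} = (\<lambda>K. norm (X + K)) ` {K. compact_operator (app K)}"
    by (auto simp: norm_bop_onorm image_iff)
  then show ?thesis by (simp add: essential_norm_def calkin_class_app)
qed

lemma compact_operator_zero: "compact_operator (app 0)"
  by (rule finrank_compact_operator[OF finrank.zero])

lemma essential_norm_le:
  "compact_operator (app K) \<Longrightarrow> essential_norm (app X) \<le> norm (X + K)"
  unfolding essential_norm_app by (rule cINF_lower) (auto intro!: bdd_belowI[of _ 0])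

lemma essential_norm_lessD:
  assumes "essential_norm (app X) < c"
  shows "\<exists>K. compact_operator (app K) \<and> norm (X + K) < c"
proof -
  have "{K. compact_operator (app (K::'a bop))} \<noteq> {}" using compact_operator_zero by blast
  moreover have "bdd_below ((\<lambda>K. norm (X + K)) ` {K. compact_operator (app K)})"
    by (auto intro!: bdd_belowI[of _ 0])
  ultimately show ?thesis using assms unfolding essential_norm_app
    by (subst (asm) cINF_less_iff) auto
qed

lemma essential_norm_nonneg: "essential_norm (app X) \<ge> 0"
  using essential_norm_lessD[of X 0] by fastforce

text \<open>
  The compact operator in the definition of the essential norm may be replaced by one of finite
  rank. This is why all perturbations constructed below have finite rank.
\<close>

lemma essential_norm_less_finrank:
  assumes "essential_norm (app X) < c"
  shows "\<exists>F. finrank F \<and> norm (X - F) < c"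
proof -
  obtain K where K: "compact_operator (app K)" "norm (X + K) < c"
    using essential_norm_lessD[OF assms] by blast
  obtain F where F: "finrank F" "norm (K - F) \<le> (c - norm (X + K)) / 2"
    using compact_operator_approx_finrank[OF K(1), of "(c - norm (X + K)) / 2"] K by auto
  have "norm (X + F) \<le> norm (X + K) + norm (K - F)"
    using norm_triangle_ineq4[of "X + K" "K - F"] by (simp add: algebra_simps)
  also have "\<dots> < c" using F(2) K(2) by simp
  finally show ?thesis using F(1) by (intro exI[of _ "-F"]) (auto intro: finrank_minus)
qed

lemma essential_norm_finrank_le: "finrank (B - A) \<Longrightarrow> essential_norm (app A) \<le> norm B"
  using essential_norm_le[of "B - A" A] finrank_compact_operator[of "B - A"] by simp

lemma essential_norm_lipschitz: "essential_norm (app A) \<le> essential_norm (app B) + norm (A - B)"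
proof (rule field_le_epsilon)
  fix e :: real assume "e > 0"
  then obtain K where K: "compact_operator (app K)" "norm (B + K) < essential_norm (app B) + e"
    using essential_norm_lessD[of B "essential_norm (app B) + e"] by auto
  have "essential_norm (app A) \<le> norm ((B + K) + (A - B))"
    using essential_norm_le[OF K(1), of A] by (simp add: algebra_simps)
  also have "\<dots> \<le> norm (B + K) + norm (A - B)" by (rule norm_triangle_ineq)
  finally show "essential_norm (app A) \<le> essential_norm (app B) + norm (A - B) + e" using K by simp
qed

section \<open>Geometric decay\<close>

text \<open>
  Geometric decay of a coefficient sequence says that its power series converges on a disc of radius
  greater than \<open>1\<close>; geometric decay of the powers of an operator says that the spectral radius is less
  than \<open>1\<close>. The elementary inequality replaces both notions.
\<close>

definition decays :: "(nat \<Rightarrow> 'b::real_normed_vector) \<Rightarrow> bool" where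
  "decays f \<longleftrightarrow> (\<exists>C q. 0 < q \<and> q < 1 \<and> (\<forall>n. norm (f n) \<le> C * q ^ n))"

lemma decaysI: "0 < q \<Longrightarrow> q < 1 \<Longrightarrow> (\<And>n. norm (f n) \<le> C * q ^ n) \<Longrightarrow> decays f"
  unfolding decays_def by blast

lemma decaysE2:
  assumes "decays f" "decays g"
  obtains C q where "0 \<le> C" "0 < q" "q < 1" "\<And>n. norm (f n) \<le> C * q ^ n" "\<And>n. norm (g n) \<le> C * q ^ n"
proof -
  obtain C q where f: "0 < q" "q < 1" "\<And>n. norm (f n) \<le> C * q ^ n" using assms(1) by (auto simp: decays_def)
  obtain D s where g: "0 < s" "s < 1" "\<And>n. norm (g n) \<le> D * s ^ n" using assms(2) by (auto simp: decays_def)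
  define E where "E = max 0 (max C D)"
  have le: "B * t ^ n \<le> E * (max q s) ^ n" if "B \<le> E" "0 < t" "t \<le> max q s" for B t n
  proof -
    have "B * t ^ n \<le> E * t ^ n" using that by (intro mult_right_mono) auto
    also have "\<dots> \<le> E * (max q s) ^ n" using that by (intro mult_left_mono power_mono) (auto simp: E_def)
    finally show ?thesis .
  qed
  show ?thesis
  proof (rule that[of E "max q s"])
    show "norm (f n) \<le> E * max q s ^ n" for n using order_trans[OF f(3)[of n] le[of C q n]] f(1) by (simp add: E_def)
    show "norm (g n) \<le> E * max q s ^ n" for n using order_trans[OF g(3)[of n] le[of D s n]] g(1) by (simp add: E_def)
  qed (use f g in \<open>auto simp: E_def\<close>)
qed

lemma decaysE:
  assumes "decays f"
  obtains C q where "0 \<le> C" "0 < q" "q < 1" "\<And>n. norm (f n) \<le> C * q ^ n"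
  using decaysE2[OF assms assms] by metis

lemma decays_dominated:
  assumes "decays f" "\<And>n. norm (g n) \<le> B * norm (f n)" "B \<ge> 0"
  shows "decays g"
proof -
  obtain C q where f: "0 < q" "q < 1" "\<And>n. norm (f n) \<le> C * q ^ n" using assms(1) by (auto simp: decays_def)
  show ?thesis
  proof (rule decaysI[OF f(1,2), of _ "B * C"])
    show "norm (g n) \<le> B * C * q ^ n" for n
      using assms(2)[of n] mult_left_mono[OF f(3)[of n] assms(3)] by (simp add: mult.assoc)
  qed
qed

lemma decays_add: "decays f \<Longrightarrow> decays g \<Longrightarrow> decays (\<lambda>n. f n + g n)"
proof (erule (1) decaysE2)
  fix C q :: real
  assume *: "0 \<le> C" "0 < q" "q < 1" "\<And>n. norm (f n) \<le> C * q ^ n" "\<And>n. norm (g n) \<le> C * q ^ n"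
  show "decays (\<lambda>n. f n + g n)"
  proof (rule decaysI[OF *(2,3), of _ "2 * C"])
    show "norm (f n + g n) \<le> 2 * C * q ^ n" for n
      using norm_triangle_ineq[of "f n" "g n"] *(4)[of n] *(5)[of n] by simp
  qed
qed

lemma decays_minus: "decays f \<Longrightarrow> decays (\<lambda>n. - f n)"
  by (simp add: decays_def)

lemma decays_diff: "decays f \<Longrightarrow> decays g \<Longrightarrow> decays (\<lambda>n. f n - g n)"
  using decays_add[of f "\<lambda>n. - g n"] decays_minus[of g] by simp

lemma decays_shift: "decays f \<Longrightarrow> decays (\<lambda>n. f (n + k))"
proof (erule decaysE)
  fix C q :: real assume *: "0 \<le> C" "0 < q" "q < 1" "\<And>n. norm (f n) \<le> C * q ^ n"
  show "decays (\<lambda>n. f (n + k))"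
    by (rule decaysI[OF *(2,3), of _ "C * q ^ k"]) (use *(4)[of "_ + k"] in \<open>simp add: power_add mult_ac\<close>)
qed

lemma decays_unshift: "decays (\<lambda>n. f (Suc n)) \<Longrightarrow> decays f"
proof (erule decaysE)
  fix C q :: real assume *: "0 \<le> C" "0 < q" "q < 1" "\<And>n. norm (f (Suc n)) \<le> C * q ^ n"
  show "decays f"
  proof (rule decaysI[OF *(2,3), of _ "max (norm (f 0)) (C / q)"])
    fix n show "norm (f n) \<le> max (norm (f 0)) (C / q) * q ^ n"
    proof (cases n)
      case (Suc k)
      have "norm (f n) \<le> C / q * q ^ n" using *(2) *(4)[of k] by (simp add: Suc)
      also have "\<dots> \<le> max (norm (f 0)) (C / q) * q ^ n" using *(2) by (intro mult_right_mono) auto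
      finally show ?thesis .
    qed simp
  qed
qed

lemma decays_zero: "decays (\<lambda>n. 0)"
  by (rule decaysI[of "1/2" _ 0]) auto

lemma decays_finite_support: "(\<And>n. n \<ge> d \<Longrightarrow> f n = 0) \<Longrightarrow> decays f"
proof (induction d arbitrary: f)
  case 0
  then have "f = (\<lambda>n. 0)" by auto
  then show ?case by (simp add: decays_zero)
next
  case (Suc d)
  show ?case by (rule decays_unshift, rule Suc.IH) (use Suc.prems in auto)
qed

lemma decays_power:
  fixes c :: "'b::real_normed_vector"
  assumes "\<And>n. norm (f n) \<le> s ^ n" "0 \<le> s" "s < 1"
  shows "decays f"
proof (rule decaysI[of "(s + 1) / 2" f 1])
  fix n
  have "s ^ n \<le> ((s + 1) / 2) ^ n" using assms by (intro power_mono) auto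
  then show "norm (f n) \<le> 1 * ((s + 1) / 2) ^ n" using assms(1)[of n] by simp
qed (use assms in auto)

lemma decays_Suc_times:
  assumes "0 < q" "q < 1" "\<And>n. norm (f n) \<le> C * (real n + 1) * q ^ n" "0 \<le> C"
  shows "decays f"
proof -
  define s where "s = (1 + q) / 2"
  have s: "0 < s" "s < 1" "q < s" using assms by (auto simp: s_def)
  have "(\<lambda>n. real n * (q / s) ^ n) \<longlonglongrightarrow> 0"
    using powser_times_n_limit_0[of "q/s"] s assms by (simp add: field_simps)
  then have "Bseq (\<lambda>n. real n * (q / s) ^ n)"
    by (intro convergent_imp_Bseq) (auto simp: convergent_def)
  then obtain B where B: "\<And>n. norm (real n * (q / s) ^ n) \<le> B"
    unfolding Bseq_def by blast
  show ?thesis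
  proof (rule decaysI[OF s(1,2), of _ "C * (B + 1)"])
    fix n
    have "(q / s) ^ n \<le> 1" using s assms by (intro power_le_one) (auto simp: field_simps)
    then have "(real n + 1) * (q / s) ^ n \<le> B + 1"
      using B[of n] s assms by (simp add: algebra_simps)
    then have "C * ((real n + 1) * (q / s) ^ n) * s ^ n \<le> C * (B + 1) * s ^ n"
      using s assms by (intro mult_right_mono mult_left_mono) auto
    moreover have "C * ((real n + 1) * (q / s) ^ n) * s ^ n = C * (real n + 1) * q ^ n"
      using s by (simp add: power_divide)
    ultimately show "norm (f n) \<le> C * (B + 1) * s ^ n" using assms(3)[of n] by simp
  qed
qed

text \<open>
  The Cauchy product picks up a factor \<open>n + 1\<close>, which a slightly larger ratio absorbs.
\<close>

lemma decays_fps_mult: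
  fixes f g :: "'b::{ring, real_normed_algebra} fps"
  assumes "decays (fps_nth f)" "decays (fps_nth g)"
  shows "decays (fps_nth (f * g))"
proof -
  obtain C q where *: "0 \<le> C" "0 < q" "q < 1" "\<And>n. norm (fps_nth f n) \<le> C * q ^ n"
    "\<And>n. norm (fps_nth g n) \<le> C * q ^ n" using decaysE2[OF assms] by blast
  show ?thesis
  proof (rule decays_Suc_times[OF *(2,3)])
    fix n
    have "norm (fps_nth (f * g) n) \<le> (\<Sum>i=0..n. norm (fps_nth f i * fps_nth g (n - i)))"
      unfolding fps_mult_nth by (rule norm_sum)
    also have "\<dots> \<le> (\<Sum>i=0..n. (C * C) * q ^ n)"
    proof (rule sum_mono)
      fix i assume i: "i \<in> {0..n}"
      have "norm (fps_nth f i * fps_nth g (n - i)) \<le> norm (fps_nth f i) * norm (fps_nth g (n - i))"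
        by (rule norm_mult_ineq)
      also have "\<dots> \<le> (C * q ^ i) * (C * q ^ (n - i))"
        using * by (intro mult_mono) auto
      also have "\<dots> = (C * C) * q ^ n" using i by (simp add: power_add[symmetric])
      finally show "norm (fps_nth f i * fps_nth g (n - i)) \<le> (C * C) * q ^ n" .
    qed
    also have "\<dots> = C * C * (real n + 1) * q ^ n" by simp
    finally show "norm (fps_nth (f * g) n) \<le> C * C * (real n + 1) * q ^ n" .
  qed (use * in auto)
qed

lemma decays_recursion:
  fixes w :: "nat \<Rightarrow> 'b::real_normed_vector"
  assumes "decays g" "\<And>n. norm (w (Suc n)) \<le> l * norm (w n) + norm (g n)" "0 \<le> l" "l < 1"
  shows "decays w"
proof -
  obtain C q where g: "0 \<le> C" "0 < q" "q < 1" "\<And>n. norm (g n) \<le> C * q ^ n" using decaysE[OF assms(1)] by blast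
  define s where "s = (1 + max l q) / 2"
  have s: "0 < s" "s < 1" "q < s" "l < s" using assms g by (auto simp: s_def)
  define D where "D = max (norm (w 0)) (C / (s - l))"
  have D: "C \<le> D * (s - l)" using s by (auto simp: D_def field_simps max_def)
  have "norm (w n) \<le> D * s ^ n" for n
  proof (induction n)
    case (Suc n)
    have "norm (w (Suc n)) \<le> l * (D * s ^ n) + C * q ^ n"
      using assms(2)[of n] mult_left_mono[OF Suc assms(3)] g(4)[of n] by linarith
    also have "\<dots> \<le> l * (D * s ^ n) + C * s ^ n"
      using g s by (intro add_left_mono mult_left_mono power_mono) auto
    also have "\<dots> \<le> l * (D * s ^ n) + (D * (s - l)) * s ^ n"
      using D s by (intro add_left_mono mult_right_mono) auto
    also have "\<dots> = D * s ^ Suc n" by (simp add: algebra_simps)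
    finally show ?case .
  qed (simp add: D_def)
  then show ?thesis by (intro decaysI[OF s(1,2)])
qed

subsection \<open>Clearing the zeros of a power series\<close>

lemma decays_imp_conv_radius:
  fixes m :: "complex fps"
  assumes "decays (fps_nth m)"
  shows "\<exists>s>1. fps_conv_radius m \<ge> ereal s"
proof -
  obtain C q where *: "0 \<le> C" "0 < q" "q < 1" "\<And>n. norm (fps_nth m n) \<le> C * q ^ n"
    using decaysE[OF assms] by blast
  define s where "s = 2 / (1 + q)"
  have s: "s > 1" "q * s < 1" "0 \<le> q * s" using * by (auto simp: s_def field_simps)
  have "summable (\<lambda>n. fps_nth m n * of_real s ^ n)"
  proof (rule summable_comparison_test'[where N=0])
    show "summable (\<lambda>n. C * (q * s) ^ n)" using s by (intro summable_mult summable_geometric) auto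
    fix n
    have "norm (fps_nth m n) * s ^ n \<le> (C * q ^ n) * s ^ n" using *(4) s by (intro mult_right_mono) auto
    then show "norm (fps_nth m n * of_real s ^ n) \<le> C * (q * s) ^ n"
      using s by (simp add: norm_mult norm_power power_mult_distrib)
  qed
  then have "conv_radius (fps_nth m) \<ge> norm (of_real s :: complex)" by (rule conv_radius_geI)
  then show ?thesis using s by (auto simp: fps_conv_radius_def intro!: exI[of _ s])
qed

lemma conv_radius_imp_decays:
  fixes h :: "complex fps"
  assumes "fps_conv_radius h \<ge> ereal r" "r > 1"
  shows "decays (fps_nth h)"
proof -
  define s where "s = (1 + r) / 2"
  have s: "1 < s" "s < r" using assms by (auto simp: s_def)
  have "ereal (norm (of_real s :: complex)) < fps_conv_radius h"
    using s assms by (auto intro: less_le_trans[of _ "ereal r"])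
  then have "summable (\<lambda>n. fps_nth h n * of_real s ^ n)" by (rule summable_fps)
  then have "Bseq (\<lambda>n. fps_nth h n * of_real s ^ n)"
    by (intro convergent_imp_Bseq) (auto simp: convergent_def dest: summable_LIMSEQ_zero)
  then obtain B where "\<And>n. norm (fps_nth h n * of_real s ^ n) \<le> B" unfolding Bseq_def by blast
  then have "norm (fps_nth h n) \<le> B * (1 / s) ^ n" for n
    using s by (auto simp: norm_mult norm_power power_divide field_simps)
  then show ?thesis using s by (intro decaysI[of "1/s" _ B]) auto
qed

text \<open>
  A function that is analytic beyond the closed unit disc has finitely many zeros there, so it is
  a polynomial times a function without zeros. The reciprocal of that function is analytic
  beyond the closed unit disc too, and this is \<open>h\<close>.
\<close>

lemma power_series_divides_poly:
  fixes m :: "complex fps"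
  assumes "decays (fps_nth m)" "m \<noteq> 0"
  shows "\<exists>\<mu> h. \<mu> \<noteq> 0 \<and> decays (fps_nth h) \<and> h * m = fps_of_poly \<mu>"
proof -
  obtain s where s: "s > 1" "fps_conv_radius m \<ge> ereal s" using decays_imp_conv_radius[OF assms(1)] by blast
  define f where "f = eval_fps m"
  \<comment> \<open>The radius \<open>r\<close> lies strictly between \<open>1\<close> and the radius of convergence: the closed disc of radius \<open>r\<close>
    is compact, hence contains finitely many zeros, and the reciprocal of the factor without zeros
    is still analytic beyond the closed unit disc.\<close>
  define r where "r = (1 + s) / 2"
  have r: "1 < r" "r < s" using s by (auto simp: r_def)
  have sub: "ball 0 s \<subseteq> eball 0 (fps_conv_radius m)" using eball_mono[OF s(2), of 0] by simp
  then have f_hol: "f holomorphic_on ball 0 s" unfolding f_def by (rule holomorphic_on_eval_fps)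
  define Z where "Z = {z\<in>cball 0 r. f z = 0}"
  have m_pos: "fps_conv_radius m > 0" using s by (intro less_le_trans[OF _ s(2)]) auto
  have nz: "\<exists>w\<in>ball 0 r. f w \<noteq> 0"
  proof (rule ccontr)
    assume *: "\<not> ?thesis"
    have "eventually (\<lambda>z. z \<in> ball 0 r) (nhds (0::complex))"
      using r by (intro eventually_nhds_in_open) auto
    then have "eventually (\<lambda>z. eval_fps m z = eval_fps 0 z) (nhds 0)"
      by eventually_elim (use * in \<open>auto simp: f_def\<close>)
    then have "m = 0" using m_pos by (intro eval_fps_eqD) auto
    with assms(2) show False by simp
  qed
  have finZ: "finite Z"
  proof (cases "f constant_on ball 0 s")
    case True
    then have "Z = {}" using nz r by (force simp: Z_def constant_on_def)
    then show ?thesis by simp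
  next
    case False
    then show ?thesis unfolding Z_def
      by (intro holomorphic_compact_finite_zeros[OF f_hol]) (use r in auto)
  qed
  define n where "n z = nat (zorder f z)" for z
  define \<mu> where "\<mu> = (\<Prod>z\<in>Z. [:- z, 1:] ^ n z)"
  have \<mu>0: "\<mu> \<noteq> 0" using finZ by (auto simp: \<mu>_def)
  have poly\<mu>: "poly \<mu> w = (\<Prod>z\<in>Z. (w - z) ^ n z)" for w by (simp add: \<mu>_def poly_prod)
  define A where "A = ball (0::complex) r"
  have A: "open A" "connected A" by (auto simp: A_def)
  have f_hol': "f holomorphic_on A" using f_hol r by (auto simp: A_def elim!: holomorphic_on_subset)
  have ord: "zorder f z > 0" if "z \<in> A" "f z = 0" for z
    using zorder_exist_zero[OF f_hol' A that(1)] nz that(2) by (auto simp: A_def)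
  have zeros: "poly \<mu> z = 0 \<longleftrightarrow> f z = 0" if "z \<in> A" for z
    using that ord[OF that] finZ by (auto simp: poly\<mu> n_def Z_def A_def)
  have zord: "zorder (poly \<mu>) z = zorder f z" if z: "z \<in> A" for z
  proof (cases "f z = 0")
    case False
    have "f analytic_on {z}" using f_hol' A z by (meson analytic_at)
    moreover have "poly \<mu> analytic_on {z}"
      using poly_holomorphic_on[OF holomorphic_on_ident, of \<mu> UNIV] by (metis UNIV_I analytic_at open_UNIV)
    ultimately show ?thesis using False zeros[OF z] by (simp add: zorder_eq_0I)
  next
    case True
    then have zZ: "z \<in> Z" using z by (auto simp: Z_def A_def)
    define g where "g = (\<lambda>w. \<Prod>u\<in>Z - {z}. (w - u) ^ n u)"
    have "zorder (poly \<mu>) z = int (n z)"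
    proof (rule zorder_eqI[of UNIV z g])
      show "g holomorphic_on UNIV" unfolding g_def by (intro holomorphic_intros)
      show "g z \<noteq> 0" using finZ by (auto simp: g_def)
      show "poly \<mu> w = g w * (w - z) powi int (n z)" for w
        unfolding poly\<mu> g_def using finZ zZ by (subst prod.remove[of Z z]) auto
    qed auto
    with ord[OF z True] show ?thesis by (simp add: n_def)
  qed
  obtain h where h: "h holomorphic_on A" "\<And>z. z \<in> A \<Longrightarrow> h z \<noteq> 0" "\<And>z. z \<in> A \<Longrightarrow> f z = h z * poly \<mu> z"
    using holomorphic_zorder_factorization[OF f_hol' A poly_holomorphic_on[OF holomorphic_on_ident] zeros zord]
    by blast
  define H where "H = fps_expansion (\<lambda>z. inverse (h z)) 0"
  have H_hol: "(\<lambda>z. inverse (h z)) holomorphic_on eball 0 (ereal r)"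
    using h by (auto simp: A_def intro!: holomorphic_intros)
  have H_rad: "fps_conv_radius H \<ge> ereal r" unfolding H_def by (rule conv_radius_fps_expansion[OF H_hol])
  have H_eval: "eval_fps H z = inverse (h z)" if "z \<in> A" for z
    unfolding H_def using eval_fps_expansion'[OF H_hol] that by (simp add: A_def)
  have H_pos: "fps_conv_radius H > 0" using r by (intro less_le_trans[OF _ H_rad]) auto
  have "H * m = fps_of_poly \<mu>"
  proof (rule eval_fps_eqD)
    show "fps_conv_radius (H * m) > 0"
      using fps_conv_radius_mult[of H m] H_pos m_pos by (auto simp: min_def split: if_splits)
    have "eventually (\<lambda>z. z \<in> A) (nhds (0::complex))"
      using r A by (intro eventually_nhds_in_open) (auto simp: A_def)
    then show "eventually (\<lambda>z. eval_fps (H * m) z = eval_fps (fps_of_poly \<mu>) z) (nhds 0)"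
    proof eventually_elim
      fix z assume z: "z \<in> A"
      then have "ereal (norm z) < ereal r" by (simp add: A_def)
      moreover have "ereal r < ereal s" using r by simp
      ultimately have "eval_fps (H * m) z = eval_fps H z * eval_fps m z"
        using H_rad s(2) by (intro eval_fps_mult) (meson less_le_trans less_trans)+
      also have "\<dots> = inverse (h z) * (h z * poly \<mu> z)"
        using h(3)[OF z] H_eval[OF z] by (simp add: f_def)
      finally show "eval_fps (H * m) z = eval_fps (fps_of_poly \<mu>) z" using h(2)[OF z] by simp
    qed
  qed auto
  with \<mu>0 conv_radius_imp_decays[OF H_rad r(1)] show ?thesis by blast
qed

section \<open>Finite-rank perturbations of contractions\<close>

text \<open>
  Complex power series act on power series of operators as a central subring.
\<close>

definition scalar_fps :: "complex fps \<Rightarrow> 'a::complex_inner bop fps" where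
  "scalar_fps f = Abs_fps (\<lambda>n. fps_nth f n *\<^sub>C 1)"

text \<open>
  The expansion of \<open>(1 - z A)\<^sup>-\<^sup>1\<close> at \<open>z = 0\<close>.
\<close>

definition resolvent_fps :: "'a::complex_inner bop \<Rightarrow> 'a bop fps" where
  "resolvent_fps A = Abs_fps (\<lambda>n. A ^ n)"

lemma scalar_fps_nth [simp]: "fps_nth (scalar_fps f) n = fps_nth f n *\<^sub>C 1"
  by (simp add: scalar_fps_def)
lemma resolvent_fps_nth [simp]: "fps_nth (resolvent_fps A) n = A ^ n"
  by (simp add: resolvent_fps_def)

lemma scalar_fps_mult_nth: "fps_nth (scalar_fps f * G) n = (\<Sum>i=0..n. fps_nth f i *\<^sub>C fps_nth G (n - i))"
  by (simp add: fps_mult_nth)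
lemma mult_emb_nth: "fps_nth (G * scalar_fps f) n = (\<Sum>i=0..n. fps_nth f (n - i) *\<^sub>C fps_nth G i)"
  by (simp add: fps_mult_nth)

lemma scalar_fps_commute: "scalar_fps f * G = G * scalar_fps f"
proof (rule fps_ext)
  fix n
  have "(\<Sum>i=0..n. fps_nth f i *\<^sub>C fps_nth G (n - i)) = (\<Sum>i=0..n. fps_nth f (n - i) *\<^sub>C fps_nth G i)"
    by (rule sum.reindex_bij_witness[where i="\<lambda>i. n - i" and j="\<lambda>i. n - i"]) auto
  then show "fps_nth (scalar_fps f * G) n = fps_nth (G * scalar_fps f) n" by (simp only: scalar_fps_mult_nth mult_emb_nth)
qed

lemma scalar_fps_left_commute: "G * (scalar_fps f * H) = scalar_fps f * (G * H)"
proof -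
  have "G * (scalar_fps f * H) = (G * scalar_fps f) * H" by (simp only: mult.assoc)
  also have "\<dots> = (scalar_fps f * G) * H" by (simp only: scalar_fps_commute)
  finally show ?thesis by (simp only: mult.assoc)
qed

lemma scalar_fps_mult: "scalar_fps (f * g) = scalar_fps f * scalar_fps g"
  by (rule fps_ext) (simp add: fps_mult_nth scaleC_sum_left scaleC_scaleC mult.commute)
lemma scalar_fps_diff: "scalar_fps (f - g) = scalar_fps f - scalar_fps g"
  by (rule fps_ext) (simp add: scaleC_diff_left)
lemma scalar_fps_one_mult [simp]: "scalar_fps 1 * G = G"
proof (rule fps_ext)
  fix n
  have "fps_nth (scalar_fps 1 * G) n = (\<Sum>i=0..n. if i = 0 then fps_nth G n else 0)"
    unfolding scalar_fps_mult_nth by (rule sum.cong) (auto simp: fps_one_nth)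
  then show "fps_nth (scalar_fps 1 * G) n = fps_nth G n" by (simp add: sum.delta)
qed

lemma scalar_fps_X_mult_nth: "fps_nth (scalar_fps fps_X * G) n = (if n = 0 then 0 else fps_nth G (n - 1))"
proof -
  have "fps_nth (scalar_fps fps_X * G) n = (\<Sum>i=0..n. if i = 1 then fps_nth G (n - 1) else 0)"
    unfolding scalar_fps_mult_nth by (rule sum.cong) (auto simp: fps_X_def)
  then show ?thesis by (auto simp: sum.delta)
qed

lemma decays_emb: "decays (fps_nth f) \<Longrightarrow> decays (fps_nth (scalar_fps f :: 'a::complex_inner bop fps))"
  by (erule decays_dominated[where B=1]) (auto simp: norm_cscale intro: mult_left_le norm_one_bop_le)

lemma decays_fps_const: "decays (fps_nth (fps_const c :: 'b::real_normed_vector fps))"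
  by (rule decays_finite_support[of 1]) auto

lemma power_Suc_diff:
  "X ^ Suc n = Y ^ Suc n + (\<Sum>i=0..n. Y ^ i * (X - Y) * X ^ (n - i))" for X Y :: "'a::complex_inner bop"
proof (induction n)
  case (Suc n)
  have "X ^ Suc (Suc n) = Y * X ^ Suc n + (X - Y) * X ^ Suc n" by (simp add: algebra_simps)
  also have "Y * X ^ Suc n = Y ^ Suc (Suc n) + (\<Sum>i=0..n. Y ^ Suc i * (X - Y) * X ^ (n - i))"
    by (subst Suc) (simp add: algebra_simps sum_distrib_left)
  also have "Y ^ Suc (Suc n) + (\<Sum>i=0..n. Y ^ Suc i * (X - Y) * X ^ (n - i)) + (X - Y) * X ^ Suc n
      = Y ^ Suc (Suc n) + (\<Sum>i=0..Suc n. Y ^ i * (X - Y) * X ^ (Suc n - i))"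
    by (subst sum.atLeast0_atMost_Suc_shift) (simp add: ac_simps)
  finally show ?case .
qed simp

text \<open>
  The second resolvent identity \<open>(1 - z X)\<^sup>-\<^sup>1 - (1 - z Y)\<^sup>-\<^sup>1 = z (1 - z Y)\<^sup>-\<^sup>1 (X - Y) (1 - z X)\<^sup>-\<^sup>1\<close>, proved
  coefficient by coefficient.
\<close>

lemma resolvent_fps_diff:
  "resolvent_fps X = resolvent_fps Y + scalar_fps fps_X * (resolvent_fps Y * fps_const (X - Y) * resolvent_fps X)"
proof (rule fps_ext)
  fix n
  show "fps_nth (resolvent_fps X) n = fps_nth (resolvent_fps Y + scalar_fps fps_X * (resolvent_fps Y * fps_const (X - Y) * resolvent_fps X)) n"
  proof (cases n)
    case (Suc k)
    have *: "fps_nth (resolvent_fps Y * fps_const (X - Y)) i = Y ^ i * (X - Y)" for i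
      by (simp add: fps_mult_right_const_nth)
    show ?thesis
      using power_Suc_diff[of X k Y] by (simp add: Suc scalar_fps_X_mult_nth fps_mult_nth[of _ "resolvent_fps X"] *)
  qed (simp add: scalar_fps_X_mult_nth)
qed

text \<open>
  If \<open>K x = \<phi>(x) v\<close>, then \<open>K A K = \<phi>(A v) K\<close>. This is what turns the resolvent identity for a rank-one
  perturbation into a scalar equation.
\<close>

lemma rank_one_compression:
  fixes K :: "'a::complex_inner bop"
  assumes "rank_one K"
  shows "\<exists>\<tau> B. (\<forall>A. K * A * K = \<tau> A *\<^sub>C K) \<and> (\<forall>A. cmod (\<tau> A) \<le> B * norm A) \<and> 0 \<le> B
    \<and> (\<forall>A A'. \<tau> (A + A') = \<tau> A + \<tau> A') \<and> (\<forall>c A. \<tau> (c *\<^sub>C A) = c * \<tau> A)"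
proof -
  obtain v where v: "\<And>x. \<exists>c. app K x = c *\<^sub>C v" using assms unfolding rank_one_def by blast
  show ?thesis
  proof (cases "v = 0")
    case True
    then have "app K x = 0" for x using v[of x] by auto
    then have "K = 0" by (intro bop_eqI) auto
    then show ?thesis by (intro exI[of _ "\<lambda>_. 0"] exI[of _ 0]) auto
  next
    case False
    define n where "n = complex_of_real ((norm v)\<^sup>2)"
    have n0: "n \<noteq> 0" using False by (simp add: n_def)
    define \<phi> where "\<phi> x = cinner (app K x) v / n" for x
    have K: "app K x = \<phi> x *\<^sub>C v" for x
      using v[of x] n0 by (auto simp: \<phi>_def cinner_scaleC_left cinner_self n_def)
    define \<tau> where "\<tau> A = \<phi> (app A v)" for A
    have "K * A * K = \<tau> A *\<^sub>C K" for A
    proof (rule bop_eqI)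
      fix x
      have "app (K * A * K) x = app K (app A (\<phi> x *\<^sub>C v))" by (simp only: app_mult K[of x])
      also have "\<dots> = \<phi> x *\<^sub>C (\<tau> A *\<^sub>C v)" by (simp add: K[of "app A v"] \<tau>_def)
      also have "\<dots> = app (\<tau> A *\<^sub>C K) x" by (simp add: app_cscale K[of x] scaleC_scaleC mult.commute)
      finally show "app (K * A * K) x = app (\<tau> A *\<^sub>C K) x" .
    qed
    moreover have "cmod (\<tau> A) \<le> norm K * norm A" for A
    proof -
      have "cmod (\<tau> A) * norm v = norm (app K (app A v))" by (simp add: \<tau>_def K norm_scaleC)
      also have "\<dots> \<le> norm K * (norm A * norm v)"
        by (rule order_trans[OF norm_app]) (intro mult_left_mono norm_app norm_ge_zero)
      finally show ?thesis using False by (simp add: mult.assoc[symmetric])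
    qed
    moreover have "\<tau> (A + A') = \<tau> A + \<tau> A'" for A A'
      by (simp add: \<tau>_def \<phi>_def app_add app_add_right cinner_add_left add_divide_distrib)
    moreover have "\<tau> (c *\<^sub>C A) = c * \<tau> A" for c A
      by (simp add: \<tau>_def \<phi>_def app_cscale cinner_scaleC_left)
    ultimately show ?thesis by (intro exI[of _ \<tau>] exI[of _ "norm K"]) auto
  qed
qed

text \<open>
  The resolvent \<open>(1 - z A)\<^sup>-\<^sup>1\<close> is meromorphic on a disc of radius greater than \<open>1\<close>, with the zeros of a
  polynomial \<open>\<rho>\<close> as its only possible poles.
\<close>

definition meromorphic_resolvent :: "'a::complex_inner bop \<Rightarrow> bool" where
  "meromorphic_resolvent A \<longleftrightarrow> (\<exists>\<rho>. \<rho> \<noteq> 0 \<and> decays (fps_nth (scalar_fps (fps_of_poly \<rho>) * resolvent_fps A)))"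

lemma meromorphic_resolvent_contraction:
  assumes "norm Y < 1"
  shows "meromorphic_resolvent Y"
  unfolding meromorphic_resolvent_def
proof (intro exI[of _ 1] conjI)
  have "decays (fps_nth (resolvent_fps Y))"
    by (rule decays_power[of _ "norm Y"]) (use assms in \<open>auto intro: norm_power_le\<close>)
  then show "decays (fps_nth (scalar_fps (fps_of_poly 1) * resolvent_fps Y))" by simp
qed simp

text \<open>
  Put \<open>P = (1 - z Y)\<^sup>-\<^sup>1\<close> and \<open>R = (1 - z (Y + K))\<^sup>-\<^sup>1\<close>. With \<open>K P K = t K\<close> for a scalar series \<open>t\<close>, the resolvent
  identity gives \<open>(1 - z t) K R = K P\<close> and hence \<open>(1 - z t) R = (1 - z t) P + z P K P\<close>. Multiplication by
  \<open>\<rho>\<^sup>2\<close> makes the right-hand side analytic, and the zeros of the scalar function \<open>\<rho>\<^sup>2 (1 - z t)\<close> are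
  then cleared by a polynomial.
\<close>

lemma meromorphic_resolvent_rank_one:
  fixes Y K :: "'a::complex_inner bop"
  assumes "meromorphic_resolvent Y" "rank_one K"
  shows "meromorphic_resolvent (Y + K)"
proof -
  define X where "X = Y + K"
  have XY: "X - Y = K" by (simp add: X_def)
  obtain \<rho> where \<rho>: "\<rho> \<noteq> 0" and \<rho>decays: "decays (fps_nth (scalar_fps (fps_of_poly \<rho>) * resolvent_fps Y))"
    using assms(1) unfolding meromorphic_resolvent_def by blast
  obtain \<tau> B where \<tau>: "\<And>A. K * A * K = \<tau> A *\<^sub>C K" "\<And>A. cmod (\<tau> A) \<le> B * norm A" "0 \<le> B"
    "\<And>A A'. \<tau> (A + A') = \<tau> A + \<tau> A'" "\<And>c A. \<tau> (c *\<^sub>C A) = c * \<tau> A"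
    using rank_one_compression[OF assms(2)] by blast
  have \<tau>0: "\<tau> 0 = 0" using \<tau>(4)[of 0 0] by simp
  have \<tau>sum: "\<tau> (\<Sum>i\<in>I. f i) = (\<Sum>i\<in>I. \<tau> (f i))" for f and I :: "nat set"
    by (induction I rule: infinite_finite_induct) (auto simp: \<tau>0 \<tau>(4))
  define t where "t = Abs_fps (\<lambda>n. \<tau> (Y ^ n))"
  let ?K = "fps_const K" and ?z = "scalar_fps fps_X :: 'a bop fps" and ?\<rho> = "fps_of_poly \<rho>"
  define P where "P = resolvent_fps Y"
  define R where "R = resolvent_fps X"
  have KPK: "?K * P * ?K = scalar_fps t * ?K"
  proof (rule fps_ext)
    fix n
    have "fps_nth (scalar_fps t * ?K) n = fps_nth t n *\<^sub>C K"
      by (simp add: fps_mult_right_const_nth)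
    then show "fps_nth (?K * P * ?K) n = fps_nth (scalar_fps t * ?K) n"
      by (simp add: fps_mult_right_const_nth P_def t_def \<tau>(1))
  qed
  define m0 where "m0 = 1 - fps_X * t"
  have R: "R = P + ?z * (P * ?K * R)" using resolvent_fps_diff[of X Y] by (simp add: R_def P_def XY)
  have "?K * R = ?K * P + ?K * (?z * (P * ?K * R))" by (subst R) (rule distrib_left)
  also have "?K * (?z * (P * ?K * R)) = ?z * ((?K * P * ?K) * R)"
    by (simp only: mult.assoc scalar_fps_left_commute[of "?K"])
  also have "\<dots> = scalar_fps (fps_X * t) * (?K * R)"
    unfolding KPK by (simp only: scalar_fps_mult mult.assoc)
  finally have KR: "scalar_fps m0 * (?K * R) = ?K * P"
    by (simp add: m0_def scalar_fps_diff left_diff_distrib algebra_simps)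
  have "scalar_fps m0 * R = scalar_fps m0 * P + scalar_fps m0 * (?z * (P * ?K * R))" by (subst R) (rule distrib_left)
  also have "scalar_fps m0 * (?z * (P * ?K * R)) = ?z * (P * (scalar_fps m0 * (?K * R)))"
    by (simp only: mult.assoc scalar_fps_left_commute[of P] scalar_fps_left_commute[of "?z"])
  finally have m0R: "scalar_fps m0 * R = scalar_fps m0 * P + ?z * (P * (?K * P))" by (simp only: KR)
  define m where "m = ?\<rho> * (?\<rho> * m0)"
  have "scalar_fps m * R = scalar_fps (?\<rho> * ?\<rho>) * (scalar_fps m0 * R)" by (simp add: m_def scalar_fps_mult mult.assoc)
  also have "\<dots> = scalar_fps (?\<rho> * ?\<rho>) * (scalar_fps m0 * P) + scalar_fps (?\<rho> * ?\<rho>) * (?z * (P * (?K * P)))"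
    by (simp only: m0R distrib_left)
  also have "scalar_fps (?\<rho> * ?\<rho>) * (scalar_fps m0 * P) = scalar_fps (?\<rho> * m0) * (scalar_fps ?\<rho> * P)"
    by (simp only: scalar_fps_mult mult.assoc scalar_fps_left_commute[of "scalar_fps m0"])
  also have "scalar_fps (?\<rho> * ?\<rho>) * (?z * (P * (?K * P))) = ?z * ((scalar_fps ?\<rho> * P) * (?K * (scalar_fps ?\<rho> * P)))"
    by (simp only: scalar_fps_mult mult.assoc scalar_fps_left_commute[of "?K"] scalar_fps_left_commute[of P] scalar_fps_left_commute[of "?z"])
  finally have mR: "scalar_fps m * R = scalar_fps (?\<rho> * m0) * (scalar_fps ?\<rho> * P) + ?z * ((scalar_fps ?\<rho> * P) * (?K * (scalar_fps ?\<rho> * P)))" .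
  have geoX: "decays (fps_nth (fps_X :: complex fps))"
    by (rule decays_finite_support[of 2]) (auto simp: fps_X_def)
  have decays\<rho>: "decays (fps_nth ?\<rho>)"
    by (rule decays_finite_support[of "Suc (degree \<rho>)"]) (auto intro: coeff_eq_0)
  have "fps_nth (?\<rho> * t) n = \<tau> (fps_nth (scalar_fps ?\<rho> * P) n)" for n
    by (simp add: scalar_fps_mult_nth \<tau>sum \<tau>(5) fps_mult_nth t_def P_def)
  then have "decays (fps_nth (?\<rho> * t))"
    using \<rho>decays \<tau>(2,3) by (intro decays_dominated[OF \<rho>decays, of _ B]) (auto simp: P_def)
  then have "decays (fps_nth (fps_X * (?\<rho> * t)))" by (rule decays_fps_mult[OF geoX])
  then have "decays (\<lambda>n. fps_nth ?\<rho> n - fps_nth (fps_X * (?\<rho> * t)) n)" by (intro decays_diff decays\<rho>)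
  moreover have "?\<rho> * m0 = ?\<rho> - fps_X * (?\<rho> * t)" by (simp add: m0_def algebra_simps)
  then have "fps_nth (?\<rho> * m0) = (\<lambda>n. fps_nth ?\<rho> n - fps_nth (fps_X * (?\<rho> * t)) n)"
    by (simp only: fps_sub_nth fun_eq_iff) simp
  ultimately have decays\<rho>m0: "decays (fps_nth (?\<rho> * m0))" by (simp only:)
  then have geom: "decays (fps_nth m)" unfolding m_def by (rule decays_fps_mult[OF decays\<rho>])
  have "fps_nth m0 0 = 1" by (simp add: m0_def)
  then have "m0 \<noteq> 0" by auto
  then have "m \<noteq> 0" using \<rho> by (simp add: m_def)
  then obtain \<mu> h where \<mu>: "\<mu> \<noteq> 0" "decays (fps_nth h)" "h * m = fps_of_poly \<mu>"
    using power_series_divides_poly[OF geom] by blast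
  have "decays (fps_nth (scalar_fps m * R))"
  proof -
    have "decays (fps_nth (scalar_fps (?\<rho> * m0) * (scalar_fps ?\<rho> * P)))"
      unfolding P_def by (rule decays_fps_mult[OF decays_emb[OF decays\<rho>m0] \<rho>decays])
    moreover have "decays (fps_nth (?z * ((scalar_fps ?\<rho> * P) * (?K * (scalar_fps ?\<rho> * P)))))"
      unfolding P_def
      by (rule decays_fps_mult[OF decays_emb[OF geoX] decays_fps_mult[OF \<rho>decays decays_fps_mult[OF decays_fps_const \<rho>decays]]])
    ultimately show ?thesis unfolding mR fps_add_nth by (rule decays_add)
  qed
  then have "decays (fps_nth (scalar_fps h * (scalar_fps m * R)))" by (rule decays_fps_mult[OF decays_emb[OF \<mu>(2)]])
  then have "decays (fps_nth (scalar_fps (fps_of_poly \<mu>) * R))" by (simp add: \<mu>(3)[symmetric] scalar_fps_mult mult.assoc)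
  then show ?thesis using \<mu>(1) unfolding meromorphic_resolvent_def R_def X_def by blast
qed

lemma meromorphic_resolvent_finrank:
  assumes "finrank F" "norm Y < 1"
  shows "meromorphic_resolvent (Y + F)"
  using assms(1)
proof (induction rule: finrank.induct)
  case zero
  then show ?case using meromorphic_resolvent_contraction[OF assms(2)] by simp
next
  case (add_rank_one F K)
  then show ?case using meromorphic_resolvent_rank_one[of "Y + F" K] by (simp add: add.assoc)
qed

text \<open>
  The coefficient of index \<open>n + degree \<rho>\<close> of \<open>\<rho>(z) (1 - z X)\<^sup>-\<^sup>1\<close> is \<open>r(X) X\<^sup>n\<close>, where \<open>r\<close> is \<open>\<rho>\<close> with its
  coefficients in reverse order.
\<close>

lemma finrank_perturbation_annihilator:
  fixes Y F :: "'a::complex_inner bop"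
  assumes "finrank F" "norm Y < 1"
  shows "\<exists>r. r \<noteq> 0 \<and> decays (\<lambda>n. peval r (Y + F) * (Y + F) ^ n)"
proof -
  define X where "X = Y + F"
  obtain \<rho> where \<rho>: "\<rho> \<noteq> 0" "decays (fps_nth (scalar_fps (fps_of_poly \<rho>) * resolvent_fps X))"
    using meromorphic_resolvent_finrank[OF assms] unfolding meromorphic_resolvent_def X_def by blast
  define d where "d = degree \<rho>"
  define r where "r = reflect_poly \<rho>"
  have "peval r X * X ^ k = fps_nth (scalar_fps (fps_of_poly \<rho>) * resolvent_fps X) (k + d)" for k
  proof -
    have "fps_nth (scalar_fps (fps_of_poly \<rho>) * resolvent_fps X) (k + d) = (\<Sum>i=0..k+d. coeff \<rho> i *\<^sub>C X ^ (k + d - i))"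
      by (simp add: scalar_fps_mult_nth)
    also have "\<dots> = (\<Sum>i\<le>d. coeff \<rho> i *\<^sub>C X ^ (k + d - i))"
      by (rule sum.mono_neutral_right) (auto simp: coeff_eq_0 d_def)
    also have "\<dots> = (\<Sum>i\<le>d. coeff r i *\<^sub>C X ^ i * X ^ k)"
    proof (rule sum.reindex_bij_witness[where i="\<lambda>i. d - i" and j="\<lambda>i. d - i"])
      fix i assume i: "i \<in> {..d}"
      then have "X ^ (k + d - i) = X ^ (d - i) * X ^ k" by (simp add: power_add[symmetric] add.commute)
      then show "coeff r (d - i) *\<^sub>C X ^ (d - i) * X ^ k = coeff \<rho> i *\<^sub>C X ^ (k + d - i)"
        using i by (auto simp: r_def coeff_reflect_poly d_def)
    qed auto
    also have "\<dots> = peval r X * X ^ k"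
      unfolding r_def d_def by (subst peval_bound[OF degree_reflect_poly_le]) (rule sum_distrib_right[symmetric])
    finally show ?thesis by simp
  qed
  then have "decays (\<lambda>k. peval r X * X ^ k)" using decays_shift[OF \<rho>(2), of d] by simp
  moreover have "r \<noteq> 0" using \<rho>(1) by (simp add: r_def)
  ultimately show ?thesis unfolding X_def by blast
qed

text \<open>
  A zero inside the open unit disc is superfluous: the sequence \<open>w\<^sub>n = A X\<^sup>n\<close> satisfies
  \<open>w\<^sub>n\<^sub>+\<^sub>1 = \<zeta> w\<^sub>n + g\<^sub>n\<close> with \<open>\<bar>\<zeta>\<bar> < 1\<close> and \<open>g\<close> decaying.
\<close>

lemma annihilator_strip_root:
  fixes X A :: "'a::complex_inner bop"
  assumes "decays (\<lambda>n. (X - \<zeta> *\<^sub>C 1) * A * X ^ n)" "cmod \<zeta> < 1" "A * X = X * A"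
  shows "decays (\<lambda>n. A * X ^ n)"
proof (rule decays_recursion[OF assms(1), where l="cmod \<zeta>"])
  fix n
  have "A * X ^ Suc n = \<zeta> *\<^sub>C (A * X ^ n) + (X - \<zeta> *\<^sub>C 1) * A * X ^ n"
    using assms(3) by (simp add: algebra_simps) (metis mult.assoc)
  then show "norm (A * X ^ Suc n) \<le> cmod \<zeta> * norm (A * X ^ n) + norm ((X - \<zeta> *\<^sub>C 1) * A * X ^ n)"
    using norm_triangle_ineq[of "\<zeta> *\<^sub>C (A * X ^ n)" "(X - \<zeta> *\<^sub>C 1) * A * X ^ n"]
    by (simp add: norm_cscale)
qed (use assms in auto)

text \<open>
  A polynomial of least degree with the decay property has no zero in the open unit disc.
\<close>

lemma ex_unstable_annihilator:
  fixes Y F :: "'a::complex_inner bop"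
  assumes "finrank F" "norm Y < 1"
  shows "\<exists>r. r \<noteq> 0 \<and> (\<forall>\<zeta>. poly r \<zeta> = 0 \<longrightarrow> cmod \<zeta> \<ge> 1) \<and> decays (\<lambda>n. peval r (Y + F) * (Y + F) ^ n)"
proof -
  define X where "X = Y + F"
  let ?Q = "\<lambda>r. r \<noteq> 0 \<and> decays (\<lambda>n. peval r X * X ^ n)"
  have ex: "\<exists>r. ?Q r" using finrank_perturbation_annihilator[OF assms] by (simp add: X_def)
  define r where "r = arg_min degree ?Q"
  have r: "?Q r" "\<And>s. ?Q s \<Longrightarrow> degree r \<le> degree s"
    using arg_min_natI[of ?Q _ degree] arg_min_nat_le[of ?Q _ degree] ex unfolding r_def by blast+
  have "cmod \<zeta> \<ge> 1" if "poly r \<zeta> = 0" for \<zeta>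
  proof (rule ccontr)
    assume l: "\<not> cmod \<zeta> \<ge> 1"
    obtain s where s: "r = [:- \<zeta>, 1:] * s" using \<open>poly r \<zeta> = 0\<close> by (auto simp: poly_eq_0_iff_dvd dvd_def)
    have s0: "s \<noteq> 0" using r(1) s by auto
    have rs: "peval r X = (X - \<zeta> *\<^sub>C 1) * peval s X"
      unfolding s peval_mult by (simp add: peval_pCons scaleC_minus_left)
    have "decays (\<lambda>n. (X - \<zeta> *\<^sub>C 1) * peval s X * X ^ n)" using r(1) by (simp only: rs)
    then have "decays (\<lambda>n. peval s X * X ^ n)"
      by (rule annihilator_strip_root) (use l in \<open>simp_all add: peval_commutes\<close>)
    then have "degree r \<le> degree s" using r(2) s0 by blast
    moreover have "degree r = degree [:- \<zeta>, 1:] + degree s"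
      unfolding s using s0 by (intro degree_mult_eq) auto
    ultimately show False by simp
  qed
  with r(1) show ?thesis unfolding X_def by blast
qed

section \<open>Semi-Fredholm operators\<close>

text \<open>
  On a Hilbert space this is the sequential description of the operators with finite-dimensional kernel and closed
  range, the upper semi-Fredholm operators. In this form the class is visibly closed under products.
\<close>

definition proper :: "'a::complex_inner bop \<Rightarrow> bool" where
  "proper A \<longleftrightarrow> (\<forall>x::nat \<Rightarrow> 'a. \<forall>B. (\<forall>k. norm (x k) \<le> B) \<longrightarrow> convergent (\<lambda>k. app A (x k)) \<longrightarrow>
     (\<exists>s. strict_mono s \<and> convergent (\<lambda>k. x (s k))))"

lemma properE:
  fixes x :: "nat \<Rightarrow> 'a::complex_inner"
  assumes "proper A" "\<And>k. norm (x k) \<le> B" "convergent (\<lambda>k. app A (x k))"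
  obtains s where "strict_mono s" "convergent (\<lambda>k. x (s k))"
  using assms unfolding proper_def by blast

lemma proper_one: "proper 1"
  unfolding proper_def by (auto intro!: exI[of _ id] strict_mono_id)

lemma proper_mult:
  fixes A C :: "'a::complex_inner bop"
  assumes "proper A" "proper C"
  shows "proper (A * C)"
  unfolding proper_def
proof (intro allI impI)
  fix x :: "nat \<Rightarrow> 'a" and B
  assume B: "\<forall>k. norm (x k) \<le> B" and conv: "convergent (\<lambda>k. app (A * C) (x k))"
  have "norm (app C (x k)) \<le> norm C * B" for k
    using B by (intro order_trans[OF norm_app] mult_left_mono) auto
  then obtain s where s: "strict_mono s" "convergent (\<lambda>k. app C (x (s k)))"
    using properE[OF assms(1), of "\<lambda>k. app C (x k)"] conv by (auto simp: app_mult)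
  obtain t where t: "strict_mono t" "convergent (\<lambda>k. x (s (t k)))"
    using properE[OF assms(2), of "\<lambda>k. x (s k)" B] B s(2) by auto
  show "\<exists>s. strict_mono s \<and> convergent (\<lambda>k. x (s k))"
    using strict_mono_o[OF s(1) t(1)] t(2) by (intro exI[of _ "s \<circ> t"]) auto
qed

lemma proper_cscale:
  fixes A :: "'a::complex_inner bop"
  assumes "proper A" "c \<noteq> 0"
  shows "proper (c *\<^sub>C A)"
  unfolding proper_def
proof (intro allI impI)
  fix x :: "nat \<Rightarrow> 'a" and B
  assume B: "\<forall>k. norm (x k) \<le> B" and conv: "convergent (\<lambda>k. app (c *\<^sub>C A) (x k))"
  obtain l where "(\<lambda>k. app (c *\<^sub>C A) (x k)) \<longlonglongrightarrow> l" using conv by (auto simp: convergent_def)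
  then have "(\<lambda>k. app (inverse c *\<^sub>C 1) (app (c *\<^sub>C A) (x k))) \<longlonglongrightarrow> app (inverse c *\<^sub>C 1) l"
    by (intro tendsto_intros)
  then have "convergent (\<lambda>k. app A (x k))"
    using assms(2) by (auto simp: convergent_def app_cscale scaleC_scaleC)
  then show "\<exists>s. strict_mono s \<and> convergent (\<lambda>k. x (s k))"
    using properE[OF assms(1), of x B] B by blast
qed

text \<open>
  The operator \<open>Y - \<zeta>\<close> is bounded below by \<open>1 - \<parallel>Y\<parallel>\<close>, and \<open>F\<close> sends a bounded sequence to one with a
  convergent subsequence.
\<close>

lemma proper_shifted_contraction:
  fixes Y F :: "'a::chilbert_space bop"
  assumes "norm Y < 1" "finrank F" "cmod \<zeta> \<ge> 1"
  shows "proper (Y + F - \<zeta> *\<^sub>C 1)"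
  unfolding proper_def
proof (intro allI impI)
  fix x :: "nat \<Rightarrow> 'a" and B
  assume B: "\<forall>k. norm (x k) \<le> B" and conv: "convergent (\<lambda>k. app (Y + F - \<zeta> *\<^sub>C 1) (x k))"
  obtain s l where s: "strict_mono s" "(\<lambda>k. app F (x (s k))) \<longlonglongrightarrow> l"
    using finrank_convergent_subseq[OF assms(2), of x B] B by blast
  obtain l' where "(\<lambda>k. app (Y + F - \<zeta> *\<^sub>C 1) (x k)) \<longlonglongrightarrow> l'" using conv by (auto simp: convergent_def)
  then have "(\<lambda>k. app (Y + F - \<zeta> *\<^sub>C 1) (x (s k))) \<longlonglongrightarrow> l'"
    using s(1) LIMSEQ_subseq_LIMSEQ[of _ l' s] by (simp add: o_def)
  then have "(\<lambda>k. app (Y + F - \<zeta> *\<^sub>C 1) (x (s k)) - app F (x (s k))) \<longlonglongrightarrow> l' - l"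
    using s(2) by (rule tendsto_diff)
  then have "(\<lambda>k. app (Y - \<zeta> *\<^sub>C 1) (x (s k))) \<longlonglongrightarrow> l' - l" by (simp add: app_simps algebra_simps)
  then have cau: "Cauchy (\<lambda>k. app (Y - \<zeta> *\<^sub>C 1) (x (s k)))" by (rule LIMSEQ_imp_Cauchy)
  define d where "d = 1 - norm Y"
  have d: "d > 0" using assms by (simp add: d_def)
  have below: "d * norm v \<le> norm (app (Y - \<zeta> *\<^sub>C 1) v)" for v
  proof -
    have "1 * norm v \<le> cmod \<zeta> * norm v" using assms(3) by (intro mult_right_mono) auto
    also have "\<dots> = norm (app Y v - app (Y - \<zeta> *\<^sub>C 1) v)" by (simp add: app_simps norm_scaleC)
    also have "\<dots> \<le> norm (app Y v) + norm (app (Y - \<zeta> *\<^sub>C 1) v)" by (rule norm_triangle_ineq4)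
    finally show ?thesis using norm_app[of Y v] by (simp add: d_def left_diff_distrib)
  qed
  have "Cauchy (\<lambda>k. x (s k))"
  proof (rule CauchyI)
    fix e :: real assume "e > 0"
    then have "d * e > 0" using d by simp
    then obtain M where M: "\<And>m n. m \<ge> M \<Longrightarrow> n \<ge> M \<Longrightarrow>
      norm (app (Y - \<zeta> *\<^sub>C 1) (x (s m)) - app (Y - \<zeta> *\<^sub>C 1) (x (s n))) < d * e"
      using CauchyD[OF cau] by blast
    have "norm (x (s m) - x (s n)) < e" if "m \<ge> M" "n \<ge> M" for m n
      using below[of "x (s m) - x (s n)"] M[OF that] d
      by (simp add: app_diff_right) (metis le_less_trans mult_less_cancel_left_pos)
    then show "\<exists>M. \<forall>m\<ge>M. \<forall>n\<ge>M. norm (x (s m) - x (s n)) < e" by blast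
  qed
  then show "\<exists>s. strict_mono s \<and> convergent (\<lambda>k. x (s k))"
    using s(1) Cauchy_convergent_iff by blast
qed

lemma proper_peval:
  fixes Y F :: "'a::chilbert_space bop"
  assumes "norm Y < 1" "finrank F" "r \<noteq> 0" "\<And>\<zeta>. poly r \<zeta> = 0 \<Longrightarrow> cmod \<zeta> \<ge> 1"
  shows "proper (peval r (Y + F))"
  using assms(3,4)
proof (induction "degree r" arbitrary: r)
  case 0
  then obtain c where "r = [:c:]" "c \<noteq> 0" by (metis degree_eq_zeroE pCons_0_0)
  then show ?case by (simp add: peval_const proper_cscale proper_one)
next
  case (Suc n)
  obtain \<zeta> where \<zeta>: "poly r \<zeta> = 0"
    using alg_closed_imp_poly_has_root[of r] Suc.hyps(2) by auto
  then obtain s where s: "r = [:- \<zeta>, 1:] * s" by (auto simp: poly_eq_0_iff_dvd dvd_def)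
  have s0: "s \<noteq> 0" using Suc.prems(1) s by auto
  have "degree r = degree [:- \<zeta>, 1:] + degree s" unfolding s using s0 by (intro degree_mult_eq) auto
  then have "proper (peval s (Y + F))"
    using Suc.hyps(2) s0 Suc.prems(2) by (intro Suc.hyps(1)) (auto simp: s)
  moreover have "peval r (Y + F) = (Y + F - \<zeta> *\<^sub>C 1) * peval s (Y + F)"
    unfolding s peval_mult by (simp add: peval_pCons scaleC_minus_left)
  ultimately show ?case
    using proper_mult[OF proper_shifted_contraction[OF assms(1,2)]] Suc.prems(2)[OF \<zeta>] by simp
qed

text \<open>
  On the kernel the defining property of \<open>proper\<close> says that the unit ball is compact. Hence some
  orthogonal projection into the kernel moves every unit vector of the kernel by less than \<open>1\<close>, and then
  no unit vector of the kernel is orthogonal to its range.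
\<close>

lemma ex_kernel_projection:
  fixes S :: "'a::chilbert_space bop"
  assumes "proper S"
  shows "\<exists>P. finrank P \<and> orth_proj P \<and> S * P = 0 \<and> (\<forall>x. app S x = 0 \<longrightarrow> app P x = x)"
proof -
  define M where "M = {x. app S x = 0}"
  have sub: "complex_vector.subspace M"
    by (auto simp: M_def complex_vector.subspace_def app_add_right)
  have comp: "compact (M \<inter> cball 0 1)" unfolding compact_def
  proof (intro allI impI)
    fix f :: "nat \<Rightarrow> 'a" assume f: "\<forall>n. f n \<in> M \<inter> cball 0 1"
    then have "(\<lambda>k. app S (f k)) = (\<lambda>k. 0)" by (auto simp: M_def)
    then obtain s where s: "strict_mono s" "convergent (\<lambda>k. f (s k))"
      using properE[OF assms, of f 1] f by (auto simp: convergent_const)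
    then obtain l where l: "(\<lambda>k. f (s k)) \<longlonglongrightarrow> l" by (auto simp: convergent_def)
    then have "(\<lambda>k. app S (f (s k))) \<longlonglongrightarrow> app S l" by (intro tendsto_intros)
    moreover have "app S (f (s k)) = 0" for k using f by (auto simp: M_def)
    ultimately have "app S l = 0" by (simp add: LIMSEQ_const_iff)
    moreover have "norm l \<le> 1"
      using l f by (intro LIMSEQ_le_const2[OF tendsto_norm[OF l]]) auto
    ultimately show "\<exists>l\<in>M \<inter> cball 0 1. \<exists>r. strict_mono r \<and> (f \<circ> r) \<longlonglongrightarrow> l"
      using s(1) l by (intro bexI[of _ l] exI[of _ s]) (auto simp: M_def o_def)
  qed
  obtain P where P: "finrank P" "orth_proj P" "\<And>x. app P x \<in> M"
    "\<And>y. y \<in> M \<inter> cball 0 1 \<Longrightarrow> norm (y - app P y) < 1"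
    using ex_orth_proj_compact[OF comp _ sub, of 1] by auto
  have "app P x = x" if x: "x \<in> M" for x
  proof (rule ccontr)
    assume ne: "app P x \<noteq> x"
    define w where "w = x - app P x"
    have w: "w \<in> M" "w \<noteq> 0" using ne x P(3) sub by (auto simp: w_def intro: complex_vector.subspace_diff)
    have Pw: "app P w = 0" by (simp add: w_def app_diff_right orth_proj_app_app[OF P(2)])
    define u where "u = (1 / norm w) *\<^sub>R w"
    have "u \<in> M" using w(1) by (simp add: u_def M_def app_scaleR_right)
    moreover have "norm u = 1" using w by (simp add: u_def)
    moreover have "app P u = 0" by (simp add: u_def app_scaleR_right Pw)
    ultimately show False using P(4)[of u] by auto
  qed
  moreover have "S * P = 0" by (rule bop_eqI) (use P(3) in \<open>auto simp: M_def app_mult\<close>)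
  ultimately show ?thesis using P by (auto simp: M_def)
qed

text \<open>
  \<open>S\<close> is bounded below on the orthogonal complement of its kernel: otherwise there are unit vectors
  in the complement on which \<open>S\<close> tends to \<open>0\<close>, and a limit of a subsequence is a unit vector lying both in
  the kernel and in the complement.
\<close>

lemma proper_bounded_below:
  fixes S P :: "'a::chilbert_space bop"
  assumes "proper S" "orth_proj P" "S * P = 0" "\<And>x. app S x = 0 \<Longrightarrow> app P x = x"
  shows "\<exists>C\<ge>0. \<forall>y. norm (app (1 - P) y) \<le> C * norm (app S y)"
proof (rule ccontr)
  assume "\<not> ?thesis"
  then have "\<forall>k::nat. \<exists>y. norm (app (1 - P) y) > real k * norm (app S y)"
    by (metis not_le of_nat_0_le_iff)
  then obtain y where y: "\<And>k::nat. norm (app (1 - P) (y k)) > real k * norm (app S (y k))" by metis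
  define n where "n k = norm (app (1 - P) (y k))" for k
  have n: "n k > 0" for k using y[of k] by (smt (verit) n_def mult_nonneg_nonneg norm_ge_zero of_nat_0_le_iff)
  define x where "x k = (1 / n k) *\<^sub>R app (1 - P) (y k)" for k
  have nx: "norm (x k) = 1" for k using n[of k] by (simp add: x_def n_def[symmetric])
  have PP: "app P (app P z) = app P z" for z by (rule orth_proj_app_app[OF assms(2)])
  have Px: "app P (x k) = 0" for k by (simp add: x_def app_scaleR_right app_simps app_right_simps PP)
  have SP: "app S (app P z) = 0" for z by (metis app_mult app_zero assms(3))
  have Sx: "app S (x k) = (1 / n k) *\<^sub>R app S (y k)" for k
    by (simp add: x_def app_scaleR_right app_simps app_right_simps SP)
  have "norm (app S (x k)) \<le> 1 / real k" if "k > 0" for k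
    using y[of k] n[of k] that by (simp add: Sx n_def[symmetric] field_simps)
  then have "(\<lambda>k. app S (x k)) \<longlonglongrightarrow> 0"
    by (intro Lim_null_comparison[OF _ lim_1_over_n])
       (auto intro!: eventually_mono[OF eventually_gt_at_top[of 0]])
  then obtain s where s: "strict_mono s" "convergent (\<lambda>k. x (s k))"
    using properE[OF assms(1), of x 1] nx by (auto simp: convergent_def)
  then obtain l where l: "(\<lambda>k. x (s k)) \<longlonglongrightarrow> l" by (auto simp: convergent_def)
  have "(\<lambda>k. app S (x (s k))) \<longlonglongrightarrow> 0"
    using LIMSEQ_subseq_LIMSEQ[OF \<open>(\<lambda>k. app S (x k)) \<longlonglongrightarrow> 0\<close> s(1)] by (simp add: o_def)
  moreover have "(\<lambda>k. app S (x (s k))) \<longlonglongrightarrow> app S l" by (intro tendsto_intros l)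
  ultimately have "app S l = 0" by (metis LIMSEQ_unique)
  then have "app P l = l" by (rule assms(4))
  moreover have "(\<lambda>k. app P (x (s k))) \<longlonglongrightarrow> app P l" by (intro tendsto_intros l)
  ultimately have "l = 0" by (simp add: Px LIMSEQ_const_iff)
  moreover have "norm l = 1" using tendsto_norm[OF l] by (simp add: nx LIMSEQ_const_iff)
  ultimately show False by simp
qed

section \<open>Resolvents\<close>

lemma neumann_inverse:
  fixes Z :: "'a::chilbert_space bop"
  assumes "decays (\<lambda>n. Z ^ n)"
  shows "\<exists>W. (1 - Z) * W = 1 \<and> W * (1 - Z) = 1"
proof -
  obtain C q where Cq: "0 \<le> C" "0 < q" "q < 1" "\<And>n. norm (Z ^ n) \<le> C * q ^ n" using decaysE[OF assms] by blast
  have le: "norm (app (Z ^ n) x) \<le> C * norm x * q ^ n" for n x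
    using order_trans[OF norm_app mult_right_mono[OF Cq(4)]] by (simp add: mult_ac)
  have sumr: "summable (\<lambda>n. C * norm x * q ^ n)" for x :: 'a
    using Cq by (intro summable_mult summable_geometric) auto
  have sumb: "summable (\<lambda>n. app (Z ^ n) x)" for x
    by (rule summable_comparison_test'[OF sumr le])
  define f where "f x = (\<Sum>n. app (Z ^ n) x)" for x
  have "\<exists>W. \<forall>x. app W x = f x"
  proof (rule ex_bop)
    fix x y :: 'a and c
    show "f (x + y) = f x + f y" by (simp add: f_def app_add_right suminf_add sumb)
    have "bounded_linear (\<lambda>z::'a. c *\<^sub>C z)"
      by (rule bounded_linear_intro[where K="cmod c"])
         (auto simp: norm_scaleC scaleC_add_right scaleR_eq_scaleC scaleC_scaleC mult.commute)
    then show "f (c *\<^sub>C x) = c *\<^sub>C f x"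
      unfolding f_def by (simp add: bounded_linear.suminf[OF _ sumb])
    have sumn: "summable (\<lambda>n. norm (app (Z ^ n) x))"
      by (rule summable_comparison_test'[OF sumr[of x]]) (simp add: le)
    have "norm (f x) \<le> (\<Sum>n. norm (app (Z ^ n) x))"
      unfolding f_def by (rule summable_norm[OF sumn])
    also have "\<dots> \<le> (\<Sum>n. C * norm x * q ^ n)"
      by (rule suminf_le[OF le sumn sumr])
    also have "\<dots> = norm x * (C / (1 - q))"
      using Cq by (subst suminf_mult) (auto simp: suminf_geometric intro: summable_geometric)
    finally show "norm (f x) \<le> norm x * (C / (1 - q))" .
  qed
  then obtain W where W: "\<And>x. app W x = (\<Sum>n. app (Z ^ n) x)" by (auto simp: f_def)
  have step: "(\<Sum>n. app (Z ^ Suc n) x) = app W x - x" for x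
    using suminf_split_head[OF sumb, of x] by (simp add: W)
  have "(1 - Z) * W = 1"
  proof (rule bop_eqI)
    fix x
    have "app Z (app W x) = (\<Sum>n. app Z (app (Z ^ n) x))"
      unfolding W by (rule bounded_linear.suminf[OF bounded_linear_app sumb])
    then show "app ((1 - Z) * W) x = app 1 x" using step[of x] by (simp add: app_simps)
  qed
  moreover have "W * (1 - Z) = 1"
  proof (rule bop_eqI)
    fix x
    have "app W (app Z x) = (\<Sum>n. app (Z ^ Suc n) x)"
      unfolding W by (simp add: app_mult[symmetric] power_commutes)
    then show "app (W * (1 - Z)) x = app 1 x" using step[of x] by (simp add: app_simps app_right_simps)
  qed
  ultimately show ?thesis by blast
qed

text \<open>
  The theorem of Gelfand that the spectrum is not empty, for the operator \<open>A\<close> acting on the range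
  of a projection \<open>e\<close>, the identity of the corner algebra. If \<open>z e - A\<close> had an inverse \<open>R(z)\<close> for
  every \<open>z\<close>, the matrix coefficients of \<open>R\<close> would be entire and vanish at infinity; by Liouville's
  theorem \<open>R = 0\<close>, so \<open>e = 0\<close>.
\<close>

lemma spectrum_nonempty:
  fixes A e :: "'a::complex_inner bop"
  assumes e: "e * e = e" "A * e = A" "e * A = A"
    and R: "\<And>z. R z * e = R z" "\<And>z. e * R z = R z"
      "\<And>z. (z *\<^sub>C e - A) * R z = e" "\<And>z. R z * (z *\<^sub>C e - A) = e"
  shows "e = 0"
proof -
  have resolvent: "R z - R w = (w - z) *\<^sub>C (R z * R w)" for z w
  proof -
    have "R z * ((w *\<^sub>C e - A) - (z *\<^sub>C e - A)) * R w = R z * ((w *\<^sub>C e - A) * R w) - (R z * (z *\<^sub>C e - A)) * R w"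
      by (simp only: right_diff_distrib left_diff_distrib mult.assoc)
    also have "\<dots> = R z - R w" by (simp add: R)
    finally have "R z - R w = R z * ((w - z) *\<^sub>C e) * R w" by (simp add: scaleC_diff_left)
    then show ?thesis by (simp add: R)
  qed
  have norm_diff: "norm (R z - R w) \<le> cmod (w - z) * (norm (R z) * norm (R w))" for z w
    unfolding resolvent norm_cscale by (intro mult_left_mono norm_mult_ineq) auto
  \<comment> \<open>Local boundedness of \<open>R\<close> follows from the resolvent identity alone: near \<open>w\<close> the term
    \<open>\<parallel>R z - R w\<parallel>\<close> is at most \<open>\<parallel>R z\<parallel> / 2\<close> and can be absorbed.\<close>
  have local_bound: "norm (R z) \<le> 2 * norm (R w)" if "cmod (w - z) * norm (R w) \<le> 1/2" for z w
  proof -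
    have "norm (R z) \<le> norm (R w) + norm (R z - R w)" by norm
    also have "norm (R z - R w) \<le> norm (R z) * (cmod (w - z) * norm (R w))"
      using norm_diff[of z w] by (simp add: mult_ac)
    also have "\<dots> \<le> norm (R z) * (1/2)" using that by (intro mult_left_mono) auto
    finally show ?thesis by simp
  qed
  have vanish: "cinner (app (R w) x) y = 0" for w x y
  proof (rule Liouville_weak_0[of "\<lambda>z. cinner (app (R z) x) y"])
    define f where "f z = cinner (app (R z) x) y" for z
    define K where "K = norm x * norm y"
    have fle: "cmod (cinner (app B x) y) \<le> norm B * K" for B
      using order_trans[OF norm_cinner_le mult_right_mono[OF norm_app norm_ge_zero]] by (simp add: K_def mult.assoc)
    have cont: "R \<midarrow>w\<rightarrow> R w" for w
    proof -
      have "((\<lambda>z. R z - R w) \<longlongrightarrow> 0) (at w)"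
      proof (rule Lim_null_comparison)
        show "\<forall>\<^sub>F z in at w. norm (R z - R w) \<le> cmod (w - z) * (2 * norm (R w) * norm (R w))"
        proof -
          have "((\<lambda>z. cmod (w - z) * norm (R w)) \<longlongrightarrow> cmod (w - w) * norm (R w)) (at w)"
            by (intro tendsto_intros)
          then have "\<forall>\<^sub>F z in at w. cmod (w - z) * norm (R w) < 1/2"
            by (rule order_tendstoD) simp
          then show ?thesis
          proof eventually_elim
            fix z assume "cmod (w - z) * norm (R w) < 1/2"
            then have "norm (R z) \<le> 2 * norm (R w)" by (intro local_bound) simp
            then show "norm (R z - R w) \<le> cmod (w - z) * (2 * norm (R w) * norm (R w))"
              by (intro order_trans[OF norm_diff] mult_left_mono mult_right_mono) auto
          qed
        qed
        have "((\<lambda>z. cmod (w - z) * (2 * norm (R w) * norm (R w))) \<longlongrightarrow> cmod (w - w) * (2 * norm (R w) * norm (R w))) (at w)"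
          by (intro tendsto_intros)
        then show "((\<lambda>z. cmod (w - z) * (2 * norm (R w) * norm (R w))) \<longlongrightarrow> 0) (at w)" by simp
      qed
      then show ?thesis by (rule LIM_zero_cancel)
    qed
    have deriv: "(f has_field_derivative - cinner (app (R w * R w) x) y) (at w)" for w
      unfolding has_field_derivative_iff
    proof -
      have "((\<lambda>z. R z * R w - R w * R w) \<longlongrightarrow> R w * R w - R w * R w) (at w)"
        by (intro tendsto_intros cont)
      then have lim0: "((\<lambda>z. norm (R z * R w - R w * R w) * K) \<longlongrightarrow> 0) (at w)"
        by (intro tendsto_mult_left_zero tendsto_norm_zero) simp
      have "((\<lambda>z. - cinner (app (R z * R w) x) y - - cinner (app (R w * R w) x) y) \<longlongrightarrow> 0) (at w)"
      proof (rule Lim_null_comparison[OF _ lim0], rule always_eventually, rule allI)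
        fix z
        have "- cinner (app (R z * R w) x) y - - cinner (app (R w * R w) x) y = - cinner (app (R z * R w - R w * R w) x) y"
          by (simp add: app_diff cinner_diff_left)
        then show "norm (- cinner (app (R z * R w) x) y - - cinner (app (R w * R w) x) y) \<le> norm (R z * R w - R w * R w) * K"
          using fle by (simp only: norm_minus_cancel)
      qed
      then have "((\<lambda>z. - cinner (app (R z * R w) x) y) \<longlongrightarrow> - cinner (app (R w * R w) x) y) (at w)"
        by (rule LIM_zero_cancel)
      then show "((\<lambda>z. (f z - f w) / (z - w)) \<longlongrightarrow> - cinner (app (R w * R w) x) y) (at w)"
      proof (rule Lim_transform_eventually)
        show "\<forall>\<^sub>F z in at w. - cinner (app (R z * R w) x) y = (f z - f w) / (z - w)"
        proof (rule eventually_at_filter[THEN iffD2], rule always_eventually, intro allI impI)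
          fix z assume "z \<noteq> w"
          have "f z - f w = cinner (app (R z - R w) x) y" by (simp add: f_def app_diff cinner_diff_left)
          also have "\<dots> = (w - z) * cinner (app (R z * R w) x) y"
            unfolding resolvent by (simp add: app_cscale cinner_scaleC_left)
          finally show "- cinner (app (R z * R w) x) y = (f z - f w) / (z - w)"
            using \<open>z \<noteq> w\<close> by (simp add: field_simps)
        qed
      qed
    qed
    then have "f field_differentiable (at w)" for w
      unfolding field_differentiable_def by blast
    then show "(\<lambda>z. cinner (app (R z) x) y) holomorphic_on UNIV"
      by (simp add: f_def[symmetric] holomorphic_on_def field_differentiable_at_within)
    show "((\<lambda>z. cinner (app (R z) x) y) \<longlongrightarrow> 0) at_infinity"
    proof (rule Lim_null_comparison)
      show "\<forall>\<^sub>F z in at_infinity. norm (cinner (app (R z) x) y) \<le> inverse (norm z) * (2 * norm e * K)"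
        unfolding eventually_at_infinity
      proof (intro exI[of _ "2 * norm A + 1"] allI impI)
        fix z assume z: "2 * norm A + 1 \<le> cmod z"
        have "z *\<^sub>C R z = e + A * R z"
          using R(3)[of z] by (simp add: left_diff_distrib R(2) algebra_simps)
        then have "cmod z * norm (R z) \<le> norm e + norm A * norm (R z)"
          using norm_triangle_ineq[of e "A * R z"] norm_mult_ineq[of A "R z"] by (metis norm_cscale add_left_mono order_trans)
        moreover have "2 * norm A * norm (R z) \<le> cmod z * norm (R z)"
          using z by (intro mult_right_mono) auto
        ultimately have "cmod z * norm (R z) \<le> 2 * norm e" by simp
        moreover have "cmod z > 0" using z norm_ge_zero[of A] by linarith
        ultimately have "norm (R z) \<le> inverse (norm z) * (2 * norm e)" by (simp add: field_simps)
        then have "norm (R z) * K \<le> inverse (norm z) * (2 * norm e) * K"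
          by (intro mult_right_mono) (auto simp: K_def)
        then show "norm (cinner (app (R z) x) y) \<le> inverse (norm z) * (2 * norm e * K)"
          using fle[of "R z"] by (simp add: mult.assoc)
      qed
      have "((\<lambda>z::complex. inverse (norm z)) \<longlongrightarrow> 0) at_infinity"
        using tendsto_norm_zero[OF tendsto_inverse_0[where 'a=complex]] by (simp add: norm_inverse)
      then show "((\<lambda>z::complex. inverse (norm z) * (2 * norm e * K)) \<longlongrightarrow> 0) at_infinity"
        by (rule tendsto_mult_left_zero)
    qed
  qed
  have "R 0 = 0"
  proof (rule bop_eqI)
    show "app (R 0) x = app 0 x" for x
      using vanish[of 0 x "app (R 0) x"] by (simp add: cinner_self_eq_zero_iff)
  qed
  then show "e = 0" using R(3)[of 0] by simp
qed

section \<open>Changing the norm by a finite-rank similarity\<close>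

lemma parallelogram:
  fixes x y :: "'a::real_inner"
  shows "(norm (x - y))\<^sup>2 = 2 * (norm x)\<^sup>2 + 2 * (norm y)\<^sup>2 - 4 * (norm ((1/2) *\<^sub>R (x + y)))\<^sup>2"
  by (simp add: power2_norm_eq_inner inner_simps inner_commute field_simps)

text \<open>
  The representing vector minimises \<open>J(x) = \<parallel>x\<parallel>\<^sup>2 - 2 g(x)\<close>. By the parallelogram law a minimising sequence
  is a Cauchy sequence, and the first variation of \<open>J\<close> at the minimum vanishes.
\<close>

lemma riesz_representation_real:
  fixes g :: "'a::{real_inner, complete_space} \<Rightarrow> real"
  assumes "bounded_linear g"
  shows "\<exists>w. \<forall>x. g x = inner x w"
proof -
  interpret g: bounded_linear g by fact
  obtain b where b: "b > 0" "\<And>x. norm (g x) \<le> norm x * b" using g.pos_bounded by blast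
  define J where "J x = (norm x)\<^sup>2 - 2 * g x" for x
  have lower: "J x \<ge> - b\<^sup>2" for x
  proof -
    have "0 \<le> (norm x - b)\<^sup>2" by simp
    then show ?thesis using b(2)[of x] by (simp add: J_def power2_diff)
  qed
  define m where "m = Inf (range J)"
  have bdd: "bdd_below (range J)" using lower by (auto intro!: bdd_belowI)
  have m_le: "m \<le> J x" for x unfolding m_def by (rule cInf_lower[OF _ bdd]) simp
  have "\<exists>x. J x < m + 1 / real (Suc n)" for n
    using cInf_lessD[of "range J" "m + 1 / real (Suc n)"] by (auto simp: m_def)
  then obtain x where x: "\<And>n. J (x n) < m + 1 / real (Suc n)" by metis
  have par: "(norm (u - v))\<^sup>2 = 2 * J u + 2 * J v - 4 * J ((1/2) *\<^sub>R (u + v))" for u v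
    unfolding J_def parallelogram[of u v] by (simp add: g.add g.scaleR algebra_simps)
  have close: "(norm (x i - x j))\<^sup>2 < 2 / real (Suc i) + 2 / real (Suc j)" for i j
    using par[of "x i" "x j"] m_le[of "(1/2) *\<^sub>R (x i + x j)"] x[of i] x[of j] by simp
  have "Cauchy x"
  proof (rule CauchyI)
    fix e :: real assume e: "e > 0"
    then have "e\<^sup>2 / 4 > 0" by simp
    then obtain N where N: "inverse (real (Suc N)) < e\<^sup>2 / 4" using reals_Archimedean by blast
    have "norm (x i - x j) < e" if "i \<ge> N" "j \<ge> N" for i j
    proof -
      have le: "1 / real (Suc i) \<le> inverse (real (Suc N))" if "i \<ge> N" for i
        using that by (simp add: field_simps)
      have "(norm (x i - x j))\<^sup>2 < e\<^sup>2"
        using close[of i j] le[OF that(1)] le[OF that(2)] N by linarith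
      then show ?thesis by (rule power2_less_imp_less) (use e in simp)
    qed
    then show "\<exists>M. \<forall>m\<ge>M. \<forall>n\<ge>M. norm (x m - x n) < e" by blast
  qed
  then obtain w where w: "x \<longlonglongrightarrow> w" using Cauchy_convergent_iff convergent_def by blast
  have "(\<lambda>n. J (x n)) \<longlonglongrightarrow> J w" unfolding J_def by (intro tendsto_intros w g.tendsto)
  moreover have "(\<lambda>n. m + 1 / real (Suc n)) \<longlonglongrightarrow> m + 0"
    by (intro tendsto_intros LIMSEQ_Suc[OF lim_1_over_n])
  ultimately have "J w \<le> m + 0"
    using x by (intro LIMSEQ_le[of "\<lambda>n. J (x n)"]) (auto intro: less_imp_le)
  then have min: "J w \<le> J v" for v using m_le[of v] by simp
  have "g u = inner u w" for u
  proof (rule ccontr)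
    assume ne: "g u \<noteq> inner u w"
    define d where "d = g u - inner u w"
    have d: "d \<noteq> 0" using ne by (simp add: d_def)
    have "u \<noteq> 0" using ne by auto
    then have nu: "(norm u)\<^sup>2 > 0" by simp
    define t where "t = d / (norm u)\<^sup>2"
    have "J (w + t *\<^sub>R u) = J w - 2 * t * d + t\<^sup>2 * (norm u)\<^sup>2"
    proof -
      have "(norm (w + t *\<^sub>R u))\<^sup>2 = (norm w)\<^sup>2 + 2 * t * inner u w + t\<^sup>2 * (norm u)\<^sup>2"
        unfolding power2_norm_eq_inner
        by (simp add: inner_simps inner_commute power2_eq_square algebra_simps)
      then show ?thesis by (simp add: J_def g.add g.scaleR d_def algebra_simps)
    qed
    also have "\<dots> = J w - d\<^sup>2 / (norm u)\<^sup>2"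
      using nu by (simp add: t_def power2_eq_square field_simps)
    also have "\<dots> < J w" using nu d by simp
    finally show False using min[of "w + t *\<^sub>R u"] by simp
  qed
  then show ?thesis by blast
qed

text \<open>
  Up to a unit vector, a rank-one operator is a linear functional. Its representing vector is
  obtained from the real part, which determines a complex-linear functional.
\<close>

lemma rank_one_norm:
  fixes K :: "'a::chilbert_space bop"
  assumes "rank_one K"
  shows "\<exists>w. \<forall>x. norm (app K x) = cmod (cinner x w)"
proof -
  obtain v where v: "\<And>x. \<exists>c. app K x = c *\<^sub>C v" using assms unfolding rank_one_def by blast
  show ?thesis
  proof (cases "v = 0")
    case True
    have "app K x = 0" for x using v[of x] True by auto
    then show ?thesis by (intro exI[of _ 0]) simp
  next
    case False
    define g where "g x = inner (app K x) v / norm v" for x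
    have "bounded_linear (\<lambda>x. inner (app K x) v / norm v)"
      by (intro bounded_linear_compose[OF bounded_linear_divide] bounded_linear_inner_left_comp bounded_linear_app)
    then have "bounded_linear g" by (simp add: g_def[abs_def])
    then obtain w where w: "\<And>x. g x = inner x w" using riesz_representation_real by blast
    have Re_eq: "Re (cinner (app K x) v) / norm v = Re (cinner x w)" for x
      using w[of x] by (simp add: Re_cinner g_def)
    have "cinner (app K x) v / complex_of_real (norm v) = cinner x w" for x
    proof (rule complex_eqI)
      show "Re (cinner (app K x) v / complex_of_real (norm v)) = Re (cinner x w)"
        using Re_eq[of x] by simp
      show "Im (cinner (app K x) v / complex_of_real (norm v)) = Im (cinner x w)"
        using Re_eq[of "(- \<i>) *\<^sub>C x"]
        by (simp add: cinner_scaleC_left cinner_minus_left app_minus_right scaleC_minus_left)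
    qed
    moreover have "norm (app K x) = cmod (cinner (app K x) v / complex_of_real (norm v))" for x
    proof -
      obtain c where c: "app K x = c *\<^sub>C v" using v by blast
      show ?thesis using False
        by (simp add: c cinner_scaleC_left cinner_self norm_scaleC norm_divide norm_mult power2_eq_square norm_power)
    qed
    ultimately show ?thesis by metis
  qed
qed

definition finrank_similarity :: "'a::complex_inner bop \<Rightarrow> 'a bop \<Rightarrow> bool" where
  "finrank_similarity S S' \<longleftrightarrow> finrank (S - 1) \<and> finrank (S' - 1) \<and> S * S' = 1 \<and> S' * S = 1"

lemma finrank_similarity_one: "finrank_similarity 1 1"
  by (simp add: finrank_similarity_def finrank.zero)

lemma finrank_similarity_mult:
  assumes "finrank_similarity S S'" "finrank_similarity R R'"
  shows "finrank_similarity (R * S) (S' * R')"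
proof -
  have eq: "R * S - 1 = (R - 1) * S + (S - 1)" "S' * R' - 1 = (S' - 1) * R' + (R' - 1)"
    by (simp_all add: left_diff_distrib)
  have "R * S * (S' * R') = R * (S * S') * R'" "S' * R' * (R * S) = S' * (R' * R) * S"
    by (simp_all only: mult.assoc)
  then show ?thesis
    unfolding finrank_similarity_def eq
    using assms by (auto simp: finrank_similarity_def intro!: finrank_add finrank_mult_right)
qed

text \<open>
  If \<open>\<parallel>K x\<parallel> = \<bar>\<langle>x, w\<rangle>\<bar>\<close>, then \<open>S x = x + t \<langle>x, w\<rangle> w\<close> satisfies
  \<open>\<parallel>S x\<parallel>\<^sup>2 = \<parallel>x\<parallel>\<^sup>2 + (2 t + t\<^sup>2 \<parallel>w\<parallel>\<^sup>2) \<bar>\<langle>x, w\<rangle>\<bar>\<^sup>2\<close>, and \<open>t\<close> is the positive solution of \<open>2 t + t\<^sup>2 \<parallel>w\<parallel>\<^sup>2 = 1\<close>.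
\<close>

lemma rank_one_similarity:
  fixes K :: "'a::chilbert_space bop"
  assumes "rank_one K"
  shows "\<exists>S S'. finrank_similarity S S' \<and> (\<forall>x. (norm (app S x))\<^sup>2 = (norm x)\<^sup>2 + (norm (app K x))\<^sup>2)"
proof -
  obtain w where w: "\<And>x. norm (app K x) = cmod (cinner x w)" using rank_one_norm[OF assms] by blast
  define a where "a = (norm w)\<^sup>2"
  define t where "t = 1 / (1 + sqrt (1 + a))"
  have a: "a \<ge> 0" by (simp add: a_def)
  have s: "sqrt (1 + a) * sqrt (1 + a) = 1 + a" using a by simp
  have pos: "1 + sqrt (1 + a) > 0" using a by (smt (verit) real_sqrt_ge_zero)
  have t: "t > 0" "t * t * a + 2 * t = 1"
  proof -
    show "t > 0" using pos by (simp add: t_def)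
    define r where "r = sqrt (1 + a)"
    have r: "a = r * r - 1" "1 + r > 0" using s pos by (auto simp: r_def)
    have "t * t * a + 2 * t = (a + 2 * (1 + r)) / ((1 + r) * (1 + r))"
    proof -
      have "2 * (1 + r) / ((1 + r) * (1 + r)) = 2 / (1 + r)"
        using r(2) by (intro nonzero_mult_divide_mult_cancel_right) simp
      then have "2 * t = 2 * (1 + r) / ((1 + r) * (1 + r))" by (simp add: t_def r_def[symmetric])
      moreover have "t * t * a = a / ((1 + r) * (1 + r))" by (simp add: t_def r_def[symmetric])
      ultimately show ?thesis by (simp only: add_divide_distrib)
    qed
    also have "a + 2 * (1 + r) = (1 + r) * (1 + r)" by (simp add: r(1) algebra_simps)
    finally show "t * t * a + 2 * t = 1" using r(2) by simp
  qed
  have "\<exists>R. \<forall>x. app R x = cinner x w *\<^sub>C w"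
  proof (rule ex_bop[where K=a])
    fix x show "norm (cinner x w *\<^sub>C w) \<le> norm x * a"
      using mult_right_mono[OF norm_cinner_le[of x w], of "norm w"]
      by (simp add: norm_scaleC a_def power2_eq_square mult.assoc)
  qed (auto simp: cinner_simps scaleC_add_left scaleC_scaleC)
  then obtain R where R: "\<And>x. app R x = cinner x w *\<^sub>C w" by blast
  have R1: "rank_one R" unfolding rank_one_def using R by blast
  have RR: "R * R = complex_of_real a *\<^sub>C R"
    by (rule bop_eqI) (simp add: app_mult app_cscale R cinner_scaleC_left cinner_self a_def scaleC_scaleC mult.commute)
  define t' where "t' = t / (1 + t * a)"
  define S where "S = 1 + complex_of_real t *\<^sub>C R"
  define S' where "S' = 1 - complex_of_real t' *\<^sub>C R"
  have "1 + t * a > 0" using a t by (smt (verit) mult_nonneg_nonneg)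
  then have "t - t' - t * t' * a = 0" by (simp add: t'_def field_simps)
  then have tt: "complex_of_real t - complex_of_real t' - complex_of_real t * complex_of_real t' * complex_of_real a = 0"
    by (metis of_real_0 of_real_diff of_real_mult)
  have "S * S' = 1 + (complex_of_real t - complex_of_real t' - complex_of_real t * complex_of_real t' * complex_of_real a) *\<^sub>C R"
    by (simp add: S_def S'_def algebra_simps RR scaleC_scaleC scaleC_diff_left mult_ac)
  moreover have "S' * S = 1 + (complex_of_real t - complex_of_real t' - complex_of_real t * complex_of_real t' * complex_of_real a) *\<^sub>C R"
    by (simp add: S_def S'_def algebra_simps RR scaleC_scaleC scaleC_diff_left mult_ac)
  moreover have "finrank (S - 1)" "finrank (S' - 1)"
    using finrank_rank_one[OF R1] by (auto simp: S_def S'_def intro: finrank_cscale finrank_minus)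
  ultimately have "finrank_similarity S S'" by (simp add: finrank_similarity_def tt)
  moreover have "(norm (app S x))\<^sup>2 = (norm x)\<^sup>2 + (norm (app K x))\<^sup>2" for x
  proof -
    define c where "c = cinner x w"
    have Sx: "app S x = x + t *\<^sub>R (c *\<^sub>C w)" by (simp add: S_def app_simps R c_def scaleR_eq_scaleC)
    have "inner x (c *\<^sub>C w) = Re (cnj c * c)"
      by (simp add: Re_cinner[symmetric] cinner_scaleC_right c_def)
    also have "\<dots> = (cmod c)\<^sup>2" by (simp add: cmod_power2) (simp add: power2_eq_square)
    finally have i: "inner x (c *\<^sub>C w) = (cmod c)\<^sup>2" .
    have "(norm (app S x))\<^sup>2 = (norm x)\<^sup>2 + 2 * t * inner x (c *\<^sub>C w) + t * t * (norm (c *\<^sub>C w))\<^sup>2"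
      unfolding Sx by (simp add: power2_norm_eq_inner inner_simps inner_commute algebra_simps)
    also have "\<dots> = (norm x)\<^sup>2 + (t * t * a + 2 * t) * (cmod c)\<^sup>2"
      by (simp add: i norm_scaleC a_def power_mult_distrib algebra_simps)
    finally show ?thesis using w[of x] t(2) by (simp add: c_def)
  qed
  ultimately show ?thesis by blast
qed

text \<open>
  The quadratic forms of finite rank used for renorming. They are presented by lists of rank-one
  operators because \<open>energy_similarity\<close> realises them one operator at a time.
\<close>

definition list_energy :: "'a::complex_inner bop list \<Rightarrow> 'a \<Rightarrow> real" where
  "list_energy L x = (\<Sum>K\<leftarrow>L. (norm (app K x))\<^sup>2)"

lemma list_energy_Nil [simp]: "list_energy [] x = 0"
  by (simp add: list_energy_def)
lemma list_energy_Cons [simp]: "list_energy (K # L) x = (norm (app K x))\<^sup>2 + list_energy L x"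
  by (simp add: list_energy_def)
lemma list_energy_append [simp]: "list_energy (L @ L') x = list_energy L x + list_energy L' x"
  by (simp add: list_energy_def)
lemma list_energy_nonneg: "0 \<le> list_energy L x"
  by (induction L) auto
lemma list_energy_map_mult: "list_energy (map (\<lambda>K. K * A) L) x = list_energy L (app A x)"
  by (induction L) (auto simp: app_mult)
lemma list_energy_map_cscale: "list_energy (map (\<lambda>K. c *\<^sub>C K) L) x = (cmod c)\<^sup>2 * list_energy L x"
  by (induction L) (auto simp: app_cscale norm_scaleC power_mult_distrib algebra_simps)

lemma list_energy_bound: "\<exists>B\<ge>0. \<forall>x. list_energy L x \<le> B * (norm x)\<^sup>2"
proof (induction L)
  case (Cons K L)
  then obtain B where B: "B \<ge> 0" "\<And>x. list_energy L x \<le> B * (norm x)\<^sup>2" by blast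
  have "(norm (app K x))\<^sup>2 \<le> (norm K)\<^sup>2 * (norm x)\<^sup>2" for x
    using power_mono[OF norm_app norm_ge_zero, of K x 2] by (simp add: power_mult_distrib)
  then have "list_energy (K # L) x \<le> ((norm K)\<^sup>2 + B) * (norm x)\<^sup>2" for x
    using add_mono[OF _ B(2)] by (simp add: distrib_right)
  then show ?case using B(1) by (intro exI[of _ "(norm K)\<^sup>2 + B"]) auto
qed auto

text \<open>
  The form \<open>\<parallel>x\<parallel>\<^sup>2 + energy\<close> is the square of \<open>\<parallel>S x\<parallel>\<close>. To add the term \<open>\<parallel>K x\<parallel>\<^sup>2\<close> to what \<open>S\<close> realises, apply
  the rank-one case to \<open>K S\<^sup>-\<^sup>1\<close> in the coordinates \<open>S x\<close>.
\<close>

lemma energy_similarity: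
  fixes L :: "'a::chilbert_space bop list"
  assumes "\<forall>K\<in>set L. rank_one K"
  shows "\<exists>S S'. finrank_similarity S S' \<and> (\<forall>x. (norm (app S x))\<^sup>2 = (norm x)\<^sup>2 + list_energy L x)"
  using assms
proof (induction L)
  case Nil
  then show ?case using finrank_similarity_one by (intro exI[of _ 1]) auto
next
  case (Cons K L)
  then obtain S S' where S: "finrank_similarity S S'" "\<And>x. (norm (app S x))\<^sup>2 = (norm x)\<^sup>2 + list_energy L x"
    by auto
  obtain R R' where R: "finrank_similarity R R'"
    "\<And>x. (norm (app R x))\<^sup>2 = (norm x)\<^sup>2 + (norm (app (K * S') x))\<^sup>2"
    using rank_one_similarity[OF rank_one_mult_right, of K S'] Cons.prems by auto
  have "app S' (app S x) = x" for x
    using S(1) by (metis finrank_similarity_def app_mult app_one)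
  then have "(norm (app (R * S) x))\<^sup>2 = (norm x)\<^sup>2 + list_energy (K # L) x" for x
    by (simp add: app_mult R(2) S(2))
  with finrank_similarity_mult[OF S(1) R(1)] show ?case by blast
qed

lemma norm_add_sq_le:
  fixes u v :: "'a::real_inner"
  assumes "\<delta> > 0"
  shows "(norm (u + v))\<^sup>2 \<le> (1 + \<delta>) * (norm u)\<^sup>2 + (1 + 1/\<delta>) * (norm v)\<^sup>2"
proof -
  have "(norm (u + v))\<^sup>2 \<le> (norm u + norm v)\<^sup>2" by (intro power_mono norm_triangle_ineq) auto
  moreover have "0 \<le> (\<delta> * norm u - norm v)\<^sup>2 / \<delta>" using assms by simp
  then have "2 * norm u * norm v \<le> \<delta> * (norm u)\<^sup>2 + (norm v)\<^sup>2 / \<delta>"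
    using assms by (simp add: power2_diff power_mult_distrib field_simps power2_eq_square)
  ultimately show ?thesis by (simp add: power2_sum algebra_simps)
qed

text \<open>
  By \<open>norm_add_sq_le\<close> each rank-one summand of \<open>F\<close> enlarges the factor \<open>q\<close> of \<open>\<parallel>x\<parallel>\<^sup>2\<close> by an arbitrarily small
  amount, so the factor \<open>\<parallel>Y\<parallel>\<^sup>2 < 1\<close> stays below \<open>1\<close> throughout.
\<close>

lemma contraction_modulo_energy:
  fixes Y F :: "'a::complex_inner bop"
  assumes "finrank F" "norm Y < 1"
  shows "\<exists>L. (\<forall>K\<in>set L. rank_one K) \<and> (\<forall>x. (norm (app (Y + F) x))\<^sup>2 \<le> (norm x)\<^sup>2 + list_energy L x)"
proof -
  have "\<exists>q L. q < 1 \<and> 0 \<le> q \<and> (\<forall>K\<in>set L. rank_one K) \<and>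
      (\<forall>x. (norm (app (Y + F) x))\<^sup>2 \<le> q * (norm x)\<^sup>2 + list_energy L x)"
    using assms(1)
  proof (induction rule: finrank.induct)
    case zero
    have "(norm (app Y x))\<^sup>2 \<le> (norm Y)\<^sup>2 * (norm x)\<^sup>2" for x
      using power_mono[OF norm_app norm_ge_zero, of Y x 2] by (simp add: power_mult_distrib)
    moreover have "(norm Y)\<^sup>2 < 1" using assms(2) by (simp add: power_less_one_iff)
    ultimately show ?case by (intro exI[of _ "(norm Y)\<^sup>2"] exI[of _ "[]"]) auto
  next
    case (add_rank_one F K)
    then obtain q L where IH: "q < 1" "0 \<le> q" "\<forall>K\<in>set L. rank_one K"
      "\<And>x. (norm (app (Y + F) x))\<^sup>2 \<le> q * (norm x)\<^sup>2 + list_energy L x" by blast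
    define \<delta> where "\<delta> = (1 - q) / 2"
    have \<delta>: "\<delta> > 0" "(1 + \<delta>) * q < 1"
    proof -
      show "\<delta> > 0" using IH by (simp add: \<delta>_def)
      have "(1 + \<delta>) * q = 1 - (1 - q) * (1 - q / 2)" by (simp add: \<delta>_def field_simps)
      also have "\<dots> < 1" using IH by simp
      finally show "(1 + \<delta>) * q < 1" .
    qed
    define a where "a = complex_of_real (sqrt (1 + \<delta>))"
    define b where "b = complex_of_real (sqrt (1 + 1/\<delta>))"
    have ab: "(cmod a)\<^sup>2 = 1 + \<delta>" "(cmod b)\<^sup>2 = 1 + 1/\<delta>" using \<delta>(1) by (auto simp: a_def b_def)
    define L' where "L' = (b *\<^sub>C K) # map (\<lambda>K. a *\<^sub>C K) L"
    have "(norm (app (Y + (F + K)) x))\<^sup>2 \<le> ((1 + \<delta>) * q) * (norm x)\<^sup>2 + list_energy L' x" for x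
    proof -
      have "(norm (app (Y + (F + K)) x))\<^sup>2 = (norm (app (Y + F) x + app K x))\<^sup>2" by (simp add: app_add add.assoc)
      also have "\<dots> \<le> (1 + \<delta>) * (norm (app (Y + F) x))\<^sup>2 + (1 + 1/\<delta>) * (norm (app K x))\<^sup>2"
        by (rule norm_add_sq_le[OF \<delta>(1)])
      also have "\<dots> \<le> (1 + \<delta>) * (q * (norm x)\<^sup>2 + list_energy L x) + (1 + 1/\<delta>) * (norm (app K x))\<^sup>2"
        using \<delta>(1) IH(4)[of x] by (intro add_right_mono mult_left_mono) auto
      also have "\<dots> = ((1 + \<delta>) * q) * (norm x)\<^sup>2 + list_energy L' x"
        by (simp add: L'_def list_energy_map_cscale ab app_cscale norm_scaleC power_mult_distrib algebra_simps)
      finally show ?thesis .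
    qed
    moreover have "\<forall>K\<in>set L'. rank_one K"
      using IH(3) add_rank_one.hyps by (auto simp: L'_def intro: rank_one_cscale)
    ultimately show ?case using \<delta> IH(2) by (intro exI[of _ "(1 + \<delta>) * q"] exI[of _ L']) auto
  qed
  then obtain q L where q: "q < 1" "0 \<le> q" "\<forall>K\<in>set L. rank_one K"
    "\<And>x. (norm (app (Y + F) x))\<^sup>2 \<le> q * (norm x)\<^sup>2 + list_energy L x" by blast
  have "(norm (app (Y + F) x))\<^sup>2 \<le> (norm x)\<^sup>2 + list_energy L x" for x
    using q(4)[of x] mult_right_mono[of q 1 "(norm x)\<^sup>2"] q(1) by simp
  with q(3) show ?thesis by blast
qed

definition iterate_list :: "'a::complex_inner bop \<Rightarrow> nat \<Rightarrow> 'a bop list \<Rightarrow> 'a bop list" where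
  "iterate_list X N L = concat (map (\<lambda>n. map (\<lambda>K. K * X ^ n) L) [0..<N])"

lemma list_energy_iterate: "list_energy (iterate_list X N L) x = (\<Sum>n<N. list_energy L (app (X ^ n) x))"
  by (induction N) (auto simp: iterate_list_def list_energy_map_mult)

lemma rank_one_iterate: "\<forall>K\<in>set L. rank_one K \<Longrightarrow> \<forall>K\<in>set (iterate_list X N L). rank_one K"
  by (auto simp: iterate_list_def intro: rank_one_mult_right)

lemma sum_norm_powers_bound:
  fixes X :: "'a::complex_inner bop"
  assumes "decays (\<lambda>n. X ^ n)"
  shows "\<exists>B>0. \<forall>N x. (\<Sum>n<N. (norm (app (X ^ n) x))\<^sup>2) \<le> B * (norm x)\<^sup>2"
proof -
  obtain C q where Cq: "0 \<le> C" "0 < q" "q < 1" "\<And>n. norm (X ^ n) \<le> C * q ^ n" using decaysE[OF assms] by blast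
  have q2: "q\<^sup>2 < 1" "0 < q\<^sup>2" using Cq by (auto simp: power_less_one_iff)
  define B where "B = C\<^sup>2 / (1 - q\<^sup>2)"
  have B: "B \<ge> 0" using q2 by (simp add: B_def)
  have le: "(norm (app (X ^ n) x))\<^sup>2 \<le> C\<^sup>2 * (norm x)\<^sup>2 * (q\<^sup>2) ^ n" for n x
  proof -
    have "norm (app (X ^ n) x) \<le> C * q ^ n * norm x"
      by (rule order_trans[OF norm_app mult_right_mono[OF Cq(4)]]) simp
    then have "(norm (app (X ^ n) x))\<^sup>2 \<le> (C * q ^ n * norm x)\<^sup>2" by (rule power_mono) simp
    also have "\<dots> = C\<^sup>2 * (norm x)\<^sup>2 * (q\<^sup>2) ^ n"
      by (simp add: power_mult_distrib mult_ac flip: power_mult)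
    finally show ?thesis .
  qed
  have "(\<Sum>n<N. (norm (app (X ^ n) x))\<^sup>2) \<le> B * (norm x)\<^sup>2" for N x
  proof -
    have "(\<Sum>n<N. (norm (app (X ^ n) x))\<^sup>2) \<le> (\<Sum>n<N. C\<^sup>2 * (norm x)\<^sup>2 * (q\<^sup>2) ^ n)"
      by (intro sum_mono le)
    also have "\<dots> = C\<^sup>2 * (norm x)\<^sup>2 * (\<Sum>n<N. (q\<^sup>2) ^ n)" by (simp add: sum_distrib_left)
    also have "\<dots> \<le> C\<^sup>2 * (norm x)\<^sup>2 * (1 / (1 - q\<^sup>2))"
    proof (intro mult_left_mono)
      have "(\<Sum>n<N. (q\<^sup>2) ^ n) = (1 - (q\<^sup>2) ^ N) / (1 - q\<^sup>2)"
        using q2 by (subst sum_gp_strict) auto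
      also have "\<dots> \<le> 1 / (1 - q\<^sup>2)" using q2 by (intro divide_right_mono) auto
      finally show "(\<Sum>n<N. (q\<^sup>2) ^ n) \<le> 1 / (1 - q\<^sup>2)" .
    qed simp
    finally show ?thesis by (simp add: B_def mult_ac)
  qed
  moreover have "B * (norm x)\<^sup>2 \<le> (B + 1) * (norm x)\<^sup>2" for x :: 'a by (simp add: distrib_right)
  ultimately have "(\<Sum>n<N. (norm (app (X ^ n) x))\<^sup>2) \<le> (B + 1) * (norm x)\<^sup>2" for N x
    using order_trans by blast
  then show ?thesis using B by (intro exI[of _ "B + 1"]) auto
qed

text \<open>
  A Lyapunov function for finitely many commuting operators: up to the error \<open>\<delta> \<parallel>x\<parallel>\<^sup>2\<close>, each step by
  any of the operators lowers the energy of \<open>L\<close> by at least the energy of \<open>L0\<close>. The operators are treated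
  in turn. Summing the current energy along the orbit of \<open>X\<close> makes the sum telescope for \<open>X\<close> and, by
  commutativity, keeps the estimate for the operators already treated. The orbit sum is truncated
  where its tail falls below \<open>\<delta>\<close>.
\<close>

lemma ex_lyapunov_list:
  fixes Xs :: "'a::complex_inner bop list"
  assumes "\<forall>X\<in>set Xs. decays (\<lambda>n. X ^ n)" "\<forall>X\<in>set Xs. \<forall>X'\<in>set Xs. X * X' = X' * X"
    and "\<forall>K\<in>set L0. rank_one K" "\<delta> > 0"
  shows "\<exists>L. (\<forall>K\<in>set L. rank_one K) \<and> (\<forall>x. list_energy L0 x \<le> list_energy L x) \<and>
    (\<forall>X\<in>set Xs. \<forall>x. list_energy L (app X x) \<le> list_energy L x - list_energy L0 x + \<delta> * (norm x)\<^sup>2)"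
  using assms(1,2,4)
proof (induction Xs arbitrary: \<delta>)
  case Nil
  then show ?case using assms(3) by (intro exI[of _ L0]) auto
next
  case (Cons X Xs)
  have geoX: "decays (\<lambda>n. X ^ n)" using Cons.prems by simp
  obtain B where B: "B > 0" "\<And>N x. (\<Sum>n<N. (norm (app (X ^ n) x))\<^sup>2) \<le> B * (norm x)\<^sup>2"
    using sum_norm_powers_bound[OF geoX] by blast
  \<comment> \<open>For the operators already treated the errors add up along the orbit of \<open>X\<close>. Their sum is
    at most \<open>B\<close> times one error, independently of the length of the orbit.\<close>
  have "\<delta> / B > 0" using B Cons.prems by simp
  then obtain L where L: "\<forall>K\<in>set L. rank_one K" "\<And>x. list_energy L0 x \<le> list_energy L x"
    "\<And>Z x. Z \<in> set Xs \<Longrightarrow> list_energy L (app Z x) \<le> list_energy L x - list_energy L0 x + \<delta> / B * (norm x)\<^sup>2"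
    using Cons.IH[of "\<delta> / B"] Cons.prems by (auto simp del: divide_pos_pos)
  obtain D where D: "D \<ge> 0" "\<And>x. list_energy L x \<le> D * (norm x)\<^sup>2" using list_energy_bound[of L] by blast
  obtain C q where Cq: "0 \<le> C" "0 < q" "q < 1" "\<And>n. norm (X ^ n) \<le> C * q ^ n" using decaysE[OF geoX] by blast
  have "(\<lambda>n. D * (C * q ^ n)\<^sup>2) \<longlonglongrightarrow> D * (C * 0)\<^sup>2"
    using Cq by (intro tendsto_intros LIMSEQ_realpow_zero) auto
  then have "\<forall>\<^sub>F n in sequentially. D * (C * q ^ n)\<^sup>2 < \<delta>"
    using Cons.prems by (intro order_tendstoD(2)) auto
  then obtain N0 where N0: "\<And>n. n \<ge> N0 \<Longrightarrow> D * (C * q ^ n)\<^sup>2 < \<delta>" by (auto simp: eventually_sequentially)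
  define N where "N = Suc N0"
  have N: "D * (C * q ^ N)\<^sup>2 < \<delta>" by (rule N0) (simp add: N_def)
  define L' where "L' = iterate_list X N L"
  have energy: "list_energy L' x = (\<Sum>n<N. list_energy L (app (X ^ n) x))" for x
    by (simp add: L'_def list_energy_iterate)
  have ge: "list_energy L0 x \<le> list_energy L' x" for x
  proof -
    have "list_energy L' x = list_energy L x + (\<Sum>n<N0. list_energy L (app (X ^ Suc n) x))"
      unfolding energy N_def by (subst sum.lessThan_Suc_shift) simp
    moreover have "0 \<le> (\<Sum>n<N0. list_energy L (app (X ^ Suc n) x))" by (intro sum_nonneg list_energy_nonneg)
    ultimately show ?thesis using L(2)[of x] by simp
  qed
  have "list_energy L' (app Z x) \<le> list_energy L' x - list_energy L0 x + \<delta> * (norm x)\<^sup>2"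
    if Z: "Z \<in> set (X # Xs)" for Z x
  proof (cases "Z \<in> set Xs")
    case True
    have comm: "app (X ^ n) (app Z x) = app Z (app (X ^ n) x)" for n
    proof -
      have "Z * X = X * Z" by (rule Cons.prems(2)[rule_format]) (use True in simp_all)
      then have "X ^ n * Z = Z * X ^ n" using power_commuting_commutes by metis
      then show ?thesis by (metis app_mult)
    qed
    have "list_energy L' (app Z x) = (\<Sum>n<N. list_energy L (app Z (app (X ^ n) x)))"
      by (simp add: energy comm)
    also have "\<dots> \<le> (\<Sum>n<N. list_energy L (app (X ^ n) x) - list_energy L0 (app (X ^ n) x)
        + \<delta> / B * (norm (app (X ^ n) x))\<^sup>2)"
      by (intro sum_mono L(3) True)
    also have "\<dots> = list_energy L' x - (\<Sum>n<N. list_energy L0 (app (X ^ n) x))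
        + \<delta> / B * (\<Sum>n<N. (norm (app (X ^ n) x))\<^sup>2)"
      by (simp add: energy sum.distrib sum_subtractf sum_distrib_left)
    also have "\<dots> \<le> list_energy L' x - list_energy L0 x + \<delta> / B * (B * (norm x)\<^sup>2)"
    proof (intro add_mono diff_left_mono mult_left_mono B(2))
      have "(\<Sum>n<N. list_energy L0 (app (X ^ n) x)) = list_energy L0 x + (\<Sum>n<N0. list_energy L0 (app (X ^ Suc n) x))"
        unfolding N_def by (subst sum.lessThan_Suc_shift) simp
      moreover have "0 \<le> (\<Sum>n<N0. list_energy L0 (app (X ^ Suc n) x))" by (intro sum_nonneg list_energy_nonneg)
      ultimately show "list_energy L0 x \<le> (\<Sum>n<N. list_energy L0 (app (X ^ n) x))" by simp
    qed (use B Cons.prems in auto)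
    finally show ?thesis using B by simp
  next
    case False
    then have ZX: "Z = X" using Z by simp
    have "list_energy L' (app X x) = (\<Sum>n<N. list_energy L (app (X ^ Suc n) x))"
      unfolding energy by (intro sum.cong) (auto simp: app_mult[symmetric] power_commutes)
    also have "\<dots> = (\<Sum>n<Suc N. list_energy L (app (X ^ n) x)) - list_energy L x"
      by (subst sum.lessThan_Suc_shift) simp
    also have "\<dots> = list_energy L' x - list_energy L x + list_energy L (app (X ^ N) x)"
      by (simp add: energy)
    also have "\<dots> \<le> list_energy L' x - list_energy L0 x + \<delta> * (norm x)\<^sup>2"
    proof (intro add_mono diff_left_mono L(2))
      have "list_energy L (app (X ^ N) x) \<le> D * (norm (app (X ^ N) x))\<^sup>2" by (rule D(2))
      also have "\<dots> \<le> D * (C * q ^ N * norm x)\<^sup>2"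
        by (intro mult_left_mono power_mono D(1) order_trans[OF norm_app mult_right_mono[OF Cq(4)]]) auto
      also have "\<dots> = D * (C * q ^ N)\<^sup>2 * (norm x)\<^sup>2" by (simp add: power_mult_distrib)
      also have "\<dots> \<le> \<delta> * (norm x)\<^sup>2" using N by (intro mult_right_mono) auto
      finally show "list_energy L (app (X ^ N) x) \<le> \<delta> * (norm x)\<^sup>2" .
    qed
    finally show ?thesis by (simp add: ZX)
  qed
  moreover have "\<forall>K\<in>set L'. rank_one K" unfolding L'_def by (rule rank_one_iterate[OF L(1)])
  ultimately show ?case using ge by blast
qed

text \<open>
  In the norm \<open>\<parallel>S x\<parallel>\<^sup>2 = \<parallel>x\<parallel>\<^sup>2 + energy\<close> the growth \<open>\<parallel>X x\<parallel>\<^sup>2 - \<parallel>x\<parallel>\<^sup>2\<close>, at most the energy of \<open>L0\<close>, is paid for by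
  the loss of energy in the same step.
\<close>

lemma simultaneous_similarity:
  fixes Xs :: "'a::chilbert_space bop list"
  assumes "\<forall>X\<in>set Xs. decays (\<lambda>n. X ^ n)" "\<forall>X\<in>set Xs. \<forall>X'\<in>set Xs. X * X' = X' * X"
    and "\<forall>X\<in>set Xs. \<exists>F. finrank F \<and> norm (X - F) < 1" "\<epsilon> > 0"
  shows "\<exists>S S'. finrank_similarity S S' \<and> (\<forall>X\<in>set Xs. norm (S * X * S') \<le> 1 + \<epsilon>)"
proof -
  have "\<exists>L0. (\<forall>K\<in>set L0. rank_one K) \<and> (\<forall>X\<in>set Xs. \<forall>x. (norm (app X x))\<^sup>2 \<le> (norm x)\<^sup>2 + list_energy L0 x)"
    using assms(3)
  proof (induction Xs)
    case Nil
    then show ?case by (intro exI[of _ "[]"]) auto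
  next
    case (Cons X Xs)
    then obtain L where L: "\<forall>K\<in>set L. rank_one K"
      "\<And>Z x. Z \<in> set Xs \<Longrightarrow> (norm (app Z x))\<^sup>2 \<le> (norm x)\<^sup>2 + list_energy L x" by auto
    obtain F where F: "finrank F" "norm (X - F) < 1" using Cons.prems by auto
    obtain L' where L': "\<forall>K\<in>set L'. rank_one K" "\<And>x. (norm (app X x))\<^sup>2 \<le> (norm x)\<^sup>2 + list_energy L' x"
      using contraction_modulo_energy[OF F] by auto
    have "(norm (app Z x))\<^sup>2 \<le> (norm x)\<^sup>2 + list_energy (L' @ L) x" if "Z \<in> set (X # Xs)" for Z x
      using that L(2)[of Z x] L'(2)[of x] list_energy_nonneg[of L x] list_energy_nonneg[of L' x] by auto
    then show ?case using L(1) L'(1) by (intro exI[of _ "L' @ L"]) auto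
  qed
  then obtain L0 where L0: "\<forall>K\<in>set L0. rank_one K"
    "\<And>X x. X \<in> set Xs \<Longrightarrow> (norm (app X x))\<^sup>2 \<le> (norm x)\<^sup>2 + list_energy L0 x" by blast
  obtain L where L: "\<forall>K\<in>set L. rank_one K"
    "\<And>X x. X \<in> set Xs \<Longrightarrow> list_energy L (app X x) \<le> list_energy L x - list_energy L0 x + \<epsilon> * (norm x)\<^sup>2"
    using ex_lyapunov_list[OF assms(1,2) L0(1) assms(4)] by blast
  obtain S S' where S: "finrank_similarity S S'" "\<And>x. (norm (app S x))\<^sup>2 = (norm x)\<^sup>2 + list_energy L x"
    using energy_similarity[OF L(1)] by blast
  have "norm (S * X * S') \<le> 1 + \<epsilon>" if X: "X \<in> set Xs" for X
  proof (rule norm_bop_le)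
    fix x
    define y where "y = app S' x"
    have Sy: "app S y = x" unfolding y_def using S(1) by (metis finrank_similarity_def app_mult app_one)
    have "(norm (app S (app X y)))\<^sup>2 \<le> (norm y)\<^sup>2 + list_energy L0 y + (list_energy L y - list_energy L0 y + \<epsilon> * (norm y)\<^sup>2)"
      unfolding S(2) by (intro add_mono L0(2) L(2) X)
    also have "\<dots> \<le> (1 + \<epsilon>) * (norm (app S y))\<^sup>2"
      using assms(4) list_energy_nonneg[of L y] unfolding S(2) by (simp add: algebra_simps)
    also have "\<dots> \<le> (1 + \<epsilon>)\<^sup>2 * (norm x)\<^sup>2"
      unfolding Sy using assms(4) by (intro mult_right_mono) (auto simp: power2_eq_square)
    finally have "(norm (app S (app X y)))\<^sup>2 \<le> ((1 + \<epsilon>) * norm x)\<^sup>2" by (simp add: power_mult_distrib)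
    then have "norm (app S (app X y)) \<le> (1 + \<epsilon>) * norm x"
      by (rule power2_le_imp_le) (use assms(4) in simp)
    then show "norm (app (S * X * S') x) \<le> (1 + \<epsilon>) * norm x" by (simp add: app_mult y_def)
  qed (use assms(4) in auto)
  with S(1) show ?thesis by blast
qed

section \<open>Finitely many polynomials\<close>

text \<open>
  \<open>S\<close> is the product of the operators \<open>r(p(T))\<close>, with \<open>r\<close> from \<open>ex_unstable_annihilator\<close>. All factors are
  polynomials in \<open>T\<close>, so they commute with one another and each factor brings the decay for its \<open>p\<close>.
\<close>

lemma ex_proper_annihilator:
  fixes T :: "'a::chilbert_space bop"
  assumes "\<forall>p\<in>set ps. \<exists>F. finrank F \<and> norm (peval p T - F) < 1"
  shows "\<exists>S. proper S \<and> S * T = T * S \<and> (\<forall>p\<in>set ps. decays (\<lambda>n. S * peval p T ^ n))"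
  using assms
proof (induction ps)
  case Nil
  then show ?case by (intro exI[of _ 1]) (auto simp: proper_one)
next
  case (Cons p ps)
  then obtain S where S: "proper S" "S * T = T * S" "\<And>q. q \<in> set ps \<Longrightarrow> decays (\<lambda>n. S * peval q T ^ n)"
    by auto
  obtain F where F: "finrank F" "norm (peval p T - F) < 1" using Cons.prems by auto
  define X where "X = peval p T"
  have X: "X - F + F = X" by simp
  obtain r where r: "r \<noteq> 0" "\<And>z. poly r z = 0 \<Longrightarrow> cmod z \<ge> 1" "decays (\<lambda>n. peval r X * X ^ n)"
    using ex_unstable_annihilator[OF F(1), of "X - F"] F(2) by (auto simp: X_def)
  define R where "R = peval r X"
  have "proper R" unfolding R_def using proper_peval[of "X - F" F r] F r(1,2) by (simp add: X_def)
  have XT: "X * T = T * X" unfolding X_def by (rule peval_commutes) simp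
  have RT: "R * T = T * R" unfolding R_def by (rule peval_commutes[OF XT])
  have "X * S = S * X" unfolding X_def by (rule peval_commutes) (simp add: S(2))
  then have RS: "R * S = S * R" unfolding R_def by (rule peval_commutes)
  have "decays (\<lambda>n. S * R * peval q T ^ n)" if q: "q \<in> set (p # ps)" for q
  proof (cases "q \<in> set ps")
    case True
    show ?thesis
    proof (rule decays_dominated[OF S(3)[OF True]])
      fix n
      have "S * R * peval q T ^ n = R * (S * peval q T ^ n)" by (simp only: RS[symmetric] mult.assoc)
      then show "norm (S * R * peval q T ^ n) \<le> norm R * norm (S * peval q T ^ n)"
        by (simp add: norm_mult_ineq)
    qed simp
  next
    case False
    then have "q = p" using q by simp
    then show ?thesis
      using decays_dominated[OF r(3), of "\<lambda>n. S * R * X ^ n" "norm S"]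
      by (simp add: X_def[symmetric] R_def[symmetric] mult.assoc norm_mult_ineq)
  qed
  moreover have "S * R * T = T * (S * R)" by (metis S(2) RT mult.assoc)
  ultimately show ?case using proper_mult[OF S(1) \<open>proper R\<close>] by blast
qed

text \<open>
  The hypothesis on \<open>T\<close> says that the range of \<open>P\<close> is invariant. Therefore compression to the complement
  is multiplicative on polynomials in \<open>T\<close>.
\<close>

lemma peval_block_diagonal:
  fixes T P :: "'a::complex_inner bop"
  assumes PP: "P * P = P" and TP: "(1 - P) * T * P = 0"
  shows "peval p ((1 - P) * T * (1 - P) + z *\<^sub>C P) = (1 - P) * peval p T * (1 - P) + poly p z *\<^sub>C P"
proof (induction p)
  case (pCons a p)
  define e where "e = 1 - P"
  have e: "e * e = e" "e * P = 0" "P * e = 0" by (simp_all add: e_def algebra_simps PP)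
  have e': "e * (e * Z) = e * Z" "P * (e * Z) = 0" "e * (P * Z) = 0" "P * (P * Z) = P * Z" for Z
    by (simp_all add: mult.assoc[symmetric] e PP)
  have eT: "e * (T * (e * Z)) = e * (T * Z)" for Z
  proof -
    have "e * T * P = 0" using TP by (simp add: e_def)
    then have "e * T * (1 - P) = e * T" by (simp add: right_diff_distrib)
    then show ?thesis unfolding e_def[symmetric] by (metis mult.assoc)
  qed
  let ?A = "e * T * e + z *\<^sub>C P"
  have "peval (pCons a p) ?A = a *\<^sub>C 1 + ?A * (e * peval p T * e + poly p z *\<^sub>C P)"
    using pCons by (simp add: peval_pCons e_def)
  also have "?A * (e * peval p T * e + poly p z *\<^sub>C P) = e * (T * (peval p T * e)) + (z * poly p z) *\<^sub>C P"
    by (simp add: distrib_left distrib_right mult.assoc e e' eT PP scaleC_scaleC mult.commute)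
  also have "a *\<^sub>C 1 = a *\<^sub>C e + a *\<^sub>C P"
    by (simp add: e_def scaleC_add_right[symmetric])
  also have "a *\<^sub>C e + a *\<^sub>C P + (e * (T * (peval p T * e)) + (z * poly p z) *\<^sub>C P)
      = e * peval (pCons a p) T * e + poly (pCons a p) z *\<^sub>C P"
    by (simp add: peval_pCons distrib_left distrib_right mult.assoc e scaleC_add_left)
  finally show ?case by (simp add: e_def)
qed simp

lemma power_mult_commuting:
  fixes a b :: "'a::monoid_mult"
  assumes "a * b = b * a"
  shows "(a * b) ^ n = a ^ n * b ^ n"
proof (induction n)
  case (Suc n)
  have "(a * b) ^ Suc n = a * (b * a ^ n) * b ^ n" by (simp add: Suc mult.assoc)
  also have "b * a ^ n = a ^ n * b" using power_commuting_commutes[of a b n] assms by simp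
  finally show ?case by (simp add: mult.assoc)
qed simp

text \<open>
  Otherwise each \<open>z\<close> has some \<open>p\<close> with \<open>\<bar>p(z)\<bar> \<ge> 1\<close>. By the decay, \<open>p(z) - p(A)\<close> is invertible by a Neumann series
  for the compression \<open>A\<close> of \<open>T\<close>, and \<open>z - A\<close> is a factor of it. So the spectrum of \<open>A\<close> is empty.
\<close>

lemma ex_stable_point:
  fixes T P :: "'a::chilbert_space bop"
  assumes PP: "P * P = P" and TP: "(1 - P) * T * P = 0" and "P \<noteq> 1"
    and decays: "\<And>p. p \<in> set ps \<Longrightarrow> decays (\<lambda>n. (1 - P) * peval p T ^ n)"
  shows "\<exists>z. \<forall>p\<in>set ps. cmod (poly p z) < 1"
proof (rule ccontr)
  assume neg: "\<not> ?thesis"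
  define e where "e = 1 - P"
  define A where "A = e * T * e"
  have e: "e * e = e" "e * P = 0" "P * e = 0" by (simp_all add: e_def algebra_simps PP)
  have eA: "e * A = A" "A * e = A" by (simp_all add: A_def mult.assoc e) (simp_all add: mult.assoc[symmetric] e)
  have pA: "peval p A = e * peval p T * e + poly p 0 *\<^sub>C P" for p
    using peval_block_diagonal[OF PP TP, of p 0] by (simp add: A_def e_def)
  have "\<exists>R. R * e = R \<and> e * R = R \<and> (z *\<^sub>C e - A) * R = e \<and> R * (z *\<^sub>C e - A) = e" for z
  proof -
    obtain p where p: "p \<in> set ps" "cmod (poly p z) \<ge> 1" using neg by (meson not_le)
    define c where "c = poly p z"
    have c: "c \<noteq> 0" "cmod c \<ge> 1" using p by (auto simp: c_def)
    define Z where "Z = inverse c *\<^sub>C (e * peval p A)"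
    have comm: "e * peval q A = peval q A * e" for q
      by (rule peval_commutes[symmetric]) (simp add: eA)
    have Zn: "Z ^ Suc n = inverse c ^ Suc n *\<^sub>C (e * peval p T ^ Suc n * e)" for n
    proof -
      have en: "e ^ Suc n = e" by (induction n) (simp_all add: e)
      have "(e * peval p A) ^ Suc n = e ^ Suc n * peval p A ^ Suc n"
        using comm[of p] by (rule power_mult_commuting)
      also have "\<dots> = e * peval (p ^ Suc n) A" by (simp only: en peval_power)
      also have "\<dots> = e * peval (p ^ Suc n) T * e"
        unfolding pA by (simp add: distrib_left mult.assoc[symmetric] e)
      finally show ?thesis unfolding Z_def cscale_power by (simp only: peval_power)
    qed
    have "decays (\<lambda>n. Z ^ Suc n)"
    proof (rule decays_dominated[OF decays_shift[OF decays[OF p(1)], of 1], where B="norm e"])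
      fix n
      have "cmod (inverse c) ^ Suc n \<le> 1"
        using c by (intro power_le_one) (auto simp: norm_inverse inverse_le_1_iff)
      then have "norm (Z ^ Suc n) \<le> 1 * norm (e * peval p T ^ Suc n * e)"
        unfolding Zn norm_cscale norm_power by (intro mult_right_mono) auto
      also have "\<dots> \<le> norm e * norm (e * peval p T ^ Suc n)"
        using norm_mult_ineq[of "e * peval p T ^ Suc n" e] by (simp add: mult.commute)
      finally show "norm (Z ^ Suc n) \<le> norm e * norm ((1 - P) * peval p T ^ (n + 1))"
        by (simp add: e_def)
    qed simp
    then have "decays (\<lambda>n. Z ^ n)" by (rule decays_unshift)
    then obtain W where W: "(1 - Z) * W = 1" "W * (1 - Z) = 1" using neumann_inverse by blast
    have Wcomm: "W * B = B * W" if "Z * B = B * Z" for B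
    proof -
      have "W * B = W * (B * ((1 - Z) * W))" by (simp add: W)
      also have "\<dots> = W * ((B * (1 - Z)) * W)" by (simp only: mult.assoc)
      also have "B * (1 - Z) = (1 - Z) * B" using that by (simp add: algebra_simps)
      also have "W * ((1 - Z) * B * W) = (W * (1 - Z)) * (B * W)" by (simp only: mult.assoc)
      finally show ?thesis by (simp add: W)
    qed
    have Ze: "Z * e = e * Z" by (simp add: Z_def mult.assoc comm[of p, symmetric])
    have pAA: "peval q A * A = A * peval q A" for q by (rule peval_commutes) simp
    have ZA: "Z * A = A * Z"
      by (simp add: Z_def) (metis eA pAA mult.assoc)
    obtain q where "p - [:c:] = [:- z, 1:] * q"
      using poly_eq_0_iff_dvd[of "p - [:c:]" z] by (auto simp: c_def dvd_def)
    then have pz: "peval p A - c *\<^sub>C 1 = (A - z *\<^sub>C 1) * peval q A"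
      using arg_cong[of "p - [:c:]" "[:- z, 1:] * q" "\<lambda>p. peval p A"]
      unfolding peval_mult peval_diff by (simp add: peval_const peval_pCons scaleC_minus_left)
    have eAz: "e * (A - z *\<^sub>C 1) = - (z *\<^sub>C e - A)" by (simp add: right_diff_distrib eA)
    have "(z *\<^sub>C e - A) * peval q A = - (e * (A - z *\<^sub>C 1) * peval q A)"
      by (simp only: eAz mult_minus_left minus_minus)
    also have "\<dots> = - (e * (peval p A - c *\<^sub>C 1))" by (simp only: mult.assoc pz)
    also have "\<dots> = c *\<^sub>C e - e * peval p A" by (simp add: right_diff_distrib)
    also have "e * peval p A = c *\<^sub>C (e * Z)"
      using c(1) by (simp add: Z_def scaleC_scaleC mult.assoc[symmetric] e)
    also have "c *\<^sub>C e - c *\<^sub>C (e * Z) = c *\<^sub>C (e * (1 - Z))"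
      by (simp add: right_diff_distrib scaleC_diff_right)
    finally have Dq: "(z *\<^sub>C e - A) * peval q A = c *\<^sub>C (e * (1 - Z))" .
    \<comment> \<open>\<open>R\<close> is the quotient \<open>q\<close> of \<open>p(z) - p(A)\<close> by \<open>z - A\<close>, divided by \<open>p(z) - p(A)\<close>,
      all taken on the range of \<open>e\<close>; there \<open>c (1 - Z) = p(z) - p(A)\<close>.\<close>
    define D where "D = z *\<^sub>C e - A"
    define R where "R = inverse c *\<^sub>C (e * peval q A * W)"
    have eD: "e * D = D" "D * e = D" by (simp_all add: D_def algebra_simps e eA)
    have ZD: "Z * D = D * Z" by (simp add: D_def algebra_simps Ze ZA)
    have Dq': "D * peval q A = peval q A * D"
      by (simp add: D_def algebra_simps comm pAA)
    have "D * R = inverse c *\<^sub>C ((D * peval q A) * W)"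
      by (simp add: R_def mult.assoc[symmetric] eD)
    also have "\<dots> = (e * (1 - Z)) * W" using c(1) by (simp add: Dq[folded D_def] scaleC_scaleC)
    also have "\<dots> = e" by (simp add: mult.assoc W)
    finally have DR: "D * R = e" .
    have "R * D = inverse c *\<^sub>C (e * peval q A * (D * W))"
      by (simp add: R_def mult.assoc Wcomm[OF ZD])
    also have "e * peval q A * (D * W) = e * (D * peval q A) * W" by (simp only: Dq' mult.assoc)
    also have "\<dots> = D * (e * peval q A * W)" by (simp only: mult.assoc[symmetric] eD)
    finally have "R * D = D * R" by (simp add: R_def)
    moreover have "e * R = R" by (simp add: R_def mult.assoc[symmetric] e)
    moreover have "R * e = R"
    proof -
      have "R * e = inverse c *\<^sub>C (e * (peval q A * e) * W)"
        by (simp add: R_def mult.assoc Wcomm[OF Ze])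
      also have "peval q A * e = e * peval q A" by (rule comm[symmetric])
      also have "e * (e * peval q A) * W = e * peval q A * W" by (simp only: mult.assoc[symmetric] e)
      finally show ?thesis by (simp only: R_def)
    qed
    ultimately show ?thesis using DR unfolding D_def by (intro exI[of _ R]) simp
  qed
  then obtain R where "\<And>z. R z * e = R z" "\<And>z. e * R z = R z"
    "\<And>z. (z *\<^sub>C e - A) * R z = e" "\<And>z. R z * (z *\<^sub>C e - A) = e" by metis
  then have "e = 0" using spectrum_nonempty[OF e(1) eA(2) eA(1)] by blast
  with \<open>P \<noteq> 1\<close> show False by (simp add: e_def)
qed

lemma finrank_range_finite_dimensional:
  "finrank F \<Longrightarrow> \<exists>B. finite B \<and> (\<forall>x. app F x \<in> cspan B)"
proof (induction rule: finrank.induct)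
  case zero
  show ?case by (rule exI[of _ "{}"]) (auto intro: complex_vector.span_zero)
next
  case (add_rank_one F K)
  then obtain B where B: "finite B" "\<And>x. app F x \<in> cspan B" by blast
  obtain v where v: "\<And>x. \<exists>c. app K x = c *\<^sub>C v" using add_rank_one.hyps unfolding rank_one_def by blast
  have "app (F + K) x \<in> cspan (insert v B)" for x
  proof -
    obtain c where c: "app K x = c *\<^sub>C v" using v by blast
    have "app F x \<in> cspan (insert v B)"
      using B(2)[of x] complex_vector.span_mono[of B "insert v B"] by auto
    moreover have "c *\<^sub>C v \<in> cspan (insert v B)"
      by (intro complex_vector.span_scale complex_vector.span_base) simp
    ultimately show ?thesis by (simp add: app_add c complex_vector.span_add)
  qed
  then show ?case using B(1) by (intro exI[of _ "insert v B"]) auto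
qed

text \<open>
  With \<open>P\<close> the projection onto the kernel of the operator \<open>S\<close> of \<open>ex_proper_annihilator\<close>, the decay of
  \<open>S p(T)\<^sup>n\<close> passes to \<open>(1 - P) p(T)\<^sup>n\<close>, because \<open>S\<close> is bounded below on the complement of its kernel. Since the space is
  infinite-dimensional and \<open>P\<close> has finite rank, the complement is not zero.
\<close>

lemma ex_stable_perturbation:
  fixes T :: "'a::chilbert_space bop"
  assumes inf: "infinite_dimensional TYPE('a)"
    and ps: "\<forall>p\<in>set ps. \<exists>F. finrank F \<and> norm (peval p T - F) < 1"
  shows "\<exists>T'. finrank (T' - T) \<and> (\<forall>p\<in>set ps. decays (\<lambda>n. peval p T' ^ n))"
proof -
  obtain S where S: "proper S" "S * T = T * S" "\<And>p. p \<in> set ps \<Longrightarrow> decays (\<lambda>n. S * peval p T ^ n)"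
    using ex_proper_annihilator[OF ps] by blast
  obtain P where P: "finrank P" "orth_proj P" "S * P = 0" "\<And>x. app S x = 0 \<Longrightarrow> app P x = x"
    using ex_kernel_projection[OF S(1)] by blast
  obtain C where C: "C \<ge> 0" "\<And>y. norm (app (1 - P) y) \<le> C * norm (app S y)"
    using proper_bounded_below[OF S(1) P(2-4)] by blast
  have PP: "P * P = P" using P(2) by (simp add: orth_proj_def)
  have TP: "(1 - P) * T * P = 0"
  proof (rule bop_eqI)
    fix x
    have "app S (app T (app P x)) = app T (app (S * P) x)" by (metis S(2) app_mult)
    then have "app S (app T (app P x)) = 0" by (simp add: P(3))
    then show "app ((1 - P) * T * P) x = app 0 x" using P(4) by (simp add: app_simps)
  qed
  define e where "e = 1 - P"
  have decays_e: "decays (\<lambda>n. e * peval p T ^ n)" if "p \<in> set ps" for p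
  proof (rule decays_dominated[OF S(3)[OF that] _ C(1)])
    fix n
    show "norm (e * peval p T ^ n) \<le> C * norm (S * peval p T ^ n)"
    proof (rule norm_bop_le)
      fix x
      have "norm (app (e * peval p T ^ n) x) \<le> C * norm (app (S * peval p T ^ n) x)"
        unfolding e_def app_mult by (rule C(2))
      also have "\<dots> \<le> C * (norm (S * peval p T ^ n) * norm x)" by (intro mult_left_mono norm_app C(1))
      finally show "norm (app (e * peval p T ^ n) x) \<le> C * norm (S * peval p T ^ n) * norm x" by simp
    qed (use C(1) in simp)
  qed
  have "P \<noteq> 1"
  proof
    assume "P = 1"
    then obtain B :: "'a set" where "finite B" "\<And>x. app (1 :: 'a bop) x \<in> cspan B"
      using finrank_range_finite_dimensional P(1) by blast
    then have "finite B \<and> cspan B = UNIV" by auto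
    with inf show False unfolding infinite_dimensional_def by blast
  qed
  then obtain z where z: "\<And>p. p \<in> set ps \<Longrightarrow> cmod (poly p z) < 1"
    using ex_stable_point[OF PP TP _ decays_e[unfolded e_def]] by blast
  define T' where "T' = e * T * e + z *\<^sub>C P"
  have "T' - T = z *\<^sub>C P - P * T - T * P + P * T * P" by (simp add: T'_def e_def algebra_simps)
  then have "finrank (T' - T)"
    using P(1) by (simp add: finrank_add finrank_diff finrank_cscale finrank_mult_left finrank_mult_right)
  moreover have "decays (\<lambda>n. peval p T' ^ n)" if p: "p \<in> set ps" for p
  proof -
    have eq: "peval p T' ^ n = e * peval p T ^ n * e + poly p z ^ n *\<^sub>C P" for n
      using peval_block_diagonal[OF PP TP, of "p ^ n" z] by (simp add: T'_def e_def peval_power)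
    have "decays (\<lambda>n. e * peval p T ^ n * e)"
    proof (rule decays_dominated[OF decays_e[OF p], of _ "norm e"])
      show "norm (e * peval p T ^ n * e) \<le> norm e * norm (e * peval p T ^ n)" for n
        using norm_mult_ineq[of "e * peval p T ^ n" e] by (simp add: mult.commute)
    qed simp
    moreover have "decays (\<lambda>n. poly p z ^ n)"
      by (rule decays_power[of _ "cmod (poly p z)"]) (use z[OF p] in \<open>auto simp: norm_power\<close>)
    then have "decays (\<lambda>n. poly p z ^ n *\<^sub>C P)"
      by (rule decays_dominated[of _ _ "norm P"]) (auto simp: norm_cscale)
    ultimately show ?thesis unfolding eq by (rule decays_add)
  qed
  ultimately show ?thesis by blast
qed

lemma peval_similarity:
  fixes S S' T :: "'a::complex_inner bop"
  assumes "S' * S = 1" "S * S' = 1"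
  shows "peval p (S * T * S') = S * peval p T * S'"
proof (induction p)
  case (pCons a p)
  have "S * T * S' * (S * peval p T * S') = S * T * (S' * S) * peval p T * S'" by (simp only: mult.assoc)
  also have "\<dots> = S * (T * peval p T) * S'" by (simp add: assms mult.assoc)
  finally show ?case using assms pCons by (simp add: peval_pCons distrib_left distrib_right)
qed simp

text \<open>
  Both changes of \<open>T\<close> have finite rank: the passage to \<open>T'\<close>, which makes the powers of all \<open>p(T')\<close> decay, and the
  similarity that turns this decay into the norm bound.
\<close>

lemma ex_finrank_perturbation_normalized:
  fixes T :: "'a::chilbert_space bop"
  assumes inf: "infinite_dimensional TYPE('a)"
    and ps: "\<forall>p\<in>set ps. \<exists>F. finrank F \<and> norm (peval p T - F) < 1" and "\<epsilon> > 0"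
  shows "\<exists>K. finrank K \<and> (\<forall>p\<in>set ps. norm (peval p (T + K)) \<le> 1 + \<epsilon>)"
proof -
  obtain T' where T': "finrank (T' - T)" "\<And>p. p \<in> set ps \<Longrightarrow> decays (\<lambda>n. peval p T' ^ n)"
    using ex_stable_perturbation[OF inf ps] by blast
  have "\<exists>F. finrank F \<and> norm (peval p T' - F) < 1" if p: "p \<in> set ps" for p
  proof -
    obtain F where F: "finrank F" "norm (peval p T - F) < 1" using ps p by blast
    then show ?thesis
      using finrank_add[OF F(1) finrank_peval_diff[OF T'(1), of p]]
      by (intro exI[of _ "peval p T' - peval p T + F"]) (simp add: algebra_simps)
  qed
  then obtain S S' where S: "finrank_similarity S S'"
    "\<And>p. p \<in> set ps \<Longrightarrow> norm (S * peval p T' * S') \<le> 1 + \<epsilon>"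
    using simultaneous_similarity[of "map (\<lambda>p. peval p T') ps" \<epsilon>] T'(2) assms(3)
    by (auto simp: peval_commute)
  define K where "K = S * T' * S' - T"
  have "K = (S - 1) * (T' * S') + T' * (S' - 1) + (T' - T)" by (simp add: K_def algebra_simps)
  then have "finrank K"
    using S(1) T'(1) by (simp add: finrank_similarity_def finrank_add finrank_mult_left finrank_mult_right)
  moreover have "peval p (T + K) = S * peval p T' * S'" for p
    using S(1) peval_similarity[of S' S p T'] by (simp add: K_def finrank_similarity_def)
  ultimately show ?thesis using S(2) by auto
qed

text \<open>
  The normalised case for the polynomials \<open>p / c p\<close>, where \<open>c p\<close> lies between the essential norm of \<open>p(T)\<close> and
  the bound to be reached. The relative error is measured by the upper bound \<open>M\<close> of all \<open>c p\<close>.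
\<close>

lemma ex_finrank_perturbation:
  fixes T :: "'a::chilbert_space bop"
  assumes inf: "infinite_dimensional TYPE('a)" and "\<epsilon> > 0"
  shows "\<exists>K. finrank K \<and> (\<forall>p\<in>set ps. norm (peval p (T + K)) \<le> essential_norm (app (peval p T)) + \<epsilon>)"
proof -
  define c where "c p = essential_norm (app (peval p T)) + \<epsilon> / 2" for p
  have c: "c p > 0" for p using essential_norm_nonneg[of "peval p T"] assms(2) by (simp add: c_def)
  define M where "M = 1 + (\<Sum>p\<leftarrow>ps. c p)"
  have cM: "c p \<le> M" if "p \<in> set ps" for p
    using member_le_sum_list[of "c p" "map c ps"] that c by (force simp: M_def less_imp_le)
  have "0 \<le> (\<Sum>p\<leftarrow>ps. c p)" by (rule sum_list_nonneg) (use c in \<open>auto intro: less_imp_le\<close>)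
  then have M: "M > 0" by (simp add: M_def)
  define qs where "qs = map (\<lambda>p. smult (complex_of_real (inverse (c p))) p) ps"
  have "\<exists>F. finrank F \<and> norm (peval q T - F) < 1" if "q \<in> set qs" for q
  proof -
    obtain p where p: "q = smult (complex_of_real (inverse (c p))) p" using \<open>q \<in> set qs\<close> by (auto simp: qs_def)
    obtain F where F: "finrank F" "norm (peval p T - F) < c p"
      using essential_norm_less_finrank[of "peval p T" "c p"] assms(2) by (auto simp: c_def)
    have "peval q T - complex_of_real (inverse (c p)) *\<^sub>C F = complex_of_real (inverse (c p)) *\<^sub>C (peval p T - F)"
      by (simp add: p peval_smult scaleC_diff_right)
    then have "norm (peval q T - complex_of_real (inverse (c p)) *\<^sub>C F) < 1"
      using F(2) c[of p] by (simp only: norm_cscale norm_of_real) (simp add: field_simps)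
    then show ?thesis using finrank_cscale[OF F(1)] by blast
  qed
  then obtain K where K: "finrank K" "\<And>q. q \<in> set qs \<Longrightarrow> norm (peval q (T + K)) \<le> 1 + \<epsilon> / (2 * M)"
    using ex_finrank_perturbation_normalized[OF inf, of qs T "\<epsilon> / (2 * M)"] assms(2) M by auto
  have "norm (peval p (T + K)) \<le> essential_norm (app (peval p T)) + \<epsilon>" if p: "p \<in> set ps" for p
  proof -
    have "norm (peval (smult (complex_of_real (inverse (c p))) p) (T + K)) \<le> 1 + \<epsilon> / (2 * M)"
      using p by (intro K(2)) (simp add: qs_def)
    then have "inverse (c p) * norm (peval p (T + K)) \<le> 1 + \<epsilon> / (2 * M)"
      using c[of p] by (simp add: peval_smult norm_cscale norm_inverse)
    then have "norm (peval p (T + K)) \<le> c p * (1 + \<epsilon> / (2 * M))"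
      using c[of p] by (simp add: field_simps)
    also have "\<dots> = c p + c p * (\<epsilon> / (2 * M))" by (simp add: distrib_left)
    also have "\<dots> \<le> c p + M * (\<epsilon> / (2 * M))"
      using cM[OF p] M assms(2) by (intro add_left_mono mult_right_mono) auto
    also have "\<dots> = essential_norm (app (peval p T)) + \<epsilon>" using M by (simp add: c_def)
    finally show ?thesis .
  qed
  with K(1) show ?thesis by blast
qed

section \<open>Passing to all polynomials\<close>

definition rational_polys :: "complex poly set" where
  "rational_polys = {p. \<forall>i. coeff p i \<in> {Complex a b |a b. a \<in> \<rat> \<and> b \<in> \<rat>}}"

lemma countable_rational_polys: "countable rational_polys"
proof -
  let ?Q = "{Complex a b |a b. a \<in> \<rat> \<and> b \<in> \<rat>}"
  have "?Q = (\<lambda>(a, b). Complex a b) ` (\<rat> \<times> \<rat>)" by auto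
  then have "countable ?Q" by (simp add: countable_rat)
  then have "countable (Poly ` lists ?Q)" by (intro countable_image countable_lists)
  moreover have "rational_polys \<subseteq> Poly ` lists ?Q"
  proof
    fix p assume "p \<in> rational_polys"
    then have "coeffs p \<in> lists ?Q" by (auto simp: rational_polys_def coeffs_def in_lists_conv_set)
    then show "p \<in> Poly ` lists ?Q" by (intro image_eqI[of _ Poly "coeffs p"]) simp_all
  qed
  ultimately show ?thesis by (rule countable_subset[rotated])
qed

lemma rational_complex_dense:
  assumes "\<epsilon> > 0"
  shows "\<exists>a\<in>\<rat>. \<exists>b\<in>\<rat>. cmod (z - Complex a b) < \<epsilon>"
proof -
  obtain a where a: "a \<in> \<rat>" "Re z < a" "a < Re z + \<epsilon> / 2"
    using Rats_dense_in_real[of "Re z" "Re z + \<epsilon> / 2"] assms by auto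
  obtain b where b: "b \<in> \<rat>" "Im z < b" "b < Im z + \<epsilon> / 2"
    using Rats_dense_in_real[of "Im z" "Im z + \<epsilon> / 2"] assms by auto
  have "cmod (z - Complex a b) \<le> \<bar>Re z - a\<bar> + \<bar>Im z - b\<bar>"
    using cmod_le[of "z - Complex a b"] by simp
  also have "\<dots> < \<epsilon>" using a b by (simp add: abs_if)
  finally show ?thesis using a(1) b(1) by blast
qed

text \<open>
  Approximating each coefficient within \<open>\<eta> / s\<close>, where \<open>s\<close> exceeds \<open>1 + M + \<dots> + M\<^sup>d\<close>, is uniform over all
  operators of norm at most \<open>M\<close>.
\<close>

lemma rational_poly_approx:
  assumes "\<eta> > 0" "M \<ge> 0"
  shows "\<exists>r\<in>rational_polys. \<forall>A :: 'a::complex_inner bop. norm A \<le> M \<longrightarrow> norm (peval p A - peval r A) \<le> \<eta>"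
proof -
  define d where "d = degree p"
  define s where "s = 1 + (\<Sum>i\<le>d. M ^ i)"
  have s: "s > 0" using assms(2) by (auto simp: s_def intro!: add_pos_nonneg sum_nonneg)
  have "\<forall>i. \<exists>a\<in>\<rat>. \<exists>b\<in>\<rat>. cmod (coeff p i - Complex a b) < \<eta> / s"
    using rational_complex_dense assms(1) s by simp
  then obtain a b where ab: "\<And>i. a i \<in> \<rat>" "\<And>i. b i \<in> \<rat>" "\<And>i. cmod (coeff p i - Complex (a i) (b i)) < \<eta> / s"
    by metis
  define r where "r = Poly (map (\<lambda>i. Complex (a i) (b i)) [0..<Suc d])"
  have coeff_r: "coeff r i = (if i \<le> d then Complex (a i) (b i) else 0)" for i
    by (auto simp: r_def nth_default_def simp del: upt_Suc)
  have "r \<in> rational_polys"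
    using ab(1,2) by (auto simp: rational_polys_def coeff_r zero_complex.code intro!: exI[of _ 0])
  moreover have "norm (peval p A - peval r A) \<le> \<eta>" if "norm A \<le> M" for A :: "'a bop"
  proof -
    have deg: "degree (p - r) \<le> d"
      by (intro degree_diff_le degree_le) (auto simp: d_def coeff_r coeff_eq_0)
    have "norm (peval p A - peval r A) = norm (\<Sum>i\<le>d. coeff (p - r) i *\<^sub>C A ^ i)"
      by (simp add: peval_diff[symmetric] peval_bound[OF deg])
    also have "\<dots> \<le> (\<Sum>i\<le>d. \<eta> / s * M ^ i)"
    proof (rule sum_norm_le)
      fix i assume i: "i \<in> {..d}"
      have "norm (A ^ i) \<le> M ^ i"
        by (rule order_trans[OF norm_power_le power_mono[OF that norm_ge_zero]])
      then show "norm (coeff (p - r) i *\<^sub>C A ^ i) \<le> \<eta> / s * M ^ i"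
        unfolding norm_cscale using ab(3)[of i] i assms s
        by (intro mult_mono) (auto simp: coeff_r)
    qed
    also have "\<dots> = \<eta> / s * (s - 1)" by (simp add: s_def sum_distrib_left)
    also have "\<dots> \<le> \<eta>" using s assms(1) by (simp add: field_simps)
    finally show ?thesis .
  qed
  ultimately show ?thesis by blast
qed

theorem theorem15:
  fixes T :: "'a::chilbert_space \<Rightarrow> 'a"
  assumes "infinite_dimensional TYPE('a)"
    and "bounded_clinear T"
  shows "\<exists>K :: nat \<Rightarrow> 'a \<Rightarrow> 'a.
           (\<forall>n\<ge>1. compact_operator (K n)) \<and>
           (\<forall>p :: complex poly.
              (\<lambda>n. onorm (poly_op p (\<lambda>x. T x + K n x))) \<longlonglongrightarrow> essential_norm (poly_op p T))"
proof -
  obtain A where A: "T = app A" using assms(2) by (metis Bop_inverse mem_Collect_eq)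
  define f where "f = from_nat_into rational_polys"
  have ne: "rational_polys \<noteq> {}" by (auto simp: rational_polys_def zero_complex.code intro!: exI[of _ 0])
  \<comment> \<open>The polynomial \<open>[:0, 1:]\<close> heads every list: it bounds \<open>\<parallel>A + K n\<parallel>\<close> independently of \<open>n\<close>.\<close>
  have "\<exists>K. finrank K \<and> (\<forall>p\<in>set ([:0, 1:] # map f [0..<n]).
      norm (peval p (A + K)) \<le> essential_norm (app (peval p A)) + 1 / real (Suc n))" for n
    by (rule ex_finrank_perturbation[OF assms(1)]) simp
  then obtain K where K: "\<And>n. finrank (K n)"
    "\<And>n p. p \<in> set ([:0, 1:] # map f [0..<n]) \<Longrightarrow>
      norm (peval p (A + K n)) \<le> essential_norm (app (peval p A)) + 1 / real (Suc n)" by metis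
  define M where "M = norm A + essential_norm (app A) + 1"
  have AM: "norm A \<le> M" using essential_norm_nonneg[of A] by (simp add: M_def)
  have KM: "norm (A + K n) \<le> M" for n
  proof -
    have "norm (A + K n) \<le> essential_norm (app A) + 1 / real (Suc n)"
      using K(2)[of "[:0, 1:]" n] by (simp add: peval_pCons)
    also have "\<dots> \<le> M" by (simp add: M_def field_simps)
    finally show ?thesis .
  qed
  have M: "M \<ge> 0" using AM norm_ge_zero order_trans by blast
  have lim: "(\<lambda>n. norm (peval p (A + K n))) \<longlonglongrightarrow> essential_norm (app (peval p A))" for p
  proof (rule LIMSEQ_I)
    fix \<eta> :: real assume \<eta>: "\<eta> > 0"
    obtain r where r: "r \<in> rational_polys"
      "\<And>B :: 'a bop. norm B \<le> M \<Longrightarrow> norm (peval p B - peval r B) \<le> \<eta> / 4"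
      using rational_poly_approx[of "\<eta> / 4" M p] \<eta> M by auto
    obtain m where m: "f m = r"
      using from_nat_into_surj[OF countable_rational_polys r(1)] by (auto simp: f_def)
    obtain N where N: "inverse (real (Suc N)) < \<eta> / 4" using reals_Archimedean[of "\<eta> / 4"] \<eta> by auto
    have "norm (norm (peval p (A + K n)) - essential_norm (app (peval p A))) < \<eta>"
      if n: "n \<ge> max N (Suc m)" for n
    proof -
      have "r \<in> set ([:0, 1:] # map f [0..<n])" using n m by auto
      then have "norm (peval r (A + K n)) \<le> essential_norm (app (peval r A)) + 1 / real (Suc n)" by (rule K(2))
      moreover have "1 / real (Suc n) \<le> inverse (real (Suc N))" using n by (simp add: field_simps)
      moreover have "norm (peval p (A + K n)) \<le> norm (peval r (A + K n)) + norm (peval p (A + K n) - peval r (A + K n))"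
        by (rule norm_triangle_sub)
      moreover have "norm (peval p (A + K n) - peval r (A + K n)) \<le> \<eta> / 4" by (rule r(2)[OF KM])
      moreover have "essential_norm (app (peval r A)) \<le> essential_norm (app (peval p A)) + norm (peval r A - peval p A)"
        by (rule essential_norm_lipschitz)
      moreover have "norm (peval r A - peval p A) \<le> \<eta> / 4" using r(2)[OF AM] by (simp add: norm_minus_commute)
      moreover have "essential_norm (app (peval p A)) \<le> norm (peval p (A + K n))"
        by (rule essential_norm_finrank_le[OF finrank_peval_diff]) (simp add: K(1))
      ultimately show ?thesis using N unfolding real_norm_def by linarith
    qed
    then show "\<exists>no. \<forall>n\<ge>no. norm (norm (peval p (A + K n)) - essential_norm (app (peval p A))) < \<eta>" by blast
  qed
  have sum: "(\<lambda>x. app A x + app (K n) x) = app (A + K n)" for n by (simp add: fun_eq_iff app_add)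
  show ?thesis
    using finrank_compact_operator[OF K(1)] lim
    by (intro exI[of _ "\<lambda>n. app (K n)"]) (simp add: A sum poly_op_app norm_bop_onorm[symmetric])
qed

end
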